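(* Let $n\ge1$, let $\lambda,\mu,\nu,\rho$ be partitions of length $n$ and let $\kappa$ be a partition of length $2n$. Then $$c_{\lambda/\mu,\nu/\rho}^{\kappa}=\big|\mathrm{SkewSkep}_{\lambda/\mu,\nu/\rho}^{\kappa}\big|.$$
   Context: A partition of length $m$ is a weakly decreasing sequence of $m$ nonnegative integers. $c_{\lambda/\mu,\nu/\rho}^\kappa$ is the coefficient of $s_\kappa$ in the product $s_{\lambda/\mu}s_{\nu/\rho}$ of skew Schur functions ($s_{\lambda/\mu}=0$ if $\mu\not\subseteq\lambda$). Let $\Delta_{m}=\{(i,j)\in\mathbb{Z}_{\ge0}^2: i+j\le m\}$. A skew skep is a function $h:\Delta_{2n}\to\mathbb{Z}$ such that, for all $(i,j)$ for which all indices occurring lie in $\Delta_{2n}$: $$h_{i,j}+h_{i+1,j}\ge h_{i,j+1}+h_{i+1,j-1},$$ $$h_{i,j}+h_{i,j+1}\ge h_{i+1,j}+h_{i-1,j+1},$$ $$h_{i,j}+h_{i+1,j}\ge h_{i,j-1}+h_{i+1,j+1},$$ $$h_{i,j}+h_{i,j+1}\ge h_{i-1,j}+h_{i+1,j+1}.$$ Define $h^{\uparrow}=(h_{0,1}-h_{0,0},\,h_{0,2}-h_{0,1},\ldots,h_{0,2n}-h_{0,2n-1})$, $h^{\rightarrow}=(h_{1,0}-h_{0,0},\,h_{2,0}-h_{1,0},\ldots,h_{2n,0}-h_{2n-1,0})$, $h^{\nwarrow}=(h_{2n-1,1}-h_{2n,0},\,h_{2n-2,2}-h_{2n-1,1},\ldots,h_{0,2n}-h_{1,2n-1})$.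 $\mathrm{SkewSkep}_{\lambda/\mu,\nu/\rho}^{\kappa}$ is the set of skew skeps with $h_{0,0}=0$, $h^\uparrow=(\lambda_1,\nu_1,\lambda_2,\nu_2,\ldots,\lambda_n,\nu_n)$, $h^\rightarrow=(\mu_1,\rho_1,\mu_2,\rho_2,\ldots,\mu_n,\rho_n)$ and $h^\nwarrow=\kappa$. *)

theory Defs
  imports Complex_Main "HOL-Library.Multiset" "HOL-Library.FuncSet" "HOL-Library.Function_Algebras"
begin

text \<open>
  A partition of length \<open>m\<close> is a function \<open>p :: nat \<Rightarrow> nat\<close> with \<open>p 0 \<ge> p 1 \<ge> \<dots>\<close> which vanishes
  from index \<open>m\<close> on; \<open>p i\<close> is the part with the conventional index \<open>i + 1\<close>. In this way sequences
  that differ only in trailing zeros are the same partition, so that every Schur function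
  occurs only once in the Schur basis below.
\<close>

definition partition_len :: "nat \<Rightarrow> (nat \<Rightarrow> nat) \<Rightarrow> bool" where
  "partition_len m p \<longleftrightarrow> antimono p \<and> (\<forall>i\<ge>m. p i = 0)"

text \<open>
  A formal power series with integer coefficients in the variables \<open>x\<^sub>0, x\<^sub>1, x\<^sub>2, \<dots>\<close> is
  represented by its coefficient function; a monomial is the multiset of the indices of its
  variables. Addition is the pointwise one, but multiplication is \<open>series_mult\<close>, not the
  pointwise \<open>*\<close>.
\<close>

type_synonym series = "nat multiset \<Rightarrow> int"

definition series_scale :: "int \<Rightarrow> series \<Rightarrow> series" where
  "series_scale c f = (\<lambda>M. c * f M)"

definition series_mult :: "series \<Rightarrow> series \<Rightarrow> series" where
  "series_mult f g = (\<lambda>M. \<Sum>(A, B) \<in> {(A, B). A + B = M}. f A * g B)"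

interpretation series: module series_scale
  by unfold_locales (auto simp: series_scale_def algebra_simps fun_eq_iff)

definition skew_diagram :: "(nat \<Rightarrow> nat) \<Rightarrow> (nat \<Rightarrow> nat) \<Rightarrow> (nat \<times> nat) set" where
  "skew_diagram lam mu = {(i, j). mu i \<le> j \<and> j < lam i}"

definition skew_ssyt :: "(nat \<Rightarrow> nat) \<Rightarrow> (nat \<Rightarrow> nat) \<Rightarrow> (nat \<times> nat \<Rightarrow> nat) set" where
  "skew_ssyt lam mu = {T \<in> skew_diagram lam mu \<rightarrow>\<^sub>E UNIV.
     (\<forall>i j j'. (i, j) \<in> skew_diagram lam mu \<longrightarrow> (i, j') \<in> skew_diagram lam mu \<longrightarrow> j < j' \<longrightarrow>
        T (i, j) \<le> T (i, j')) \<and>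
     (\<forall>i i' j. (i, j) \<in> skew_diagram lam mu \<longrightarrow> (i', j) \<in> skew_diagram lam mu \<longrightarrow> i < i' \<longrightarrow>
        T (i, j) < T (i', j))}"

definition content :: "(nat \<Rightarrow> nat) \<Rightarrow> (nat \<Rightarrow> nat) \<Rightarrow> (nat \<times> nat \<Rightarrow> nat) \<Rightarrow> nat multiset" where
  "content lam mu T = image_mset T (mset_set (skew_diagram lam mu))"

definition skew_schur :: "(nat \<Rightarrow> nat) \<Rightarrow> (nat \<Rightarrow> nat) \<Rightarrow> series" where
  "skew_schur lam mu =
     (if \<forall>i. mu i \<le> lam i
      then (\<lambda>M. int (card {T \<in> skew_ssyt lam mu. content lam mu T = M}))
      else (\<lambda>M. 0))"

definition schur :: "(nat \<Rightarrow> nat) \<Rightarrow> series" where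
  "schur lam = skew_schur lam (\<lambda>i. 0)"

definition schur_basis :: "series set" where
  "schur_basis = {schur p | p. \<exists>m. partition_len m p}"

text \<open>\<open>lr_coeff lam mu nu rho kappa\<close> is $c_{\lambda/\mu,\nu/\rho}^{\kappa}$.\<close>

definition lr_coeff ::
    "(nat \<Rightarrow> nat) \<Rightarrow> (nat \<Rightarrow> nat) \<Rightarrow> (nat \<Rightarrow> nat) \<Rightarrow> (nat \<Rightarrow> nat) \<Rightarrow> (nat \<Rightarrow> nat) \<Rightarrow> int" where
  "lr_coeff lam mu nu rho kappa =
     series.representation schur_basis
       (series_mult (skew_schur lam mu) (skew_schur nu rho)) (schur kappa)"

definition Delta :: "nat \<Rightarrow> (int \<times> int) set" where
  "Delta m = {(i, j). 0 \<le> i \<and> 0 \<le> j \<and> i + j \<le> int m}"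

text \<open>Functions on \<open>Delta (2 * n)\<close> are taken in the extensional function space, so that
  distinct elements of the set below are distinct functions on \<open>Delta (2 * n)\<close>.\<close>

definition skew_skeps :: "nat \<Rightarrow> (int \<times> int \<Rightarrow> int) set" where
  "skew_skeps n = {h \<in> Delta (2 * n) \<rightarrow>\<^sub>E UNIV.
     (\<forall>i j. {(i, j), (i + 1, j), (i, j + 1), (i + 1, j - 1)} \<subseteq> Delta (2 * n) \<longrightarrow>
        h (i, j) + h (i + 1, j) \<ge> h (i, j + 1) + h (i + 1, j - 1)) \<and>
     (\<forall>i j. {(i, j), (i, j + 1), (i + 1, j), (i - 1, j + 1)} \<subseteq> Delta (2 * n) \<longrightarrow>
        h (i, j) + h (i, j + 1) \<ge> h (i + 1, j) + h (i - 1, j + 1)) \<and>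
     (\<forall>i j. {(i, j), (i + 1, j), (i, j - 1), (i + 1, j + 1)} \<subseteq> Delta (2 * n) \<longrightarrow>
        h (i, j) + h (i + 1, j) \<ge> h (i, j - 1) + h (i + 1, j + 1)) \<and>
     (\<forall>i j. {(i, j), (i, j + 1), (i - 1, j), (i + 1, j + 1)} \<subseteq> Delta (2 * n) \<longrightarrow>
        h (i, j) + h (i, j + 1) \<ge> h (i - 1, j) + h (i + 1, j + 1))}"

text \<open>The boundary vectors, with entries indexed by \<open>0, \<dots>, 2 * n - 1\<close>.\<close>

definition h_up :: "(int \<times> int \<Rightarrow> int) \<Rightarrow> nat \<Rightarrow> int" where
  "h_up h k = h (0, int k + 1) - h (0, int k)"

definition h_right :: "(int \<times> int \<Rightarrow> int) \<Rightarrow> nat \<Rightarrow> int" where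
  "h_right h k = h (int k + 1, 0) - h (int k, 0)"

definition h_nw :: "nat \<Rightarrow> (int \<times> int \<Rightarrow> int) \<Rightarrow> nat \<Rightarrow> int" where
  "h_nw n h k =
     h (2 * int n - int k - 1, int k + 1) - h (2 * int n - int k, int k)"

definition interleave :: "(nat \<Rightarrow> nat) \<Rightarrow> (nat \<Rightarrow> nat) \<Rightarrow> nat \<Rightarrow> nat" where
  "interleave p q k = (if even k then p (k div 2) else q (k div 2))"

definition SkewSkep ::
    "nat \<Rightarrow> (nat \<Rightarrow> nat) \<Rightarrow> (nat \<Rightarrow> nat) \<Rightarrow> (nat \<Rightarrow> nat) \<Rightarrow> (nat \<Rightarrow> nat) \<Rightarrow> (nat \<Rightarrow> nat) \<Rightarrow>
     (int \<times> int \<Rightarrow> int) set" where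
  "SkewSkep n lam mu nu rho kappa = {h \<in> skew_skeps n.
     h (0, 0) = 0 \<and>
     (\<forall>k<2 * n. h_up h k = int (interleave lam nu k)) \<and>
     (\<forall>k<2 * n. h_right h k = int (interleave mu rho k)) \<and>
     (\<forall>k<2 * n. h_nw n h k = int (kappa k))}"

end

theory Submission
  imports Defs
begin

text \<open>
  Along the antidiagonal \<open>i + j = m\<close> the differences of a skew skep form a partition \<open>Z\<^sub>m\<close>. The first two
  skep inequalities say that consecutive partitions interlace, so a skew skep is a Gelfand-Tsetlin pattern
  with top row \<open>kappa\<close>. Equivalently, it is a semistandard tableau of shape \<open>kappa\<close> in the letters
  \<open>x\<^sub>1 < y\<^sub>1 < x\<^sub>2 < y\<^sub>2 < \<dots>\<close>, and the boundary conditions prescribe that \<open>x\<^sub>i\<close> occurs as often as row \<open>i\<close> of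
  \<open>lam / mu\<close> has cells and \<open>y\<^sub>i\<close> as often as row \<open>i\<close> of \<open>nu / rho\<close> has cells.

  The other two inequalities bound a crystal statistic. For neighbouring letters 1 and 2 of a tableau let
  epsilon be the number of letters 2 that stay unmatched in the usual bracketing. In the classical
  Littlewood-Richardson rule for \<open>lam / mu\<close>, in its companion form, the tableaux with row lengths of
  \<open>lam / mu\<close> as content are counted that satisfy \<open>epsilon \<le> mu i - mu (i + 1)\<close> for the letters \<open>i\<close> and
  \<open>i + 1\<close>. In a skep the letters \<open>x\<^sub>i\<close> and \<open>x\<^sub>i\<^sub>+\<^sub>1\<close> are separated by \<open>y\<^sub>i\<close>. If \<open>y\<^sub>i\<close> is moved away by a
  Bender-Knuth involution, then the bound \<open>epsilon \<le> mu i - mu (i + 1)\<close> turns out to be exactly the last two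
  skep inequalities, no matter whether \<open>y\<^sub>i\<close> was moved to the left or to the right
  (\<open>eps_le_iff_eps3_le_lower\<close>, \<open>eps_le_iff_eps3_le_upper\<close>). Hence a letter \<open>y\<close> can pass across
  \<open>x\<^sub>i\<close> and \<open>x\<^sub>i\<^sub>+\<^sub>1\<close> without changing their epsilon, and vice versa. A triangular diagram of such moves sorts the
  letters into the order \<open>x\<^sub>1 \<dots> x\<^sub>n y\<^sub>1 \<dots> y\<^sub>n\<close> and keeps all bounds (\<open>card_zigzags\<close>). A sorted tableau consists
  of the shape \<open>al\<close> reached after the letters \<open>x\<close>, a Littlewood-Richardson chain for \<open>lam / mu\<close> from the empty
  shape to \<open>al\<close>, and one for \<open>nu / rho\<close> from \<open>al\<close> to \<open>kappa\<close>.

  It remains to show the Littlewood-Richardson rule for a product of a Schur function of shape \<open>al\<close> and a skew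
  Schur function (\<open>nchains_product\<close>), which is then used twice: for \<open>lam / mu\<close> and the empty shape, and for
  \<open>nu / rho\<close> and \<open>al\<close>. The rule follows from the Robinson-Schensted-Knuth correspondence in
  Fomin's form. Growing one row of squares with labels the multiplicities of a letter in the rows of
  the skew tableau changes epsilon by a simple formula (\<open>eps_le_rsk\<close>), and this formula turns the condition that
  the skew tableau is semistandard into the bounds on epsilon. Finally, Schur functions are linearly
  independent by unitriangularity with respect to dominance, so the coefficients of this expansion are
  the numbers \<open>lr_coeff\<close>.
\<close>

section \<open>Partitions and horizontal strips\<close>

definition is_partition :: "(nat \<Rightarrow> nat) \<Rightarrow> bool" where
  "is_partition p \<longleftrightarrow> (\<exists>m. partition_len m p)"

text \<open>
  The skew shape \<open>q / p\<close> has at most one cell in each column.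
\<close>

definition hstrip :: "(nat \<Rightarrow> nat) \<Rightarrow> (nat \<Rightarrow> nat) \<Rightarrow> bool" where
  "hstrip p q \<longleftrightarrow> (\<forall>k. p k \<le> q k \<and> q (Suc k) \<le> p k)"

definition psum :: "(nat \<Rightarrow> nat) \<Rightarrow> nat \<Rightarrow> nat" where
  "psum p j = (\<Sum>k<j. p k)"

definition psize :: "(nat \<Rightarrow> nat) \<Rightarrow> nat" where
  "psize p = (\<Sum>k | p k \<noteq> 0. p k)"

lemma psum_simps [simp]: "psum p 0 = 0" "psum p (Suc j) = psum p j + p j"
  by (simp_all add: psum_def)

lemma psize_eq_psum: "(\<And>k. k \<ge> L \<Longrightarrow> p k = 0) \<Longrightarrow> psize p = psum p L"
  unfolding psize_def psum_def
proof (rule sum.mono_neutral_left)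
  assume *: "\<And>k. L \<le> k \<Longrightarrow> p k = 0"
  show "{k. p k \<noteq> 0} \<subseteq> {..<L}"
    using * by (metis (mono_tags) lessThan_iff linorder_not_less mem_Collect_eq subsetI)
qed auto

lemma psize_partition_len: "partition_len L p \<Longrightarrow> psize p = psum p L"
  by (rule psize_eq_psum) (simp add: partition_len_def)

lemma partition_len_mono: "partition_len m p \<Longrightarrow> m \<le> m' \<Longrightarrow> partition_len m' p"
  by (simp add: partition_len_def)

lemma partition_lenI: "(\<And>k. p (Suc k) \<le> p k) \<Longrightarrow> (\<And>k. k \<ge> m \<Longrightarrow> p k = 0) \<Longrightarrow> partition_len m p"
  by (simp add: partition_len_def decseq_Suc_iff)

lemma partition_lenD:
  assumes "partition_len m p"
  shows "i \<le> j \<Longrightarrow> p j \<le> p i" and "k \<ge> m \<Longrightarrow> p k = 0"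
  using assms by (auto simp: partition_len_def antimono_def)

lemma is_partition_zero [simp]: "is_partition (\<lambda>_. 0)" "partition_len m (\<lambda>_. 0)"
  by (auto simp: is_partition_def partition_len_def antimono_def)

lemma partition_len_is_partition: "partition_len m p \<Longrightarrow> is_partition p"
  by (auto simp: is_partition_def)

lemma is_partition_common_len:
  assumes "is_partition p" "is_partition q"
  obtains L where "partition_len L p" "partition_len L q"
proof -
  obtain a b where "partition_len a p" "partition_len b q"
    using assms by (auto simp: is_partition_def)
  then show ?thesis
    using that[of "max a b"] partition_len_mono by simp
qed

lemma is_partition_common_len4:
  assumes "is_partition p" "is_partition q" "is_partition r" "is_partition s"
  obtains L where "partition_len L p" "partition_len L q" "partition_len L r" "partition_len L s"
proof -
  obtain a where "partition_len a p" "partition_len a q"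
    using is_partition_common_len[OF assms(1,2)] .
  moreover obtain b where "partition_len b r" "partition_len b s"
    using is_partition_common_len[OF assms(3,4)] .
  ultimately show ?thesis
    using that[of "max a b"] partition_len_mono by simp
qed

lemma psize_zero [simp]: "psize (\<lambda>_. 0) = 0"
  by (simp add: psize_def)

lemma psum_mono: "(\<And>k. p k \<le> q k) \<Longrightarrow> psum p j \<le> psum q j"
  unfolding psum_def by (rule sum_mono) auto

lemma psum_mono_index: "i \<le> j \<Longrightarrow> psum p i \<le> psum p j"
  unfolding psum_def by (rule sum_mono2) auto

lemma psize_mono: "is_partition p \<Longrightarrow> is_partition q \<Longrightarrow> (\<And>k. p k \<le> q k) \<Longrightarrow> psize p \<le> psize q"
proof -
  assume *: "is_partition p" "is_partition q" "\<And>k. p k \<le> q k"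
  obtain L where "partition_len L p" "partition_len L q"
    using is_partition_common_len[OF *(1,2)] .
  then show ?thesis using psum_mono *(3) by (simp add: psize_partition_len)
qed

lemma psum_le_psize: "is_partition p \<Longrightarrow> psum p j \<le> psize p"
proof -
  assume "is_partition p"
  then obtain L where "partition_len L p" by (auto simp: is_partition_def)
  then have "partition_len (max L j) p" by (rule partition_len_mono) simp
  then show ?thesis by (simp add: psize_partition_len psum_mono_index)
qed

lemma psize_mono_eqD:
  assumes "is_partition p" "is_partition q" and le: "\<And>k. p k \<le> q k" and eq: "psize p = psize q"
  shows "p = q"
proof
  fix k
  obtain L where L: "partition_len L p" "partition_len L q"
    using is_partition_common_len[OF assms(1,2)] .
  have "sum p {..<L} = sum q {..<L}"
    using eq L by (simp add: psize_partition_len psum_def)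
  then have "k < L \<Longrightarrow> p k = q k"
    using sum_mono_inv[of p "{..<L}" q k] le by auto
  then show "p k = q k"
    using L by (cases "k < L") (auto simp: partition_len_def)
qed

lemma is_partition_psize_0D: "is_partition p \<Longrightarrow> psize p = 0 \<Longrightarrow> p = (\<lambda>_. 0)"
  using psize_mono_eqD[of "\<lambda>_. 0" p] by auto

lemma hstripD: "hstrip p q \<Longrightarrow> p k \<le> q k" "hstrip p q \<Longrightarrow> q (Suc k) \<le> p k"
  by (auto simp: hstrip_def)

lemma hstrip_antimono: assumes "hstrip p q" shows "antimono p" "antimono q"
proof -
  have "p (Suc k) \<le> q (Suc k)" "q (Suc k) \<le> p k" "p k \<le> q k" for k
    using assms by (auto simp: hstrip_def)
  then show "antimono p" "antimono q"
    unfolding decseq_Suc_iff by (meson order_trans)+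
qed

lemma hstrip_len_up:
  assumes "hstrip p q" "partition_len m p" shows "partition_len (Suc m) q"
proof -
  have "q k = 0" if "k \<ge> Suc m" for k
    using hstripD(2)[OF assms(1), of "k - 1"] partition_lenD(2)[OF assms(2), of "k - 1"] that by simp
  then show ?thesis using hstrip_antimono[OF assms(1)] by (simp add: partition_len_def)
qed

lemma hstrip_len_down:
  assumes "hstrip p q" "partition_len m q" shows "partition_len m p"
proof -
  have "p k = 0" if "k \<ge> m" for k
    using hstripD(1)[OF assms(1), of "k"] partition_lenD(2)[OF assms(2), of "k"] that by simp
  then show ?thesis using hstrip_antimono[OF assms(1)] by (simp add: partition_len_def)
qed

lemma hstrip_is_partition: "hstrip p q \<Longrightarrow> is_partition p \<longleftrightarrow> is_partition q"
  unfolding is_partition_def using hstrip_len_up hstrip_len_down by blast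

lemma hstrip_psize_le: "hstrip p q \<Longrightarrow> is_partition p \<Longrightarrow> psize p \<le> psize q"
  by (rule psize_mono) (auto simp: hstrip_is_partition[symmetric] hstrip_def)

lemma finite_below:
  assumes "is_partition q" shows "finite {p. \<forall>k. p k \<le> q k}"
proof -
  obtain L where L: "partition_len L q" using assms by (auto simp: is_partition_def)
  let ?R = "\<lambda>f k. if k < L then f k else (0::nat)"
  have "p \<in> ?R ` (PiE {..<L} (\<lambda>k. {..q k}))" if "\<forall>k. p k \<le> q k" for p
  proof (rule image_eqI)
    have "p k = 0" if "\<not> k < L" for k
      using \<open>\<forall>k. p k \<le> q k\<close>[rule_format, of k] L that by (simp add: partition_len_def)
    then show "p = ?R (restrict p {..<L})" by (auto simp: fun_eq_iff)
    show "restrict p {..<L} \<in> PiE {..<L} (\<lambda>k. {..q k})" using that by auto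
  qed
  then have "{p. \<forall>k. p k \<le> q k} \<subseteq> ?R ` (PiE {..<L} (\<lambda>k. {..q k}))" by blast
  then show ?thesis by (rule finite_subset) (auto intro!: finite_PiE)
qed

section \<open>Two local rules for squares of horizontal strips\<close>

text \<open>
  If \<open>p \<subseteq> q \<subseteq> q'\<close> is a chain of two horizontal strips, then the part \<open>q k\<close> may take exactly the
  values between \<open>max (p k) (q' (k + 1))\<close> and \<open>min (p (k - 1)) (q' k)\<close>, and \<open>p' k\<close> is its mirror
  image in this interval. In the first part the upper end is \<open>q' 0\<close> alone. Read on tableaux, this is the
  Bender-Knuth involution: it exchanges the numbers of occurrences of two neighbouring letters.
\<close>

definition bk_square where
  "bk_square p q p' q' \<longleftrightarrow> q 0 + p' 0 = q' 0 + max (p 0) (q' 1) \<and>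
     (\<forall>k. q (Suc k) + p' (Suc k) = min (p k) (q' (Suc k)) + max (p (Suc k)) (q' (Suc (Suc k))))"
  for p q p' q' :: "nat \<Rightarrow> nat"

lemma bk_square_commute: "bk_square p q p' q' \<longleftrightarrow> bk_square p p' q q'"
  unfolding bk_square_def by (simp add: add.commute)

definition toggle :: "(nat \<Rightarrow> nat) \<Rightarrow> (nat \<Rightarrow> nat) \<Rightarrow> (nat \<Rightarrow> nat) \<Rightarrow> nat \<Rightarrow> nat" where
  "toggle p q r = (\<lambda>k. (case k of 0 \<Rightarrow> r 0 | Suc i \<Rightarrow> min (p i) (r k)) + max (p k) (r (Suc k)) - q k)"

lemma toggle_square:
  assumes "hstrip p q" "hstrip q r"
  shows "bk_square p q (toggle p q r) r"
    and "hstrip p (toggle p q r)" and "hstrip (toggle p q r) r"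
proof -
  have a: "p k \<le> q k" "q (Suc k) \<le> p k" "q k \<le> r k" "r (Suc k) \<le> q k" for k
    using assms by (auto simp: hstrip_def)
  show "bk_square p q (toggle p q r) r"
    unfolding bk_square_def
  proof (intro conjI allI)
    show "q 0 + toggle p q r 0 = r 0 + max (p 0) (r 1)"
      using a(3)[of 0] by (simp add: toggle_def)
    fix k
    show "q (Suc k) + toggle p q r (Suc k) = min (p k) (r (Suc k)) + max (p (Suc k)) (r (Suc (Suc k)))"
      using a(2)[of k] a(3)[of "Suc k"] by (simp add: toggle_def min_def)
  qed
  have b: "p k \<le> toggle p q r k \<and> r (Suc k) \<le> toggle p q r k \<and> toggle p q r k \<le> r k" for k
    using a(1,3,4)[of k] a(2)[of "k - 1"]
    by (auto simp: toggle_def split: nat.split)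
  have c: "toggle p q r (Suc k) \<le> p k" for k
    using a(1,4)[of "Suc k"]
    by (auto simp: toggle_def)
  show "hstrip p (toggle p q r)" "hstrip (toggle p q r) r"
    using b c by (auto simp: hstrip_def)
qed

lemma bk_square_unique:
  "bk_square p q a r \<Longrightarrow> bk_square p q b r \<Longrightarrow> a = b"
proof
  fix k assume "bk_square p q a r" "bk_square p q b r"
  then show "a k = b k" unfolding bk_square_def
    by (cases k) (metis add_left_cancel)+
qed

lemma toggle_eq: "hstrip p q \<Longrightarrow> hstrip q r \<Longrightarrow> bk_square p q q' r \<Longrightarrow> toggle p q r = q'"
  using toggle_square(1) bk_square_unique by blast

lemma toggle_toggle:
  assumes "hstrip p q" "hstrip q r" shows "toggle p (toggle p q r) r = q"
  using toggle_square[OF assms] bk_square_commute toggle_eq by blast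

text \<open>
  The sum of the defining equations telescopes, because \<open>min (p k) (q' (k + 1))\<close> in one equation and
  \<open>max (p k) (q' (k + 1))\<close> in the preceding one add up to \<open>p k + q' (k + 1)\<close>. All that remains of the
  corrections is one maximum at the end.
\<close>

lemma bk_square_psum:
  assumes "bk_square p q p' q'"
  shows "psum q (Suc j) + psum p' (Suc j) = psum q' (Suc j) + psum p j + max (p j) (q' (Suc j))"
proof (induction j)
  case 0
  show ?case using assms by (simp add: bk_square_def)
next
  case (Suc j)
  have "q (Suc j) + p' (Suc j) = min (p j) (q' (Suc j)) + max (p (Suc j)) (q' (Suc (Suc j)))"
    using assms by (simp add: bk_square_def)
  with Suc show ?case by (simp add: min_def max_def split: if_splits)
qed

lemma bk_square_psize:
  assumes "bk_square p q p' q'" "is_partition p" "is_partition q" "is_partition p'" "is_partition q'"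
  shows "psize q + psize p' = psize p + psize q'"
proof -
  obtain L where L: "partition_len L p" "partition_len L q" "partition_len L p'" "partition_len L q'"
    using is_partition_common_len4[OF assms(2-5)] .
  then show ?thesis
    using bk_square_psum[OF assms(1), of L] partition_lenD(2)[OF L(1), of L] partition_lenD(2)[OF L(4), of "Suc L"]
      partition_lenD(2)[OF L(2), of L] partition_lenD(2)[OF L(3), of L] partition_lenD(2)[OF L(4), of L]
    by (simp add: psize_partition_len)
qed

text \<open>
  Fomin's local rule of the Robinson-Schensted-Knuth correspondence, with \<open>a\<close> letters entering at this
  square. It is the same reflection as above, applied to the valley \<open>q \<supseteq> p \<subseteq> p'\<close>: the part \<open>p k\<close> is
  reflected to \<open>q' (k + 1)\<close>, one row further down, and the first row of \<open>q'\<close> takes the number \<open>a\<close>.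
\<close>

definition rsk_square where
  "rsk_square p q p' q' a \<longleftrightarrow> q' 0 = max (p' 0) (q 0) + a \<and>
     (\<forall>k. p k + q' (Suc k) = max (p' (Suc k)) (q (Suc k)) + min (p' k) (q k))"
  for p q p' q' :: "nat \<Rightarrow> nat"

lemma rsk_square_forward:
  assumes "hstrip p q" "hstrip p p'"
  obtains q' where "rsk_square p q p' q' a" "hstrip q q'" "hstrip p' q'"
proof -
  have h: "p k \<le> q k" "q (Suc k) \<le> p k" "p k \<le> p' k" "p' (Suc k) \<le> p k" for k
    using assms by (auto simp: hstrip_def)
  define q' where "q' k = (case k of 0 \<Rightarrow> max (p' 0) (q 0) + a
     | Suc i \<Rightarrow> max (p' k) (q k) + min (p' i) (q i) - p i)" for k
  have q'S: "p k + q' (Suc k) = max (p' (Suc k)) (q (Suc k)) + min (p' k) (q k)" for k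
    using h(1,3)[of k] by (simp add: q'_def)
  have q'0: "q' 0 = max (p' 0) (q 0) + a" by (simp add: q'_def)
  have "q k \<le> q' k \<and> p' k \<le> q' k" for k
  proof (cases k)
    case (Suc i)
    show ?thesis using q'S[of i] h(1,3)[of i] unfolding Suc by linarith
  qed (simp add: q'0 max_def)
  moreover have "q' (Suc k) \<le> q k \<and> q' (Suc k) \<le> p' k" for k
    using q'S[of k] h(2,4)[of k] by linarith
  ultimately show ?thesis
    using that[of q'] q'S q'0 by (auto simp: rsk_square_def hstrip_def)
qed

lemma rsk_square_backward:
  assumes "hstrip q q'" "hstrip p' q'"
  obtains p a where "rsk_square p q p' q' a" "hstrip p q" "hstrip p p'"
proof -
  have h: "q k \<le> q' k" "q' (Suc k) \<le> q k" "p' k \<le> q' k" "q' (Suc k) \<le> p' k" for k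
    using assms by (auto simp: hstrip_def)
  define p where "p k = max (p' (Suc k)) (q (Suc k)) + min (p' k) (q k) - q' (Suc k)" for k
  have pq: "p k + q' (Suc k) = max (p' (Suc k)) (q (Suc k)) + min (p' k) (q k)" for k
    using h(2,4)[of k] by (simp add: p_def)
  have "q (Suc k) \<le> p k \<and> p' (Suc k) \<le> p k" for k
    using pq[of k] h(2,4)[of k] by linarith
  moreover have "p k \<le> q k \<and> p k \<le> p' k" for k
    using pq[of k] h(1,3)[of "Suc k"] by linarith
  moreover have "q' 0 = max (p' 0) (q 0) + (q' 0 - max (p' 0) (q 0))"
    using h(1,3)[of 0] by simp
  ultimately show ?thesis
    using that[of p "q' 0 - max (p' 0) (q 0)"] pq by (auto simp: rsk_square_def hstrip_def)
qed

lemma rsk_square_forward_unique: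
  assumes "rsk_square p q p' q' a" "rsk_square p q p' q'' a" shows "q' = q''"
proof
  fix k show "q' k = q'' k"
    using assms unfolding rsk_square_def by (cases k) (metis add_left_cancel)+
qed

lemma rsk_square_backward_unique:
  assumes "rsk_square p q p' q' a" "rsk_square r q p' q' b" shows "p = r" "a = b"
proof -
  show "p = r"
  proof
    fix k show "p k = r k"
      using assms unfolding rsk_square_def by (metis add_right_cancel)
  qed
  show "a = b" using assms unfolding rsk_square_def by simp
qed

lemma rsk_square_psum:
  assumes "rsk_square p q p' q' a"
  shows "psum q' (Suc j) + psum p j = a + psum p' j + psum q j + max (p' j) (q j)"
proof (induction j)
  case 0
  show ?case using assms by (simp add: rsk_square_def)
next
  case (Suc j)
  have "p j + q' (Suc j) = max (p' (Suc j)) (q (Suc j)) + min (p' j) (q j)"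
    using assms by (simp add: rsk_square_def)
  with Suc show ?case by (simp add: min_def max_def split: if_splits)
qed

lemma rsk_square_psize:
  assumes "rsk_square p q p' q' a" "is_partition p" "is_partition q" "is_partition p'" "is_partition q'"
  shows "psize q' + psize p = a + psize p' + psize q"
proof -
  obtain L where L: "partition_len L p" "partition_len L q" "partition_len L p'" "partition_len L q'"
    using is_partition_common_len4[OF assms(2-5)] .
  then show ?thesis
    using rsk_square_psum[OF assms(1), of L] partition_lenD(2)[OF L(2), of L] partition_lenD(2)[OF L(3), of L]
      partition_lenD(2)[OF L(4), of L]
    by (simp add: psize_partition_len)
qed

section \<open>The crystal statistic of two letters\<close>

text \<open>
  A chain \<open>p \<subseteq> q \<subseteq> r\<close> is a skew tableau with letters 1 (the strip \<open>q / p\<close>) and 2 (the strip \<open>r / q\<close>). The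
  number of letters 2 in rows up to \<open>j\<close> minus the number of letters 1 in rows before \<open>j\<close> is
  \<open>psum r (j + 1) - psum q (j + 1) - (psum q j - psum p j)\<close>. Its maximum over \<open>j\<close> is the crystal
  statistic epsilon, the number of letters 2 that stay unmatched in the bracketing rule, and
  \<open>eps_le K\<close> bounds it by \<open>K\<close>. For \<open>K = 0\<close> this is the Yamanouchi condition.
\<close>

definition eps_le :: "int \<Rightarrow> (nat \<Rightarrow> nat) \<Rightarrow> (nat \<Rightarrow> nat) \<Rightarrow> (nat \<Rightarrow> nat) \<Rightarrow> bool" where
  "eps_le K p q r \<longleftrightarrow> (\<forall>j. int (psum r (Suc j)) + int (psum p j) \<le> K + int (psum q (Suc j)) + int (psum q j))"

text \<open>
  The same bound for a chain \<open>p \<subseteq> q \<subseteq> q' \<subseteq> r\<close> in which a letter of a different kind (the strip \<open>q' / q\<close>)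
  stands between 1 and 2. The next two lemmas explain the formula: it is what \<open>eps_le\<close> says after the
  foreign letter has been moved away by a Bender-Knuth move, and moving it to the right or to the left
  gives the same two families of inequalities. In particular a foreign letter can pass across the pair
  without changing epsilon. The two families are also the last two inequalities of skew skeps.
\<close>

definition eps3_le where
  "eps3_le K p q q' r \<longleftrightarrow> (\<forall>j.
     int (psum r (Suc j)) + int (psum p j) \<le> K + int (psum q' (Suc j)) + int (psum q j) \<and>
     int (psum r (Suc (Suc j))) + int (psum p j) \<le> K + int (psum q' (Suc j)) + int (psum q (Suc j)))"

text \<open>
  The foreign letter moves to the right. By \<open>bk_square_psum\<close> the inequality on the left at \<open>j\<close> contains
  \<open>max (q j) (r' (j + 1))\<close>, and its two cases are the two inequalities on the right at \<open>j\<close>.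
\<close>

lemma eps_le_iff_eps3_le_lower:
  assumes "bk_square q r q' r'"
  shows "eps_le K p q r \<longleftrightarrow> eps3_le K p q q' r'"
proof -
  have "int (psum r (Suc j)) + int (psum p j) \<le> K + int (psum q (Suc j)) + int (psum q j) \<longleftrightarrow>
     int (psum r' (Suc j)) + int (psum p j) \<le> K + int (psum q' (Suc j)) + int (psum q j) \<and>
     int (psum r' (Suc (Suc j))) + int (psum p j) \<le> K + int (psum q' (Suc j)) + int (psum q (Suc j))" for j
    proof -
    have "int (psum r (Suc j)) + int (psum q' (Suc j)) =
        int (psum r' (Suc j)) + int (psum q j) + int (max (q j) (r' (Suc j)))"
      using bk_square_psum[OF assms, of j] by linarith
    then show ?thesis unfolding psum_simps by linarith
  qed
  then show ?thesis unfolding eps_le_def eps3_le_def by metis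
qed

text \<open>
  The foreign letter moves to the left. Now the inequality on the left at \<open>j + 1\<close> splits into the first
  inequality on the right at \<open>j + 1\<close> and the second one at \<open>j\<close>.
\<close>

lemma eps_le_iff_eps3_le_upper:
  assumes "bk_square p q p' q'"
  shows "eps_le K p' q' r' \<longleftrightarrow> eps3_le K p q q' r'"
proof -
  let ?E = "\<lambda>j. int (psum r' (Suc j)) + int (psum p' j) \<le> K + int (psum q' (Suc j)) + int (psum q' j)"
  let ?F = "\<lambda>j. int (psum r' (Suc j)) + int (psum p j) \<le> K + int (psum q' (Suc j)) + int (psum q j)"
  let ?G = "\<lambda>j. int (psum r' (Suc (Suc j))) + int (psum p j) \<le> K + int (psum q' (Suc j)) + int (psum q (Suc j))"
  have 0: "?E 0 \<longleftrightarrow> ?F 0" by simp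
  have S: "?E (Suc j) \<longleftrightarrow> ?F (Suc j) \<and> ?G j" for j
    proof -
    have "int (psum q (Suc j)) + int (psum p' (Suc j)) =
        int (psum q' (Suc j)) + int (psum p j) + int (max (p j) (q' (Suc j)))"
      using bk_square_psum[OF assms, of j] by linarith
    then show ?thesis unfolding psum_simps by linarith
  qed
  have "(\<forall>j. ?E j) \<longleftrightarrow> (\<forall>j. ?F j \<and> ?G j)"
  proof
    assume "\<forall>j. ?E j"
    then show "\<forall>j. ?F j \<and> ?G j" using 0 S by (metis nat.exhaust)
  next
    assume *: "\<forall>j. ?F j \<and> ?G j"
    show "\<forall>j. ?E j"
    proof
      fix j show "?E j" using * 0 S by (cases j) blast+
    qed
  qed
  then show ?thesis unfolding eps_le_def eps3_le_def .
qed

text \<open>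
  Putting \<open>a\<close> letters 1 and \<open>b\<close> letters 2 in front of a word changes epsilon to
  \<open>max b (epsilon + b - a)\<close>; here this is checked on the local rule. The inequality on the left at
  \<open>j + 1\<close> amounts to weakened forms of the wanted inequalities at \<open>j\<close> and at \<open>j + 1\<close>. The weakening at
  \<open>j\<close> is the excess of \<open>q j\<close> over \<open>p' j\<close> in one of its two occurrences and the excess of
  \<open>p' j\<close> over \<open>q j\<close> in the other. One of them is zero, so both together are the full inequality at \<open>j\<close>.
\<close>

lemma eps_le_rsk:
  assumes s1: "rsk_square p q p' q' a" and s2: "rsk_square q r q' r' b"
  shows "eps_le K p' q' r' \<longleftrightarrow> int b \<le> K \<and> eps_le (K - int b + int a) p q r"
proof -
  let ?E' = "\<lambda>j. int (psum r' (Suc j)) + int (psum p' j) \<le> K + int (psum q' (Suc j)) + int (psum q' j)"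
  let ?E = "\<lambda>j. int (psum r (Suc j)) + int (psum p j) \<le> K - int b + int a + int (psum q (Suc j)) + int (psum q j)"
  let ?A = "\<lambda>j. int (psum r (Suc j)) + int (psum p j) + int (p' j)
      \<le> K - int b + int a + int (psum q (Suc j)) + int (psum q j) + int (max (p' j) (q j))"
  let ?B = "\<lambda>j. int (psum r (Suc j)) + int (psum p j) + int (q j)
      \<le> K - int b + int a + int (psum q (Suc j)) + int (psum q j) + int (max (p' j) (q j))"
  have 0: "?E' 0 \<longleftrightarrow> int b \<le> K \<and> ?B 0"
    using s1 s2 unfolding rsk_square_def by auto
  have S: "?E' (Suc j) \<longleftrightarrow> ?A j \<and> ?B (Suc j)" for j
  proof -
    have "int (psum r' (Suc (Suc j))) + int (psum q (Suc j))
        = int b + int (psum q' (Suc j)) + int (psum r (Suc j)) + int (max (q' (Suc j)) (r (Suc j)))"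
      using rsk_square_psum[OF s2, of "Suc j"] by linarith
    moreover have "int (psum q' (Suc j)) + int (psum p j) = int a + int (psum p' j) + int (psum q j) + int (max (p' j) (q j))"
      using rsk_square_psum[OF s1, of j] by linarith
    moreover have "int (psum q' (Suc (Suc j))) + int (psum p (Suc j)) = int a + int (psum p' (Suc j)) + int (psum q (Suc j)) + int (max (p' (Suc j)) (q (Suc j)))"
      using rsk_square_psum[OF s1, of "Suc j"] by linarith
    ultimately show ?thesis
      unfolding psum_simps by linarith
  qed
  have E: "?E j \<longleftrightarrow> ?A j \<and> ?B j" for j
    by linarith
  show ?thesis
  proof
    assume "eps_le K p' q' r'"
    then have *: "?E' j" for j unfolding eps_le_def by blast
    have "?E j" for j
      unfolding E using *[of "Suc j"] *[of j] S 0 by (cases j) blast+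
    then show "int b \<le> K \<and> eps_le (K - int b + int a) p q r"
      using *[of 0] 0 unfolding eps_le_def by blast
  next
    assume "int b \<le> K \<and> eps_le (K - int b + int a) p q r"
    then have *: "int b \<le> K" "?E j" for j unfolding eps_le_def by blast+
    have "?E' j" for j
      using * E S 0 by (cases j) blast+
    then show "eps_le K p' q' r'" unfolding eps_le_def by blast
  qed
qed

section \<open>Counting chains of horizontal strips\<close>

definition strips_above :: "nat \<Rightarrow> (nat \<Rightarrow> nat) \<Rightarrow> (nat \<Rightarrow> nat) set" where
  "strips_above s p = {q. hstrip p q \<and> psize q = psize p + s}"

definition strips_below :: "nat \<Rightarrow> (nat \<Rightarrow> nat) \<Rightarrow> (nat \<Rightarrow> nat) set" where
  "strips_below s q = {p. hstrip p q \<and> psize q = psize p + s}"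

lemma strips_below_iff_above: "p \<in> strips_below s q \<longleftrightarrow> q \<in> strips_above s p"
  by (simp add: strips_below_def strips_above_def)

lemma finite_strips_below: "is_partition q \<Longrightarrow> finite (strips_below s q)"
  by (rule finite_subset[OF _ finite_below]) (auto simp: strips_below_def hstrip_def)

lemma part_le_first: "is_partition q \<Longrightarrow> q k \<le> q 0"
  by (auto simp: is_partition_def partition_len_def antimono_def)

lemma is_partition_psize_bound: "is_partition q \<Longrightarrow> q k \<le> psize q"
  using psum_le_psize[of q 1] part_le_first[of q k] by simp

lemma finite_strips_above:
  assumes p: "is_partition p" shows "finite (strips_above s p)"
proof -
  let ?b = "\<lambda>k. case k of 0 \<Rightarrow> psize p + s | Suc i \<Rightarrow> p i"
  obtain m where m: "partition_len m p" using p by (auto simp: is_partition_def)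
  have "partition_len (Suc m) ?b"
    by (rule partition_lenI)
      (use is_partition_psize_bound[OF p, of 0] partition_lenD[OF m] in \<open>auto split: nat.split intro: trans_le_add1\<close>)
  then have "finite {q. \<forall>k. q k \<le> ?b k}"
    by (intro finite_below partition_len_is_partition)
  moreover have "strips_above s p \<subseteq> {q. \<forall>k. q k \<le> ?b k}"
  proof
    fix q assume q: "q \<in> strips_above s p"
    then have "is_partition q" using hstrip_is_partition p by (auto simp: strips_above_def)
    then have "q k \<le> psize q" for k by (rule is_partition_psize_bound)
    then show "q \<in> {q. \<forall>k. q k \<le> ?b k}"
      using q by (auto simp: strips_above_def hstrip_def split: nat.split)
  qed
  ultimately show ?thesis by (rule finite_subset[rotated])
qed

lemma strips_above_is_partition: "q \<in> strips_above s p \<Longrightarrow> is_partition p \<Longrightarrow> is_partition q"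
  using hstrip_is_partition by (auto simp: strips_above_def)

lemma strips_below_is_partition: "p \<in> strips_below s q \<Longrightarrow> is_partition q \<Longrightarrow> is_partition p"
  using hstrip_is_partition by (auto simp: strips_below_def)

text \<open>
  Chains of horizontal strips from \<open>p\<close> to \<open>q\<close> with strips of prescribed sizes. They are the semistandard
  tableaux of shape \<open>q / p\<close>: the strip number \<open>i\<close> consists of the cells with entry \<open>i\<close>.
\<close>

fun nchains :: "nat list \<Rightarrow> (nat \<Rightarrow> nat) \<Rightarrow> (nat \<Rightarrow> nat) \<Rightarrow> nat" where
  "nchains [] p q = of_bool (p = q)"
| "nchains (s # ms) p q = (\<Sum>p' \<in> strips_above s p. nchains ms p' q)"

text \<open>
  Toggling the middle partition of the first two strips exchanges their sizes.
\<close>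

lemma nchains_swap:
  assumes p: "is_partition p"
  shows "nchains (s # t # ms) p q = nchains (t # s # ms) p q"
proof -
  define P where "P s t = (SIGMA p':strips_above s p. strips_above t p')" for s t
  have eq: "nchains (s # t # ms) p q = (\<Sum>(p', r) \<in> P s t. nchains ms r q)" for s t
    unfolding P_def nchains.simps
    by (rule sum.Sigma) (auto intro!: finite_strips_above p dest: strips_above_is_partition)
  have flip: "(toggle p p' r, r) \<in> P t s" "toggle p (toggle p p' r) r = p'"
    if "(p', r) \<in> P s t" for s t p' r
  proof -
    have h: "hstrip p p'" "hstrip p' r" using that by (auto simp: P_def strips_above_def)
    note sq = toggle_square[OF h]
    have "psize p' + psize (toggle p p' r) = psize p + psize r"
      using sq h p by (intro bk_square_psize) (metis hstrip_is_partition)+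
    with that sq show "(toggle p p' r, r) \<in> P t s"
      by (auto simp: P_def strips_above_def)
    show "toggle p (toggle p p' r) r = p'" by (rule toggle_toggle[OF h])
  qed
  show ?thesis
    unfolding eq
    by (rule sum.reindex_bij_witness[where i="\<lambda>(p', r). (toggle p p' r, r)" and j="\<lambda>(p', r). (toggle p p' r, r)"])
      (auto intro: flip(1) simp: flip(2))
qed

lemma nchains_top_snoc:
  "is_partition p \<Longrightarrow> is_partition q \<Longrightarrow> nchains (ms @ [s]) p q = (\<Sum>q' \<in> strips_below s q. nchains ms p q')"
proof (induction ms arbitrary: p)
  case Nil
  have "strips_above s p \<inter> {q} = (if q \<in> strips_above s p then {q} else {})"
    "strips_below s q \<inter> {p} = (if q \<in> strips_above s p then {p} else {})"
    by (auto simp: strips_below_iff_above)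
  then show ?case
    using Nil finite_strips_above[of p s] finite_strips_below[of q s] by (simp add: eq_commute)
next
  case (Cons t ms)
  have "nchains ((t # ms) @ [s]) p q = (\<Sum>p' \<in> strips_above t p. \<Sum>q' \<in> strips_below s q. nchains ms p' q')"
    using Cons by (auto intro!: sum.cong dest: strips_above_is_partition)
  also have "\<dots> = (\<Sum>q' \<in> strips_below s q. \<Sum>p' \<in> strips_above t p. nchains ms p' q')"
    by (rule sum.swap)
  finally show ?case by simp
qed

lemma nchains_rotate: "is_partition p \<Longrightarrow> nchains (ms @ [s]) p q = nchains (s # ms) p q"
proof (induction ms arbitrary: p)
  case (Cons t ms)
  have "nchains ((t # ms) @ [s]) p q = nchains (t # s # ms) p q"
    using Cons by (auto intro!: sum.cong dest: strips_above_is_partition)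
  also have "\<dots> = nchains (s # t # ms) p q"
    by (rule nchains_swap) fact
  finally show ?case .
qed simp

text \<open>
  By symmetry in the sizes, the size at the head of the list can be assigned to the last strip instead of
  the first one. The expansion below peels two chains at opposite ends along one list of sizes.
\<close>

lemma nchains_top:
  "is_partition p \<Longrightarrow> is_partition q \<Longrightarrow> nchains (s # ms) p q = (\<Sum>q' \<in> strips_below s q. nchains ms p q')"
  using nchains_rotate nchains_top_snoc by metis

lemma nchains_nonzeroD:
  assumes "nchains ms p q \<noteq> 0" "is_partition p"
  shows "is_partition q" "p k \<le> q k" "psize q = psize p + sum_list ms"
proof -
  have "is_partition q \<and> p k \<le> q k \<and> psize q = psize p + sum_list ms"
    using assms
  proof (induction ms arbitrary: p)
    case (Cons s ms)
    then obtain p' where p': "p' \<in> strips_above s p" "nchains ms p' q \<noteq> 0"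
      by (metis nchains.simps(2) sum.neutral)
    with Cons have "is_partition q \<and> p' k \<le> q k \<and> psize q = psize p' + sum_list ms"
      using strips_above_is_partition by blast
    then show ?case using p'(1) by (auto simp: strips_above_def hstrip_def intro: order_trans)
  qed (auto split: if_splits)
  then show "is_partition q" "p k \<le> q k" "psize q = psize p + sum_list ms" by auto
qed

lemma nchains_len:
  assumes "nchains ms p q \<noteq> 0" "partition_len m p"
  shows "partition_len (m + length ms) q"
  using assms
proof (induction ms arbitrary: p m)
  case (Cons s ms)
  then obtain p' where p': "p' \<in> strips_above s p" "nchains ms p' q \<noteq> 0"
    by (metis nchains.simps(2) sum.neutral)
  then have "partition_len (Suc m) p'"
    using Cons.prems hstrip_len_up by (auto simp: strips_above_def)
  from Cons.IH[OF p'(2) this] show ?case by simp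
qed (auto split: if_splits)

definition splits :: "nat list \<Rightarrow> (nat list \<times> nat list) set" where
  "splits ms = {(xs, ys). length xs = length ys \<and> map2 (+) xs ys = ms}"

lemma splits_Nil [simp]: "splits [] = {([], [])}"
  by (auto simp: splits_def)

lemma splits_Cons:
  "splits (s # ms) = (\<lambda>(a, xs, ys). (a # xs, (s - a) # ys)) ` ({..s} \<times> splits ms)"
  (is "_ = ?f ` _")
proof (intro set_eqI iffI)
  fix x assume "x \<in> splits (s # ms)"
  then obtain a xs b ys where "x = (a # xs, b # ys)" "length xs = length ys"
     "a + b = s" "map2 (+) xs ys = ms"
    by (cases x; cases "fst x"; cases "snd x") (auto simp: splits_def)
  then have "x = ?f (a, xs, ys)" "(a, xs, ys) \<in> {..s} \<times> splits ms"
    unfolding splits_def by simp_all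
  then show "x \<in> ?f ` ({..s} \<times> splits ms)" by (rule image_eqI)
qed (auto simp: splits_def)

lemma finite_splits: "finite (splits ms)"
  by (induction ms) (auto simp: splits_Cons)

lemma sum_splits_Cons:
  "(\<Sum>(xs, ys) \<in> splits (s # ms). f xs ys) = (\<Sum>a\<le>s. \<Sum>(xs, ys) \<in> splits ms. f (a # xs) ((s - a) # ys))"
proof -
  have inj: "inj_on (\<lambda>(a, xs, ys). (a # xs, (s - a) # ys)) ({..s} \<times> splits ms)"
    by (auto simp: inj_on_def)
  show ?thesis
    unfolding splits_Cons sum.reindex[OF inj]
    by (simp add: sum.cartesian_product finite_splits case_prod_unfold)
qed

section \<open>The Littlewood-Richardson rule by growth diagrams\<close>

text \<open>
  Chains from \<open>al\<close> to \<open>ka\<close> whose strip sizes are the row lengths of \<open>lam / mu\<close> and whose statistics are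
  bounded by the differences of \<open>mu\<close>. Their number is the coefficient of \<open>schur ka\<close> in the product of
  \<open>schur al\<close> and the skew Schur function of \<open>lam / mu\<close>. The bounds encode column strictness: two
  rows of entries with statistic epsilon have strict columns exactly if the upper row starts at least
  epsilon places to the right of the lower one, and the correspondence below keeps track of epsilon.
\<close>

definition lrchains ::
    "nat \<Rightarrow> (nat \<Rightarrow> nat) \<Rightarrow> (nat \<Rightarrow> nat) \<Rightarrow> (nat \<Rightarrow> nat) \<Rightarrow> (nat \<Rightarrow> nat) \<Rightarrow> (nat \<Rightarrow> nat \<Rightarrow> nat) set" where
  "lrchains n mu lam al ka = {D \<in> extensional {..n}. D 0 = al \<and> D n = ka \<and>
     (\<forall>i<n. hstrip (D i) (D (Suc i)) \<and> psize (D (Suc i)) + mu i = psize (D i) + lam i) \<and>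
     (\<forall>i. Suc i < n \<longrightarrow> eps_le (int (mu i) - int (mu (Suc i))) (D i) (D (Suc i)) (D (Suc (Suc i))))}"

lemma lrchainsD:
  assumes "D \<in> lrchains n mu lam al ka"
  shows "D 0 = al" "D n = ka" "i < n \<Longrightarrow> hstrip (D i) (D (Suc i))"
    "i < n \<Longrightarrow> psize (D (Suc i)) + mu i = psize (D i) + lam i"
    "D \<in> extensional {..n}"
    "Suc i < n \<Longrightarrow> eps_le (int (mu i) - int (mu (Suc i))) (D i) (D (Suc i)) (D (Suc (Suc i)))"
  using assms by (auto simp: lrchains_def)

lemma hstrip_chain_is_partition:
  assumes "\<And>i. i < n \<Longrightarrow> hstrip (D i) (D (Suc i))" "is_partition (D j)" "j \<le> n" "i \<le> n"
  shows "is_partition (D i)"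
proof -
  have "is_partition (D i) \<longleftrightarrow> is_partition (D 0)" if "i \<le> n" for i
    using that by (induction i) (use assms(1) hstrip_is_partition Suc_le_eq in \<open>auto\<close>)
  then show ?thesis using assms by blast
qed

lemma hstrip_chain_mono:
  assumes "\<And>i. i < n \<Longrightarrow> hstrip (D i) (D (Suc i))" "i \<le> j" "j \<le> n"
  shows "D i k \<le> D j k"
  using assms(2,3)
proof (induction j rule: dec_induct)
  case (step j)
  have "D j k \<le> D (Suc j) k" using assms(1)[of j] step.prems by (simp add: hstrip_def)
  with step show ?case by simp
qed simp

lemma hstrip_chain_len:
  assumes "\<And>i. i < n \<Longrightarrow> hstrip (D i) (D (Suc i))" "partition_len m (D 0)" "i \<le> n"
  shows "partition_len (m + i) (D i)"
  using assms(3) by (induction i) (use assms(1,2) hstrip_len_up Suc_le_eq in auto)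

lemma lrchains_is_partition:
  assumes "D \<in> lrchains n mu lam al ka" "is_partition al \<or> is_partition ka" "i \<le> n"
  shows "is_partition (D i)"
  using assms(2)
proof
  assume "is_partition al" then show ?thesis
    using hstrip_chain_is_partition[of n D 0 i] lrchainsD[OF assms(1)] assms(3) by auto
next
  assume "is_partition ka" then show ?thesis
    using hstrip_chain_is_partition[of n D n i] lrchainsD[OF assms(1)] assms(3) by auto
qed

lemma lrchains_psize:
  assumes "D \<in> lrchains n mu lam al ka"
  shows "psize ka + psum mu n = psize al + psum lam n"
proof -
  have "psize (D i) + psum mu i = psize al + psum lam i" if "i \<le> n" for i
    using that
  proof (induction i)
    case 0
    show ?case using lrchainsD(1)[OF assms] by simp
  next
    case (Suc i)
    then show ?case using lrchainsD(4)[OF assms, of i] by simp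
  qed
  then show ?thesis using lrchainsD(2)[OF assms] by auto
qed

lemma finite_lrchains:
  assumes "is_partition ka" shows "finite (lrchains n mu lam al ka)"
proof -
  have "lrchains n mu lam al ka \<subseteq> PiE {..n} (\<lambda>_. {p. \<forall>k. p k \<le> ka k})"
  proof
    fix D assume D: "D \<in> lrchains n mu lam al ka"
    have "D i k \<le> ka k" if "i \<le> n" for i k
      using hstrip_chain_mono[of n D i n k] lrchainsD[OF D] that by auto
    then show "D \<in> PiE {..n} (\<lambda>_. {p. \<forall>k. p k \<le> ka k})"
      using lrchainsD(5)[OF D] by (auto simp: PiE_def)
  qed
  then show ?thesis
    by (rule finite_subset) (auto intro!: finite_PiE finite_below assms)
qed

lemma ext_upto_eqI:
  "f \<in> extensional {..n} \<Longrightarrow> g \<in> extensional {..n} \<Longrightarrow> (\<And>i. i \<le> n \<Longrightarrow> f i = g i) \<Longrightarrow> f = g"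
  for n :: nat
  by (rule extensionalityI) auto

lemma card_eq_by_relation:
  assumes 1: "\<And>a. a \<in> A \<Longrightarrow> \<exists>b\<in>B. R a b" and 2: "\<And>b. b \<in> B \<Longrightarrow> \<exists>a\<in>A. R a b"
    and 3: "\<And>a b b'. a \<in> A \<Longrightarrow> b \<in> B \<Longrightarrow> b' \<in> B \<Longrightarrow> R a b \<Longrightarrow> R a b' \<Longrightarrow> b = b'"
    and 4: "\<And>a a' b. a \<in> A \<Longrightarrow> a' \<in> A \<Longrightarrow> b \<in> B \<Longrightarrow> R a b \<Longrightarrow> R a' b \<Longrightarrow> a = a'"
  shows "card A = card B"
proof -
  obtain f where f: "\<And>a. a \<in> A \<Longrightarrow> f a \<in> B \<and> R a (f a)" using 1 by metis
  have "bij_betw f A B"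
    unfolding bij_betw_def
  proof
    show "inj_on f A" using f 4 by (metis inj_onI)
    show "f ` A = B" using f 2 3 by (auto simp: image_iff) metis
  qed
  then show ?thesis by (rule bij_betw_same_card)
qed

text \<open>
  A row of squares between the chains \<open>D\<close> and \<open>D'\<close> is filled from \<open>D\<close> in the order of increasing indices, and
  in the next lemma from \<open>D'\<close> in the order of decreasing indices. Together this makes one step of the
  correspondence invertible.
\<close>

lemma rsk_row_up:
  assumes D: "\<And>i. i < n \<Longrightarrow> hstrip (D i) (D (Suc i))" and al: "hstrip (D 0) al"
  obtains D' where "D' \<in> extensional {..n}" "D' 0 = al" "\<And>i. i \<le> n \<Longrightarrow> hstrip (D i) (D' i)"
    "\<And>i. i < n \<Longrightarrow> hstrip (D' i) (D' (Suc i))"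
    "\<And>i. i < n \<Longrightarrow> rsk_square (D i) (D (Suc i)) (D' i) (D' (Suc i)) (a i)"
proof -
  let ?P = "\<lambda>i x. (i = 0 \<longrightarrow> x = al) \<and> (i \<le> n \<longrightarrow> hstrip (D i) x)"
  let ?Q = "\<lambda>i x y. i < n \<longrightarrow> hstrip x y \<and> rsk_square (D i) (D (Suc i)) x y (a i)"
  have "\<exists>f. \<forall>i. ?P i (f i) \<and> ?Q i (f i) (f (Suc i))"
  proof (rule dependent_nat_choice)
    show "\<exists>x. ?P 0 x" using al by blast
    fix x i assume x: "?P i x"
    show "\<exists>y. ?P (Suc i) y \<and> ?Q i x y"
    proof (cases "i < n")
      case True
      then have "hstrip (D i) (D (Suc i))" "hstrip (D i) x" using D x by auto
      then obtain y where "rsk_square (D i) (D (Suc i)) x y (a i)" "hstrip (D (Suc i)) y" "hstrip x y"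
        using rsk_square_forward by blast
      then show ?thesis by auto
    qed auto
  qed
  then obtain f where f: "\<And>i. ?P i (f i) \<and> ?Q i (f i) (f (Suc i))" by blast
  show ?thesis
    by (rule that[of "restrict f {..n}"]) (use f in auto)
qed

lemma rsk_row_down:
  assumes D': "\<And>i. i < n \<Longrightarrow> hstrip (D' i) (D' (Suc i))" and ka: "hstrip ka (D' n)"
  obtains D a where "D \<in> extensional {..n}" "D n = ka" "\<And>i. i \<le> n \<Longrightarrow> hstrip (D i) (D' i)"
    "\<And>i. i < n \<Longrightarrow> hstrip (D i) (D (Suc i))"
    "\<And>i. i < n \<Longrightarrow> rsk_square (D i) (D (Suc i)) (D' i) (D' (Suc i)) (a i)"
proof -
  let ?P = "\<lambda>j x. (j = 0 \<longrightarrow> x = ka) \<and> (j \<le> n \<longrightarrow> hstrip x (D' (n - j)))"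
  let ?Q = "\<lambda>j x y. j < n \<longrightarrow> hstrip y x \<and> (\<exists>a. rsk_square y x (D' (n - Suc j)) (D' (n - j)) a)"
  have "\<exists>f. \<forall>j. ?P j (f j) \<and> ?Q j (f j) (f (Suc j))"
  proof (rule dependent_nat_choice)
    show "\<exists>x. ?P 0 x" using ka by auto
    fix x j assume x: "?P j x"
    show "\<exists>y. ?P (Suc j) y \<and> ?Q j x y"
    proof (cases "j < n")
      case True
      then have "hstrip (D' (n - Suc j)) (D' (n - j))" "hstrip x (D' (n - j))"
        using D'[of "n - Suc j"] x by (auto simp: Suc_diff_Suc)
      then obtain y a where "rsk_square y x (D' (n - Suc j)) (D' (n - j)) a" "hstrip y x" "hstrip y (D' (n - Suc j))"
        using rsk_square_backward by blast
      then show ?thesis by auto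
    qed auto
  qed
  then obtain f where f: "\<And>j. ?P j (f j) \<and> ?Q j (f j) (f (Suc j))" by blast
  define D where "D = restrict (\<lambda>i. f (n - i)) {..n}"
  have sq: "hstrip (D i) (D (Suc i)) \<and> (\<exists>a. rsk_square (D i) (D (Suc i)) (D' i) (D' (Suc i)) a)" if "i < n" for i
    using f[of "n - Suc i"] that by (auto simp: D_def Suc_diff_Suc)
  then obtain a where a: "\<And>i. i < n \<Longrightarrow> rsk_square (D i) (D (Suc i)) (D' i) (D' (Suc i)) (a i)"
    by metis
  have "hstrip (D i) (D' i)" if "i \<le> n" for i
    using f[of "n - i"] that by (simp add: D_def)
  then show ?thesis
    by (intro that[of D a]) (use sq a f[of 0] in \<open>auto simp: D_def\<close>)
qed

text \<open>
  The labels \<open>rho' i - rho i\<close> are the numbers of smallest entries in the rows of a skew tableau of shape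
  \<open>nu / rho\<close>. With \<open>K = rho i - rho (i + 1)\<close>, the two conditions produced by \<open>eps_le_rsk\<close> read as follows:
  \<open>b \<le> K\<close> says that \<open>rho' / rho\<close> is a horizontal strip, and the changed bound \<open>K - b + a\<close> is
  \<open>rho' i - rho' (i + 1)\<close>, the one belonging to the remaining tableau of shape \<open>nu / rho'\<close>.
\<close>

lemma lrchains_step_rel:
  assumes sq: "\<And>i. i < n \<Longrightarrow> rsk_square (D i) (D (Suc i)) (D' i) (D' (Suc i)) (rho' i - rho i)"
    and D: "\<And>i. i < n \<Longrightarrow> hstrip (D i) (D (Suc i))" and D': "\<And>i. i < n \<Longrightarrow> hstrip (D' i) (D' (Suc i))"
    and p: "\<And>i. i \<le> n \<Longrightarrow> is_partition (D i)" and p': "\<And>i. i \<le> n \<Longrightarrow> is_partition (D' i)"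
    and ext: "D \<in> extensional {..n}" "D' \<in> extensional {..n}"
    and le: "\<And>i. i < n \<Longrightarrow> rho i \<le> rho' i"
  shows "D' \<in> lrchains n rho nu (D' 0) (D' n) \<longleftrightarrow>
    (\<forall>i. Suc i < n \<longrightarrow> rho' (Suc i) \<le> rho i) \<and> D \<in> lrchains n rho' nu (D 0) (D n)"
proof -
  have size: "psize (D' (Suc i)) + rho i = psize (D' i) + nu i \<longleftrightarrow> psize (D (Suc i)) + rho' i = psize (D i) + nu i"
    if "i < n" for i
    using rsk_square_psize[OF sq[OF that]] p[of i] p[of "Suc i"] p'[of i] p'[of "Suc i"] le[OF that] that by linarith
  have eps: "eps_le (int (rho i) - int (rho (Suc i))) (D' i) (D' (Suc i)) (D' (Suc (Suc i))) \<longleftrightarrow>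
     rho' (Suc i) \<le> rho i \<and> eps_le (int (rho' i) - int (rho' (Suc i))) (D i) (D (Suc i)) (D (Suc (Suc i)))"
    if "Suc i < n" for i
  proof -
    have le': "rho i \<le> rho' i" "rho (Suc i) \<le> rho' (Suc i)" using le that by auto
    have "int (rho i) - int (rho (Suc i)) - int (rho' (Suc i) - rho (Suc i)) + int (rho' i - rho i)
       = int (rho' i) - int (rho' (Suc i))"
      using le' by (simp add: of_nat_diff)
    moreover have "int (rho' (Suc i) - rho (Suc i)) \<le> int (rho i) - int (rho (Suc i)) \<longleftrightarrow> rho' (Suc i) \<le> rho i"
      using le' by (simp add: of_nat_diff)
    ultimately show ?thesis
      using eps_le_rsk[OF sq[of i] sq[OF that]] that by simp
  qed
  show ?thesis
    unfolding lrchains_def using size eps D D' ext by auto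
qed

text \<open>
  One letter is processed on both sides. On the left the last strip \<open>al / al'\<close> of a straight tableau and
  the first strip \<open>rho' / rho\<close> of a skew tableau are removed; on the right there is the strip
  \<open>ka' / ka\<close> into which the local rules merge them.
\<close>

lemma lrchains_step:
  assumes rho: "partition_len n rho" and nu: "partition_len n nu" and al: "is_partition al" and ka: "is_partition ka"
  shows "(\<Sum>a\<le>s. \<Sum>al' \<in> strips_below a al. \<Sum>rho' \<in> {r \<in> strips_above (s - a) rho. partition_len n r}.
             card (lrchains n rho' nu al' ka)) =
         (\<Sum>ka' \<in> strips_above s ka. card (lrchains n rho nu al ka'))"
proof -
  define A where "A = (SIGMA a:{..s}. SIGMA al':strips_below a al.
     SIGMA rho':{r \<in> strips_above (s - a) rho. partition_len n r}. lrchains n rho' nu al' ka)"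
  define B where "B = (SIGMA ka':strips_above s ka. lrchains n rho nu al ka')"
  have fin: "finite (strips_above t rho)" for t
    using finite_strips_above partition_len_is_partition[OF rho] .
  have cA: "card A = (\<Sum>a\<le>s. \<Sum>al' \<in> strips_below a al. \<Sum>rho' \<in> {r \<in> strips_above (s - a) rho. partition_len n r}.
             card (lrchains n rho' nu al' ka))"
    unfolding A_def
    by (subst card_SigmaI, (auto intro!: finite_SigmaI finite_strips_below al fin finite_lrchains ka)[2])+ simp
  have cB: "card B = (\<Sum>ka' \<in> strips_above s ka. card (lrchains n rho nu al ka'))"
    unfolding B_def using strips_above_is_partition ka
    by (subst card_SigmaI) (auto intro!: finite_strips_above finite_lrchains)
  have psr: "psize rho = psum rho n" by (rule psize_partition_len[OF rho])
  have "card A = card B"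
  proof (rule card_eq_by_relation[where R="\<lambda>(a, al', rho', D) (ka', D').
     \<forall>i<n. rsk_square (D i) (D (Suc i)) (D' i) (D' (Suc i)) (rho' i - rho i)"], goal_cases)
    case (1 x)
    then obtain a al' rho' D where x: "x = (a, al', rho', D)" and a: "a \<le> s"
      and al': "hstrip al' al" "psize al = psize al' + a"
      and rho': "hstrip rho rho'" "psize rho' = psize rho + (s - a)" "partition_len n rho'"
      and D: "D \<in> lrchains n rho' nu al' ka"
      by (auto simp: A_def strips_below_def strips_above_def)
    note d = lrchainsD[OF D]
    obtain D' where D': "D' \<in> extensional {..n}" "D' 0 = al" "\<And>i. i \<le> n \<Longrightarrow> hstrip (D i) (D' i)"
      "\<And>i. i < n \<Longrightarrow> hstrip (D' i) (D' (Suc i))"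
      "\<And>i. i < n \<Longrightarrow> rsk_square (D i) (D (Suc i)) (D' i) (D' (Suc i)) (rho' i - rho i)"
      by (rule rsk_row_up[of n D al "\<lambda>i. rho' i - rho i"]) (use d al' in auto)
    have p: "is_partition (D i)" if "i \<le> n" for i
      using lrchains_is_partition[OF D _ that] ka by blast
    have p': "is_partition (D' i)" if "i \<le> n" for i
      using p[OF that] hstrip_is_partition D'(3)[OF that] by blast
    have "D' \<in> lrchains n rho nu (D' 0) (D' n)"
      using lrchains_step_rel[where rho=rho and rho'=rho' and nu=nu and D=D and D'=D' and n=n] D' d p p' D rho'(1)
      by (auto simp: hstrip_def)
    then have L: "D' \<in> lrchains n rho nu al (D' n)" using D'(2) by simp
    have "psize (D' n) = psize ka + s"
      using lrchains_psize[OF L] lrchains_psize[OF D] al'(2) rho'(2) psr psize_partition_len[OF rho'(3)] a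
      by linarith
    then have "(D' n, D') \<in> B"
      using L D'(3)[of n] d(2) by (auto simp: B_def strips_above_def)
    then show ?case using D'(5) unfolding x by fastforce
  next
    case (2 y)
    then obtain ka' D' where y: "y = (ka', D')" and ka': "hstrip ka ka'" "psize ka' = psize ka + s"
      and D': "D' \<in> lrchains n rho nu al ka'"
      by (auto simp: B_def strips_above_def)
    note d' = lrchainsD[OF D']
    obtain D a where D: "D \<in> extensional {..n}" "D n = ka" "\<And>i. i \<le> n \<Longrightarrow> hstrip (D i) (D' i)"
      "\<And>i. i < n \<Longrightarrow> hstrip (D i) (D (Suc i))"
      "\<And>i. i < n \<Longrightarrow> rsk_square (D i) (D (Suc i)) (D' i) (D' (Suc i)) (a i)"
      by (rule rsk_row_down[of n D' ka]) (use d' ka' in auto)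
    define rho' where "rho' i = (if i < n then rho i + a i else 0)" for i
    have p': "is_partition (D' i)" if "i \<le> n" for i
      using lrchains_is_partition[OF D' _ that] al by blast
    have p: "is_partition (D i)" if "i \<le> n" for i
      using p'[OF that] hstrip_is_partition D(3)[OF that] by blast
    have R: "rsk_square (D i) (D (Suc i)) (D' i) (D' (Suc i)) (rho' i - rho i)" if "i < n" for i
      using D(5)[OF that] that by (simp add: rho'_def)
    have *: "(\<forall>i. Suc i < n \<longrightarrow> rho' (Suc i) \<le> rho i) \<and> D \<in> lrchains n rho' nu (D 0) (D n)"
      using lrchains_step_rel[where rho=rho and rho'=rho' and nu=nu and D=D and D'=D' and n=n] R D d' p p' D'
      by (auto simp: rho'_def)
    then have L: "D \<in> lrchains n rho' nu (D 0) ka" using D(2) by simp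
    have hs: "hstrip rho rho'"
      unfolding hstrip_def
    proof (intro allI conjI)
      fix k
      show "rho k \<le> rho' k" using rho by (simp add: rho'_def partition_len_def)
      show "rho' (Suc k) \<le> rho k" using * by (cases "Suc k < n") (auto simp: rho'_def)
    qed
    have len: "partition_len n rho'"
      using hstrip_antimono[OF hs] by (simp add: partition_len_def rho'_def)
    have al0: "hstrip (D 0) al" using D(3)[of 0] d'(1) by simp
    have pp: "is_partition (D 0)" "is_partition rho" using p rho partition_len_is_partition by auto
    have le: "psize (D 0) \<le> psize al" "psize rho \<le> psize rho'"
      using hstrip_psize_le[OF al0] hstrip_psize_le[OF hs] pp by auto
    have eq: "(psize al - psize (D 0)) + (psize rho' - psize rho) = s"
      using lrchains_psize[OF L] lrchains_psize[OF D'] ka'(2) psr psize_partition_len[OF len] le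
      by linarith
    have "(psize al - psize (D 0), D 0, rho', D) \<in> A"
      using eq le al0 hs len L by (auto simp: A_def strips_below_def strips_above_def)
    then show ?case using R unfolding y by fastforce
  next
    case (3 x y y')
    obtain a al' rho' D where x: "x = (a, al', rho', D)" by (cases x)
    obtain k1 D1 k2 D2 where y: "y = (k1, D1)" "y' = (k2, D2)" by (cases y; cases y')
    have d: "D1 \<in> lrchains n rho nu al k1" "D2 \<in> lrchains n rho nu al k2"
      using 3 y by (auto simp: B_def)
    have "D1 i = D2 i" if "i \<le> n" for i
      using that
    proof (induction i)
      case 0
      show ?case using lrchainsD(1)[OF d(1)] lrchainsD(1)[OF d(2)] by simp
    next
      case (Suc i)
      have "rsk_square (D i) (D (Suc i)) (D1 i) (D1 (Suc i)) (rho' i - rho i)"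
        "rsk_square (D i) (D (Suc i)) (D2 i) (D2 (Suc i)) (rho' i - rho i)"
        using 3(4,5) Suc.prems by (auto simp: x y)
      then show ?case using Suc rsk_square_forward_unique by auto
    qed
    with lrchainsD(5)[OF d(1)] lrchainsD(5)[OF d(2)] have "D1 = D2"
      by (rule ext_upto_eqI)
    then show ?case using lrchainsD(2)[OF d(1)] lrchainsD(2)[OF d(2)] y by simp
  next
    case (4 x x' y)
    obtain ka' D' where y: "y = (ka', D')" by (cases y)
    obtain a1 al1 r1 D1 where x: "x = (a1, al1, r1, D1)" by (cases x)
    obtain a2 al2 r2 D2 where x': "x' = (a2, al2, r2, D2)" by (cases x')
    have d: "D1 \<in> lrchains n r1 nu al1 ka" "D2 \<in> lrchains n r2 nu al2 ka"
      and h: "hstrip rho r1" "hstrip rho r2" "partition_len n r1" "partition_len n r2"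
        "psize al = psize al1 + a1" "psize al = psize al2 + a2"
      using 4 x x' by (auto simp: A_def strips_above_def strips_below_def)
    have sq: "rsk_square (D1 i) (D1 (Suc i)) (D' i) (D' (Suc i)) (r1 i - rho i)"
        "rsk_square (D2 i) (D2 (Suc i)) (D' i) (D' (Suc i)) (r2 i - rho i)" if "i < n" for i
      using 4(4,5) that by (auto simp: x x' y)
    have E: "D1 (n - j) = D2 (n - j)" if "j \<le> n" for j
      using that
    proof (induction j)
      case 0
      show ?case using lrchainsD(2)[OF d(1)] lrchainsD(2)[OF d(2)] by simp
    next
      case (Suc j)
      then have eq: "D1 (n - j) = D2 (n - j)" and i: "n - Suc j < n" "Suc (n - Suc j) = n - j" by auto
      show ?case using rsk_square_backward_unique(1)[of "D1 (n - Suc j)" "D1 (n - j)" "D' (n - Suc j)" "D' (n - j)"]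
          sq[OF i(1)] unfolding i(2) eq by blast
    qed
    have eqD: "D1 i = D2 i" if "i \<le> n" for i
      using E[of "n - i"] that by simp
    with lrchainsD(5)[OF d(1)] lrchainsD(5)[OF d(2)] have D: "D1 = D2"
      by (rule ext_upto_eqI)
    moreover have "r1 = r2"
    proof
      fix i
      show "r1 i = r2 i"
      proof (cases "i < n")
        case True
        have "r1 i - rho i = r2 i - rho i"
          using sq[OF True] unfolding D by (rule rsk_square_backward_unique(2))
        then show ?thesis using hstripD(1)[OF h(1), of i] hstripD(1)[OF h(2), of i] by simp
      next
        case False
        then show ?thesis using h by (simp add: partition_len_def)
      qed
    qed
    moreover have "al1 = al2" using lrchainsD(1)[OF d(1)] lrchainsD(1)[OF d(2)] D by simp
    ultimately show ?case using h unfolding x x' by simp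
  qed
  then show ?thesis using cA cB by simp
qed


definition partitions_of :: "nat \<Rightarrow> (nat \<Rightarrow> nat) set" where
  "partitions_of N = {p. is_partition p \<and> psize p = N}"

lemma partitions_ofD: "p \<in> partitions_of N \<Longrightarrow> is_partition p" "p \<in> partitions_of N \<Longrightarrow> psize p = N"
  by (auto simp: partitions_of_def)

lemma finite_partitions_of: "finite (partitions_of N)"
proof -
  have "p k \<le> (if k < N then N else 0)" if p: "p \<in> partitions_of N" for p k
  proof -
    have pp: "is_partition p" "psize p = N" using p by (auto simp: partitions_of_def)
    have "Suc k * p k \<le> psum p (Suc k)" 
      using sum_bounded_below[of "{..<Suc k}" "p k" p] pp(1)
      by (auto simp: psum_def is_partition_def partition_len_def antimono_def)
    also have "\<dots> \<le> N" using psum_le_psize[OF pp(1), of "Suc k"] pp(2) by simp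
    finally have *: "Suc k * p k \<le> N" .
    then show ?thesis
      using is_partition_psize_bound[OF pp(1), of k] pp(2) by (cases "p k") auto
  qed
  then have "partitions_of N \<subseteq> {p. \<forall>k. p k \<le> (if k < N then N else 0)}" by blast
  moreover have "is_partition (\<lambda>k. if k < N then N else 0)"
    unfolding is_partition_def by (rule exI[of _ N], rule partition_lenI) auto
  ultimately show ?thesis using finite_below finite_subset by blast
qed

lemma lrchains_to_zero:
  assumes "is_partition al" "partition_len n rho" "partition_len n nu"
  shows "card (lrchains n rho nu al (\<lambda>_. 0)) = of_bool (al = (\<lambda>_. 0) \<and> rho = nu)"
proof -
  have 1: "lrchains n rho nu al (\<lambda>_. 0) \<subseteq> {restrict (\<lambda>_ _. 0) {..n}}" 
    and 2: "al = (\<lambda>_. 0) \<and> rho = nu" if ex: "lrchains n rho nu al (\<lambda>_. 0) \<noteq> {}"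
  proof -
    have D0: "D i = (\<lambda>_. 0)" if "D \<in> lrchains n rho nu al (\<lambda>_. 0)" "i \<le> n" for D i
    proof
      fix k
      have "D i k \<le> D n k"
        by (rule hstrip_chain_mono[of n]) (use lrchainsD(3)[OF that(1)] that(2) in auto)
      then show "D i k = 0" using lrchainsD(2)[OF that(1)] by simp
    qed
    show "lrchains n rho nu al (\<lambda>_. 0) \<subseteq> {restrict (\<lambda>_ _. 0) {..n}}"
    proof
      fix D assume D: "D \<in> lrchains n rho nu al (\<lambda>_. 0)"
      have "D = restrict (\<lambda>_ _. 0) {..n}"
        by (rule ext_upto_eqI[OF lrchainsD(5)[OF D]]) (auto simp: D0[OF D])
      then show "D \<in> {restrict (\<lambda>_ _. 0) {..n}}" by simp
    qed
    obtain D where D: "D \<in> lrchains n rho nu al (\<lambda>_. 0)" using ex by blast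
    have "rho i = nu i" for i
    proof (cases "i < n")
      case True
      then show ?thesis using lrchainsD(4)[OF D True] D0[OF D] by simp
    next
      case False
      then show ?thesis using assms by (simp add: partition_len_def)
    qed
    then show "al = (\<lambda>_. 0) \<and> rho = nu"
      using D0[OF D, of 0] lrchainsD(1)[OF D] by auto
  qed
  show ?thesis
  proof (cases "al = (\<lambda>_. 0) \<and> rho = nu")
    case True
    have "restrict (\<lambda>_ _. 0) {..n} \<in> lrchains n rho nu al (\<lambda>_. 0)"
      using True assms(2) by (auto simp: lrchains_def hstrip_def eps_le_def psum_def partition_len_def antimono_def)
    then have "lrchains n rho nu al (\<lambda>_. 0) = {restrict (\<lambda>_ _. 0) {..n}}"
      using 1 by blast
    then show ?thesis using True by simp
  next
    case False
    then have "lrchains n rho nu al (\<lambda>_. 0) = {}" using 2 by blast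
    then show ?thesis using False by auto
  qed
qed

text \<open>
  Induction on the number of letters. The last letter of the tableau of shape \<open>al\<close> and the first letter
  of the tableau of shape \<open>nu / rho\<close> merge into the last letter of the tableau of shape \<open>ka\<close>, by
  \<open>lrchains_step\<close>. The iteration is the Robinson-Schensted-Knuth correspondence as a growth diagram, with the
  chain counted by \<open>lrchains\<close> as its recording part.
\<close>

theorem nchains_product:
  assumes "is_partition al" "partition_len n rho" "partition_len n nu"
  shows "(\<Sum>(xs, ys) \<in> splits ms. nchains xs (\<lambda>_. 0) al * nchains ys rho nu) =
    (\<Sum>ka \<in> partitions_of (sum_list ms). card (lrchains n rho nu al ka) * nchains ms (\<lambda>_. 0) ka)"
  using assms(1,2)
proof (induction ms arbitrary: al rho)
  case Nil
  have "partitions_of 0 = {\<lambda>_. 0}"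
    using is_partition_psize_0D by (auto simp: partitions_of_def)
  then show ?case using Nil assms(3) by (auto simp: lrchains_to_zero)
next
  case (Cons s ms)
  let ?N = "sum_list ms"
  let ?U = "\<lambda>t. {r \<in> strips_above t rho. partition_len n r}"
  have fin: "finite (strips_above t rho)" for t
    using Cons finite_strips_above partition_len_is_partition by blast
  \<comment> \<open>A first strip that leaves the range of \<open>n\<close> rows cannot be continued to \<open>nu\<close>.\<close>
  have U: "nchains (t # ys) rho nu = (\<Sum>rho' \<in> ?U t. nchains ys rho' nu)" for t ys
    unfolding nchains.simps
  proof (rule sum.mono_neutral_right[OF fin])
    show "\<forall>r\<in>strips_above t rho - ?U t. nchains ys r nu = 0"
    proof
      fix r assume r: "r \<in> strips_above t rho - ?U t"
      then have "is_partition r" "hstrip rho r" using strips_above_is_partition Cons(3) partition_len_is_partition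
        by (auto simp: strips_above_def)
      then show "nchains ys r nu = 0"
      proof (rule_tac ccontr)
        assume "nchains ys r nu \<noteq> 0"
        then have "r k \<le> nu k" for k using nchains_nonzeroD \<open>is_partition r\<close> by blast
        then have "r k = 0" if "k \<ge> n" for k using that assms(3) by (metis le_zero_eq partition_len_def)
        then have "partition_len n r" using hstrip_antimono[OF \<open>hstrip rho r\<close>] by (simp add: partition_len_def)
        then show False using r by auto
      qed
    qed
  qed auto
  have "(\<Sum>(xs, ys) \<in> splits (s # ms). nchains xs (\<lambda>_. 0) al * nchains ys rho nu)
     = (\<Sum>a\<le>s. \<Sum>(xs, ys) \<in> splits ms. \<Sum>al' \<in> strips_below a al. \<Sum>rho' \<in> ?U (s - a).
          nchains xs (\<lambda>_. 0) al' * nchains ys rho' nu)"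
    unfolding sum_splits_Cons nchains_top[OF is_partition_zero(1) Cons(2)] U sum_product ..
  also have "\<dots> = (\<Sum>a\<le>s. \<Sum>al' \<in> strips_below a al. \<Sum>rho' \<in> ?U (s - a). \<Sum>(xs, ys) \<in> splits ms.
          nchains xs (\<lambda>_. 0) al' * nchains ys rho' nu)"
    unfolding case_prod_unfold
    by (intro sum.cong refl, subst sum.swap, intro sum.cong refl, subst sum.swap, rule refl)
  also have "\<dots> = (\<Sum>a\<le>s. \<Sum>al' \<in> strips_below a al. \<Sum>rho' \<in> ?U (s - a). 
     \<Sum>ka \<in> partitions_of ?N. card (lrchains n rho' nu al' ka) * nchains ms (\<lambda>_. 0) ka)"
    by (intro sum.cong refl Cons.IH) (use Cons.prems strips_below_is_partition in auto)
  also have "\<dots> = (\<Sum>ka \<in> partitions_of ?N. (\<Sum>a\<le>s. \<Sum>al' \<in> strips_below a al. \<Sum>rho' \<in> ?U (s - a). 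
     card (lrchains n rho' nu al' ka)) * nchains ms (\<lambda>_. 0) ka)"
    by (simp only: sum_distrib_right sum.swap[of _ "partitions_of ?N"])
  also have "\<dots> = (\<Sum>ka \<in> partitions_of ?N. (\<Sum>ka' \<in> strips_above s ka. card (lrchains n rho nu al ka')) * nchains ms (\<lambda>_. 0) ka)"
    by (intro sum.cong refl arg_cong2[where f="(*)"] lrchains_step)
      (use Cons.prems assms in \<open>auto simp: partitions_of_def\<close>)
  also have "\<dots> = (\<Sum>(ka, ka') \<in> (SIGMA ka:partitions_of ?N. strips_above s ka).
       card (lrchains n rho nu al ka') * nchains ms (\<lambda>_. 0) ka)"
    unfolding sum_distrib_right
    by (rule sum.Sigma) (auto intro!: finite_partitions_of finite_strips_above dest: partitions_ofD)
  also have "\<dots> = (\<Sum>(ka', ka) \<in> (SIGMA ka':partitions_of (s + ?N). {ka \<in> strips_below s ka'. psize ka = ?N}).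
       card (lrchains n rho nu al ka') * nchains ms (\<lambda>_. 0) ka)"
    by (rule sum.reindex_bij_witness[where i="\<lambda>(x, y). (y, x)" and j="\<lambda>(x, y). (y, x)"])
      (auto simp: partitions_of_def strips_below_iff_above, auto simp: strips_above_def hstrip_is_partition)
  also have "\<dots> = (\<Sum>ka' \<in> partitions_of (s + ?N). \<Sum>ka \<in> {ka \<in> strips_below s ka'. psize ka = ?N}.
       card (lrchains n rho nu al ka') * nchains ms (\<lambda>_. 0) ka)"
    by (rule sum.Sigma[symmetric]) (auto intro!: finite_partitions_of finite_Collect_conjI finite_strips_below dest: partitions_ofD)
  also have "\<dots> = (\<Sum>ka' \<in> partitions_of (s + ?N). card (lrchains n rho nu al ka') * nchains (s # ms) (\<lambda>_. 0) ka')"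
  proof (rule sum.cong[OF refl])
    fix ka' assume k: "ka' \<in> partitions_of (s + ?N)"
    then have "{ka \<in> strips_below s ka'. psize ka = ?N} = strips_below s ka'"
      by (auto simp: strips_below_def partitions_of_def)
    then show "(\<Sum>ka \<in> {ka \<in> strips_below s ka'. psize ka = ?N}.
       card (lrchains n rho nu al ka') * nchains ms (\<lambda>_. 0) ka) = card (lrchains n rho nu al ka') * nchains (s # ms) (\<lambda>_. 0) ka'"
      using k by (simp only: nchains_top[OF is_partition_zero(1)] sum_distrib_left partitions_of_def mem_Collect_eq)
  qed
  finally show ?case by simp
qed

section \<open>Sorting interleaved letters by a triangular growth diagram\<close>

text \<open>
  Tableaux of shape \<open>ka\<close> in letters of two alternating kinds, as chains of shapes: strips with even index
  belong to rows of one skew shape and strips with odd index to rows of the other. Consecutive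
  letters of one kind are separated by exactly one letter of the other kind, which is why the bounds are
  stated with \<open>eps3_le\<close>.
\<close>

definition zigzags ::
    "nat \<Rightarrow> (nat \<Rightarrow> nat) \<Rightarrow> (nat \<Rightarrow> nat) \<Rightarrow> (nat \<Rightarrow> nat) \<Rightarrow> (nat \<Rightarrow> nat \<Rightarrow> nat) set" where
  "zigzags n mt lt ka = {Z \<in> extensional {..2 * n}. Z 0 = (\<lambda>_. 0) \<and> Z (2 * n) = ka \<and>
     (\<forall>m<2 * n. hstrip (Z m) (Z (Suc m)) \<and> psize (Z (Suc m)) + mt m = psize (Z m) + lt m) \<and>
     (\<forall>m. m + 3 \<le> 2 * n \<longrightarrow>
        eps3_le (int (mt m) - int (mt (m + 2))) (Z m) (Z (m + 1)) (Z (m + 2)) (Z (m + 3)))}"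

lemma interleave_simps [simp]:
  "interleave p q (2 * a) = p a" "interleave p q (Suc (2 * a)) = q a"
  by (simp_all add: interleave_def)

text \<open>
  \<open>G a b\<close> is the shape reached after \<open>a\<close> letters of the first kind and \<open>b\<close> letters of the second kind, for
  \<open>b \<le> a \<le> n\<close>. A lattice path from \<open>(0, 0)\<close> to \<open>(n, n)\<close> in this triangle is an order of the letters, and
  flipping a corner of the path is a Bender-Knuth move. The staircase along the diagonal is the
  alternating order; the two straight sides are the order with all letters of the first kind first.
\<close>

definition growth :: "nat \<Rightarrow> (nat \<Rightarrow> nat \<Rightarrow> nat \<Rightarrow> nat) \<Rightarrow> bool" where
  "growth n G \<longleftrightarrow>
     (\<forall>a b. b \<le> a \<and> a < n \<longrightarrow> hstrip (G a b) (G (Suc a) b)) \<and>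
     (\<forall>a b. b < a \<and> a \<le> n \<longrightarrow> hstrip (G a b) (G a (Suc b))) \<and>
     (\<forall>a b. b < a \<and> a < n \<longrightarrow> bk_square (G a b) (G (Suc a) b) (G a (Suc b)) (G (Suc a) (Suc b)))"

lemma growthD:
  assumes "growth n G"
  shows "b \<le> a \<Longrightarrow> a < n \<Longrightarrow> hstrip (G a b) (G (Suc a) b)"
    "b < a \<Longrightarrow> a \<le> n \<Longrightarrow> hstrip (G a b) (G a (Suc b))"
    "b < a \<Longrightarrow> a < n \<Longrightarrow> bk_square (G a b) (G (Suc a) b) (G a (Suc b)) (G (Suc a) (Suc b))"
    "b < a \<Longrightarrow> a < n \<Longrightarrow> bk_square (G a b) (G a (Suc b)) (G (Suc a) b) (G (Suc a) (Suc b))"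
  using assms bk_square_commute unfolding growth_def by auto

lemma growth_is_partition:
  assumes G: "growth n G" and 0: "is_partition (G 0 0)"
  shows "b \<le> a \<Longrightarrow> a \<le> n \<Longrightarrow> is_partition (G a b)"
proof (induction b)
  case 0
  show ?case using \<open>a \<le> n\<close>
    by (induction a) (use assms(2) hstrip_is_partition growthD(1)[OF G] in \<open>auto simp: Suc_le_eq\<close>)
next
  case (Suc b)
  then show ?case using hstrip_is_partition growthD(2)[OF G, of b a] by auto
qed

lemma growth_size_x:
  assumes G: "growth n G" and 0: "is_partition (G 0 0)"
  shows "b \<le> a \<Longrightarrow> a < n \<Longrightarrow> psize (G (Suc a) b) + psize (G a 0) = psize (G a b) + psize (G (Suc a) 0)"
proof (induction b)
  case (Suc b)
  then have "psize (G (Suc a) b) + psize (G a (Suc b)) = psize (G a b) + psize (G (Suc a) (Suc b))"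
    by (intro bk_square_psize growthD(3)[OF G] growth_is_partition[OF G 0]) auto
  with Suc show ?case by simp
qed simp

lemma growth_size_y:
  assumes G: "growth n G" and 0: "is_partition (G 0 0)" and "b < a" "a \<le> n"
  shows "psize (G a (Suc b)) + psize (G n b) = psize (G a b) + psize (G n (Suc b))"
  using \<open>a \<le> n\<close> \<open>b < a\<close>
proof (induction a rule: inc_induct)
  case (step a)
  then have "psize (G (Suc a) b) + psize (G a (Suc b)) = psize (G a b) + psize (G (Suc a) (Suc b))"
    by (intro bk_square_psize growthD(3)[OF G] growth_is_partition[OF G 0]) auto
  with step show ?case by simp
qed simp

text \<open>
  Epsilon of two consecutive letters of the first kind does not change from one row of squares to the
  next, since a letter of the second kind passes across them. The row at height \<open>a\<close> is the last one
  before the staircase, where half of the passage remains.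
\<close>

lemma growth_eps_x:
  assumes G: "growth n G" and a: "Suc a < n"
  shows "eps_le K (G a 0) (G (Suc a) 0) (G (Suc (Suc a)) 0) \<longleftrightarrow>
     eps3_le K (G a a) (G (Suc a) a) (G (Suc a) (Suc a)) (G (Suc (Suc a)) (Suc a))"
proof -
  have "eps_le K (G a 0) (G (Suc a) 0) (G (Suc (Suc a)) 0) \<longleftrightarrow>
      eps_le K (G a b) (G (Suc a) b) (G (Suc (Suc a)) b)" if "b \<le> a" for b
    using that
  proof (induction b)
    case (Suc b)
    then show ?case
      using eps_le_iff_eps3_le_lower[OF growthD(3)[OF G, of b "Suc a"], of K "G a b"] a
        eps_le_iff_eps3_le_upper[OF growthD(3)[OF G, of b "a"], of K "G (Suc (Suc a)) (Suc b)"] by simp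
  qed simp
  from this[of a] show ?thesis
    using eps_le_iff_eps3_le_lower[OF growthD(3)[OF G, of a "Suc a"]] a by simp
qed

text \<open>
  The same for letters of the second kind, with columns of squares traversed from the right side
  to the staircase.
\<close>

lemma growth_eps_y:
  assumes G: "growth n G" and b: "Suc b < n"
  shows "eps_le K (G n b) (G n (Suc b)) (G n (Suc (Suc b))) \<longleftrightarrow>
     eps3_le K (G (Suc b) b) (G (Suc b) (Suc b)) (G (Suc (Suc b)) (Suc b)) (G (Suc (Suc b)) (Suc (Suc b)))"
proof -
  have "eps_le K (G n b) (G n (Suc b)) (G n (Suc (Suc b))) \<longleftrightarrow>
      eps_le K (G a b) (G a (Suc b)) (G a (Suc (Suc b)))" if "a \<le> n" "Suc b < a" for a
    using that
  proof (induction a rule: inc_induct)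
    case (step a)
    then show ?case
      using eps_le_iff_eps3_le_lower[OF growthD(4)[OF G, of "Suc b" a], of K "G a b"]
        eps_le_iff_eps3_le_upper[OF growthD(4)[OF G, of b "a"], of K "G (Suc a) (Suc (Suc b))"] by simp
  qed simp
  from this[of "Suc (Suc b)"] show ?thesis
    using eps_le_iff_eps3_le_upper[OF growthD(4)[OF G, of b "Suc b"]] b by simp
qed

lemma all_less_double: "(\<forall>m<2 * n. P m) \<longleftrightarrow> (\<forall>a<n. P (2 * a) \<and> P (Suc (2 * a)))" for n :: nat
proof
  assume *: "\<forall>a<n. P (2 * a) \<and> P (Suc (2 * a))"
  show "\<forall>m<2 * n. P m"
  proof (intro allI impI)
    fix m assume "m < 2 * n"
    show "P m"
    proof (cases "even m")
      case True
      then obtain a where "m = 2 * a" by blast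
      then show ?thesis using * \<open>m < 2 * n\<close> by auto
    next
      case False
      then obtain a where "m = 2 * a + 1" by (rule oddE)
      then show ?thesis using * \<open>m < 2 * n\<close> by auto
    qed
  qed
qed auto

lemma all_le_double3: "(\<forall>m. m + 3 \<le> 2 * n \<longrightarrow> P m) \<longleftrightarrow> (\<forall>a. Suc a < n \<longrightarrow> P (2 * a) \<and> P (Suc (2 * a)))" for n :: nat
proof -
  have "(\<forall>m. m + 3 \<le> 2 * n \<longrightarrow> P m) \<longleftrightarrow> (\<forall>m<2 * (n - 1). P m)"
  proof -
    have "m + 3 \<le> 2 * n \<longleftrightarrow> m < 2 * (n - 1)" for m by presburger
    then show ?thesis by simp
  qed
  then show ?thesis unfolding all_less_double by (simp add: less_diff_conv)
qed

lemma growth_zigzag_iff: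
  assumes G: "growth n G" and 0: "G 0 0 = (\<lambda>_. 0)" and n: "G n n = ka"
    and Dx: "Dx \<in> extensional {..n}" "\<And>a. a \<le> n \<Longrightarrow> Dx a = G a 0"
    and Dy: "Dy \<in> extensional {..n}" "\<And>b. b \<le> n \<Longrightarrow> Dy b = G n b"
    and Z: "Z \<in> extensional {..2 * n}" "\<And>a. a \<le> n \<Longrightarrow> Z (2 * a) = G a a"
      "\<And>a. a < n \<Longrightarrow> Z (Suc (2 * a)) = G (Suc a) a"
  shows "Z \<in> zigzags n (interleave mu rho) (interleave lam nu) ka \<longleftrightarrow>
    Dx \<in> lrchains n mu lam (\<lambda>_. 0) (G n 0) \<and> Dy \<in> lrchains n rho nu (G n 0) ka"
proof -
  have p0: "is_partition (G 0 0)" using 0 by simp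
  have ZSS: "Z (Suc (Suc (2 * a))) = G (Suc a) (Suc a)" if "a < n" for a
    using Z(2)[of "Suc a"] that by simp
  have ZSSS: "Z (Suc (Suc (Suc (2 * a)))) = G (Suc (Suc a)) (Suc a)" if "Suc a < n" for a
    using Z(3)[of "Suc a"] that by simp
  have ZSSSS: "Z (Suc (Suc (Suc (Suc (2 * a))))) = G (Suc (Suc a)) (Suc (Suc a))" if "Suc a < n" for a
    using Z(2)[of "Suc (Suc a)"] that by simp
  have iSS: "interleave p q (Suc (Suc (2 * a))) = p (Suc a)" "interleave p q (Suc (Suc (Suc (2 * a)))) = q (Suc a)" for p q a
    using interleave_simps[of p q "Suc a"] by simp_all
  have szx: "psize (G (Suc a) a) + mu a = psize (G a a) + lam a \<longleftrightarrow> psize (G (Suc a) 0) + mu a = psize (G a 0) + lam a"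
    if "a < n" for a
    using growth_size_x[OF G p0, of a a] that by linarith
  have szy: "psize (G (Suc a) (Suc a)) + rho a = psize (G (Suc a) a) + nu a \<longleftrightarrow> psize (G n (Suc a)) + rho a = psize (G n a) + nu a"
    if "a < n" for a
    using growth_size_y[OF G p0, of a "Suc a"] that by linarith
  have A: "(\<forall>m<2 * n. hstrip (Z m) (Z (Suc m)) \<and>
       psize (Z (Suc m)) + interleave mu rho m = psize (Z m) + interleave lam nu m) \<longleftrightarrow>
    (\<forall>a<n. hstrip (Dx a) (Dx (Suc a)) \<and> psize (Dx (Suc a)) + mu a = psize (Dx a) + lam a) \<and>
    (\<forall>a<n. hstrip (Dy a) (Dy (Suc a)) \<and> psize (Dy (Suc a)) + rho a = psize (Dy a) + nu a)"
    unfolding all_less_double using szx szy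
    by (auto simp: Z ZSS Dx Dy growthD(1,2)[OF G])
  have plus: "m + 1 = Suc m" "m + 2 = Suc (Suc m)" "m + 3 = Suc (Suc (Suc m))" for m by simp_all
  have B: "(\<forall>m. m + 3 \<le> 2 * n \<longrightarrow>
        eps3_le (int (interleave mu rho m) - int (interleave mu rho (m + 2))) (Z m) (Z (m + 1)) (Z (m + 2)) (Z (m + 3))) \<longleftrightarrow>
     (\<forall>i. Suc i < n \<longrightarrow> eps_le (int (mu i) - int (mu (Suc i))) (Dx i) (Dx (Suc i)) (Dx (Suc (Suc i)))) \<and>
     (\<forall>i. Suc i < n \<longrightarrow> eps_le (int (rho i) - int (rho (Suc i))) (Dy i) (Dy (Suc i)) (Dy (Suc (Suc i))))"
    unfolding all_le_double3 unfolding plus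
    by (auto simp: iSS Z ZSS ZSSS ZSSSS Dx Dy growth_eps_x[OF G] growth_eps_y[OF G])
  show ?thesis
    unfolding zigzags_def lrchains_def mem_Collect_eq A B
    using Dx Dy Z Z(2)[of 0] 0 n by auto
qed

text \<open>
  The first argument of the filling counts columns from the right side of the triangle, so that
  every square is solved for its corner \<open>(a, b + 1)\<close>. The rule makes sense in the whole square of side
  \<open>n\<close>, of which the triangle is a part.
\<close>

fun fill_inward :: "(nat \<Rightarrow> nat \<Rightarrow> nat) \<Rightarrow> (nat \<Rightarrow> nat \<Rightarrow> nat) \<Rightarrow> nat \<Rightarrow> nat \<Rightarrow> nat \<Rightarrow> nat" where
  "fill_inward X Y c 0 = X c"
| "fill_inward X Y 0 (Suc b) = Y (Suc b)"
| "fill_inward X Y (Suc c) (Suc b) =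
     toggle (fill_inward X Y (Suc c) b) (fill_inward X Y c b) (fill_inward X Y c (Suc b))"

text \<open>
  Here the first argument is the distance \<open>a - b\<close> from the diagonal, and every square is solved for its
  corner \<open>(a + 1, b)\<close>.
\<close>

fun fill_outward :: "(nat \<Rightarrow> nat \<Rightarrow> nat) \<Rightarrow> nat \<Rightarrow> nat \<Rightarrow> nat \<Rightarrow> nat" where
  "fill_outward Z 0 b = Z (2 * b)"
| "fill_outward Z (Suc 0) b = Z (Suc (2 * b))"
| "fill_outward Z (Suc (Suc d)) b =
     toggle (fill_outward Z (Suc d) b) (fill_outward Z d (Suc b)) (fill_outward Z (Suc d) (Suc b))"

lemma growth_from_sides:
  assumes X: "\<And>a. a < n \<Longrightarrow> hstrip (Dx a) (Dx (Suc a))" and Y: "\<And>b. b < n \<Longrightarrow> hstrip (Dy b) (Dy (Suc b))"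
    and eq: "Dx n = Dy 0"
  obtains G where "growth n G" "\<And>a. a \<le> n \<Longrightarrow> G a 0 = Dx a" "\<And>b. b \<le> n \<Longrightarrow> G n b = Dy b"
proof -
  define g where "g = fill_inward (\<lambda>c. Dx (n - c)) Dy"
  have g0: "g c 0 = Dx (n - c)" for c by (simp add: g_def)
  have g0': "g 0 b = Dy b" for b by (cases b) (simp_all add: g_def eq)
  have gS: "g (Suc c) (Suc b) = toggle (g (Suc c) b) (g c b) (g c (Suc b))" for c b by (simp add: g_def)
  have V: "\<forall>b<n. hstrip (g c b) (g c (Suc b))" and H: "c < n \<longrightarrow> (\<forall>b\<le>n. hstrip (g (Suc c) b) (g c b))"
    if "c \<le> n" for c
  proof -
    have step: "hstrip (g (Suc c) b) (g c b) \<and> (b < n \<longrightarrow> hstrip (g (Suc c) b) (g (Suc c) (Suc b)))"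
      if V: "\<forall>b<n. hstrip (g c b) (g c (Suc b))" and "c < n" "b \<le> n" for c b
      using \<open>b \<le> n\<close>
    proof (induction b)
      case 0
      have "hstrip (g (Suc c) 0) (g c 0)" using X[of "n - Suc c"] \<open>c < n\<close> by (simp add: g0 Suc_diff_Suc)
      then show ?case using V toggle_square(2) gS by auto
    next
      case (Suc b)
      then have h: "hstrip (g (Suc c) b) (g c b)" "hstrip (g c b) (g c (Suc b))" using V by auto
      have "hstrip (g (Suc c) (Suc b)) (g c (Suc b))" unfolding gS by (rule toggle_square(3)[OF h])
      then show ?case using V toggle_square(2) gS by auto
    qed
    have V: "\<forall>b<n. hstrip (g c b) (g c (Suc b))" if "c \<le> n" for c
      using that
    proof (induction c)
      case 0
      show ?case using Y g0' by simp
    next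
      case (Suc c)
      then show ?case using step[of c] by auto
    qed
    show "\<forall>b<n. hstrip (g c b) (g c (Suc b))" using V that .
    show "c < n \<longrightarrow> (\<forall>b\<le>n. hstrip (g (Suc c) b) (g c b))" using V step that by blast
  qed
  define G where "G a b = g (n - a) b" for a b
  have hx: "hstrip (G a b) (G (Suc a) b)" if "b \<le> n" "a < n" for a b
    using H[of "n - Suc a"] that by (simp add: G_def Suc_diff_Suc)
  have hy: "hstrip (G a b) (G a (Suc b))" if "b < n" for a b
    using V[of "n - a"] that by (simp add: G_def)
  have "bk_square (G a b) (G (Suc a) b) (G a (Suc b)) (G (Suc a) (Suc b))" if "b < a" "a < n" for a b
  proof -
    have "G a (Suc b) = toggle (G a b) (G (Suc a) b) (G (Suc a) (Suc b))"
      using gS[of "n - Suc a" b] that by (simp add: G_def Suc_diff_Suc)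
    then show ?thesis using toggle_square(1) hx[of b a] hy[of b "Suc a"] that by auto
  qed
  then have "growth n G" unfolding growth_def using hx hy by auto
  moreover have "G a 0 = Dx a" if "a \<le> n" for a using that by (simp add: G_def g0)
  moreover have "G n b = Dy b" for b by (simp add: G_def g0')
  ultimately show ?thesis using that by blast
qed

lemma growth_from_zigzag:
  assumes Z: "\<And>m. m < 2 * n \<Longrightarrow> hstrip (Z m) (Z (Suc m))"
  obtains G where "growth n G" "\<And>a. a \<le> n \<Longrightarrow> G a a = Z (2 * a)" "\<And>a. a < n \<Longrightarrow> G (Suc a) a = Z (Suc (2 * a))"
proof -
  define z where "z = fill_outward Z"
  have zS: "z (Suc (Suc d)) b = toggle (z (Suc d) b) (z d (Suc b)) (z (Suc d) (Suc b))" for d b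
    by (simp add: z_def)
  have h: "hstrip (z d b) (z (Suc d) b) \<and> hstrip (z (Suc d) b) (z d (Suc b))" if "b + d < n" for d b
    using that
  proof (induction d arbitrary: b)
    case 0
    then show ?case using Z[of "2 * b"] Z[of "Suc (2 * b)"] by (simp add: z_def)
  next
    case (Suc d)
    have "hstrip (z (Suc d) b) (z d (Suc b))" "hstrip (z d (Suc b)) (z (Suc d) (Suc b))"
      using Suc.IH[of b] Suc.IH[of "Suc b"] Suc.prems by auto
    then show ?case using toggle_square(2,3) unfolding zS by blast
  qed
  define G where "G a b = z (a - b) b" for a b
  have hx: "hstrip (G a b) (G (Suc a) b)" if "b \<le> a" "a < n" for a b
    using h[of b "a - b"] that by (simp add: G_def Suc_diff_le)
  have hy: "hstrip (G a b) (G a (Suc b))" if "b < a" "a \<le> n" for a b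
    using h[of b "a - Suc b"] that by (simp add: G_def Suc_diff_Suc)
  have "bk_square (G a b) (G (Suc a) b) (G a (Suc b)) (G (Suc a) (Suc b))" if "b < a" "a < n" for a b
  proof -
    have "G (Suc a) b = toggle (G a b) (G a (Suc b)) (G (Suc a) (Suc b))"
      using zS[of "a - Suc b" b] that by (simp add: G_def Suc_diff_Suc Suc_diff_le)
    then show ?thesis using toggle_square(1)[OF hy[of b a] hx[of "Suc b" a]] that bk_square_commute by auto
  qed
  then have "growth n G" unfolding growth_def using hx hy by auto
  then show ?thesis by (rule that) (simp_all add: G_def z_def Suc_diff_le)
qed

text \<open>
  Three corners of a square determine the fourth one, so each of the two boundary paths determines the
  diagram.
\<close>

lemma growth_unique_from_sides:
  assumes G: "growth n G" "growth n G'" and x: "\<And>a. a \<le> n \<Longrightarrow> G a 0 = G' a 0" and y: "\<And>b. b \<le> n \<Longrightarrow> G n b = G' n b"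
  shows "b \<le> a \<Longrightarrow> a \<le> n \<Longrightarrow> G a b = G' a b"
proof (induction b arbitrary: a)
  case 0
  then show ?case using x by simp
next
  case (Suc b)
  show ?case using Suc.prems(2,1)
  proof (induction a rule: inc_induct)
    case base
    then show ?case using y by simp
  next
    case (step a)
    have "bk_square (G a b) (G (Suc a) b) (G a (Suc b)) (G (Suc a) (Suc b))"
      "bk_square (G' a b) (G' (Suc a) b) (G' a (Suc b)) (G' (Suc a) (Suc b))"
      using growthD(3)[OF G(1), of b a] growthD(3)[OF G(2), of b a] step by auto
    moreover have "G a b = G' a b" "G (Suc a) b = G' (Suc a) b" "G (Suc a) (Suc b) = G' (Suc a) (Suc b)"
      using step Suc.IH by auto
    ultimately show ?case using bk_square_unique by metis
  qed
qed

lemma growth_unique_from_zigzag: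
  assumes G: "growth n G" "growth n G'" and z: "\<And>a. a \<le> n \<Longrightarrow> G a a = G' a a" "\<And>a. a < n \<Longrightarrow> G (Suc a) a = G' (Suc a) a"
  shows "b + d \<le> n \<Longrightarrow> G (b + d) b = G' (b + d) b"
proof (induction d arbitrary: b rule: less_induct)
  case (less d)
  consider "d = 0" | "d = 1" | e where "d = Suc (Suc e)" by (metis One_nat_def not0_implies_Suc)
  then show ?case
  proof cases
    case (3 e)
    let ?a = "Suc (b + e)"
    have "bk_square (G ?a b) (G ?a (Suc b)) (G (Suc ?a) b) (G (Suc ?a) (Suc b))"
      "bk_square (G' ?a b) (G' ?a (Suc b)) (G' (Suc ?a) b) (G' (Suc ?a) (Suc b))"
      using growthD(4)[OF G(1), of b ?a] growthD(4)[OF G(2), of b ?a] less.prems 3 by auto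
    moreover have "G ?a b = G' ?a b" "G ?a (Suc b) = G' ?a (Suc b)" "G (Suc ?a) (Suc b) = G' (Suc ?a) (Suc b)"
      using less.IH[of "Suc e" b] less.IH[of e "Suc b"] less.IH[of "Suc e" "Suc b"] less.prems 3 by auto
    ultimately show ?thesis using bk_square_unique 3 by (metis add_Suc_right)
  qed (use z less.prems in auto)
qed

text \<open>
  Restricting growth diagrams to the staircase and to the two straight sides gives the bijection. The sum
  runs over the shape \<open>al = G n 0\<close> in the corner, where the letters of the first kind are exhausted.
\<close>

lemma card_zigzags:
  assumes mu: "partition_len n mu" and lam: "partition_len n lam" and ka: "is_partition ka"
  shows "card (zigzags n (interleave mu rho) (interleave lam nu) ka) =
    (\<Sum>al \<in> partitions_of (psize lam - psize mu).
       card (lrchains n mu lam (\<lambda>_. 0) al) * card (lrchains n rho nu al ka))"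
proof -
  define A where "A = (SIGMA al:partitions_of (psize lam - psize mu).
     lrchains n mu lam (\<lambda>_. 0) al \<times> lrchains n rho nu al ka)"
  let ?B = "zigzags n (interleave mu rho) (interleave lam nu) ka"
  let ?R = "\<lambda>(al, Dx, Dy) Z. \<exists>G. growth n G \<and> (\<forall>a\<le>n. G a 0 = Dx a) \<and> (\<forall>b\<le>n. G n b = Dy b) \<and>
     (\<forall>a\<le>n. G a a = Z (2 * a)) \<and> (\<forall>a<n. G (Suc a) a = Z (Suc (2 * a)))"
  have "card A = card ?B"
  proof (rule card_eq_by_relation[where R = ?R], goal_cases)
    case (1 x)
    then obtain al Dx Dy where x: "x = (al, Dx, Dy)" and Dx: "Dx \<in> lrchains n mu lam (\<lambda>_. 0) al"
      and Dy: "Dy \<in> lrchains n rho nu al ka"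
      by (auto simp: A_def)
    obtain G where G: "growth n G" "\<And>a. a \<le> n \<Longrightarrow> G a 0 = Dx a" "\<And>b. b \<le> n \<Longrightarrow> G n b = Dy b"
      by (rule growth_from_sides[of n Dx Dy])
        (use lrchainsD(1,2,3)[OF Dx] lrchainsD(1,2,3)[OF Dy] in auto)
    define Z where "Z = restrict (\<lambda>m. G (Suc m div 2) (m div 2)) {..2 * n}"
    have Z: "Z (2 * a) = G a a" if "a \<le> n" for a using that by (simp add: Z_def)
    have Z': "Z (Suc (2 * a)) = G (Suc a) a" if "a < n" for a using that by (simp add: Z_def)
    have "Z \<in> ?B"
      using growth_zigzag_iff[OF G(1), of ka Dx Dy Z] lrchainsD(1,2,5)[OF Dx] lrchainsD(1,2,5)[OF Dy] Dx Dy G Z Z'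
      by (simp add: Z_def)
    then show ?case using G Z Z' unfolding x by (intro bexI[of _ Z]) auto
  next
    case (2 Z)
    then have Z: "Z \<in> extensional {..2 * n}" "Z 0 = (\<lambda>_. 0)" "Z (2 * n) = ka"
       "\<And>m. m < 2 * n \<Longrightarrow> hstrip (Z m) (Z (Suc m))" by (auto simp: zigzags_def)
    obtain G where G: "growth n G" "\<And>a. a \<le> n \<Longrightarrow> G a a = Z (2 * a)" "\<And>a. a < n \<Longrightarrow> G (Suc a) a = Z (Suc (2 * a))"
      by (rule growth_from_zigzag[of n Z]) (use Z(4) in auto)
    define Dx where "Dx = restrict (\<lambda>a. G a 0) {..n}"
    define Dy where "Dy = restrict (\<lambda>b. G n b) {..n}"
    have L: "Dx \<in> lrchains n mu lam (\<lambda>_. 0) (G n 0) \<and> Dy \<in> lrchains n rho nu (G n 0) ka"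
      using growth_zigzag_iff[OF G(1), of ka Dx Dy Z mu rho lam nu] 2 Z G by (simp add: Dx_def Dy_def)
    have "is_partition (G 0 0)" using G(2)[of 0] Z(2) by simp
    then have "is_partition (G n 0)" using growth_is_partition[OF G(1)] by simp
    moreover have "psize (G n 0) = psize lam - psize mu"
      using L lrchains_psize[of Dx n mu lam "\<lambda>_. 0" "G n 0"] by (simp add: psize_partition_len[OF mu] psize_partition_len[OF lam])
    ultimately have "(G n 0, Dx, Dy) \<in> A" using L by (auto simp: A_def partitions_of_def)
    then show ?case using G by (intro bexI[of _ "(G n 0, Dx, Dy)"]) (auto simp: Dx_def Dy_def)
  next
    case (3 x Z Z')
    then obtain al Dx Dy where x: "x = (al, Dx, Dy)" by (cases x)
    from 3(4,5) obtain G G' where G: "growth n G" "\<forall>a\<le>n. G a 0 = Dx a" "\<forall>b\<le>n. G n b = Dy b"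
       "\<forall>a\<le>n. G a a = Z (2 * a)" "\<forall>a<n. G (Suc a) a = Z (Suc (2 * a))"
      and G': "growth n G'" "\<forall>a\<le>n. G' a 0 = Dx a" "\<forall>b\<le>n. G' n b = Dy b"
       "\<forall>a\<le>n. G' a a = Z' (2 * a)" "\<forall>a<n. G' (Suc a) a = Z' (Suc (2 * a))"
      unfolding x by auto
    have eq: "G a b = G' a b" if "b \<le> a" "a \<le> n" for a b
      by (rule growth_unique_from_sides[OF G(1) G'(1)]) (use G G' that in auto)
    have "\<forall>m<2 * n. Z m = Z' m"
      unfolding all_less_double using G G' eq[of a a for a] eq[of a "Suc a" for a] by auto
    moreover have "Z (2 * n) = Z' (2 * n)" using G G' eq[of n n] by auto
    ultimately have "Z m = Z' m" if "m \<le> 2 * n" for m using that by (cases "m = 2 * n") auto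
    moreover have "Z \<in> extensional {..2 * n}" "Z' \<in> extensional {..2 * n}" using 3 by (auto simp: zigzags_def)
    ultimately show ?case by (rule_tac ext_upto_eqI[of Z "2 * n" Z'])
  next
    case (4 x x' Z)
    obtain al Dx Dy al' Dx' Dy' where x: "x = (al, Dx, Dy)" "x' = (al', Dx', Dy')" by (cases x; cases x')
    from 4(4,5) obtain G G' where G: "growth n G" "\<forall>a\<le>n. G a 0 = Dx a" "\<forall>b\<le>n. G n b = Dy b"
       "\<forall>a\<le>n. G a a = Z (2 * a)" "\<forall>a<n. G (Suc a) a = Z (Suc (2 * a))"
      and G': "growth n G'" "\<forall>a\<le>n. G' a 0 = Dx' a" "\<forall>b\<le>n. G' n b = Dy' b"
       "\<forall>a\<le>n. G' a a = Z (2 * a)" "\<forall>a<n. G' (Suc a) a = Z (Suc (2 * a))"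
      unfolding x by auto
    have eq: "G (b + d) b = G' (b + d) b" if "b + d \<le> n" for b d
      by (rule growth_unique_from_zigzag[OF G(1) G'(1)]) (use G G' that in auto)
    have D: "Dx \<in> lrchains n mu lam (\<lambda>_. 0) al" "Dx' \<in> lrchains n mu lam (\<lambda>_. 0) al'"
      "Dy \<in> lrchains n rho nu al ka" "Dy' \<in> lrchains n rho nu al' ka"
      using 4 x by (auto simp: A_def)
    have "Dx = Dx'"
      by (rule ext_upto_eqI[OF lrchainsD(5)[OF D(1)] lrchainsD(5)[OF D(2)]]) (use eq[of 0] G G' in auto)
    moreover have "Dy b = Dy' b" if "b \<le> n" for b
      using eq[of b "n - b"] G G' that by auto
    then have "Dy = Dy'"
      by (rule ext_upto_eqI[OF lrchainsD(5)[OF D(3)] lrchainsD(5)[OF D(4)]])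
    ultimately show ?case using x lrchainsD(2)[OF D(1)] lrchainsD(2)[OF D(2)] by simp
  qed
  moreover have "card A = (\<Sum>al \<in> partitions_of (psize lam - psize mu).
       card (lrchains n mu lam (\<lambda>_. 0) al) * card (lrchains n rho nu al ka))"
    unfolding A_def using ka
    by (subst card_SigmaI) (auto intro!: finite_partitions_of finite_cartesian_product finite_lrchains
         dest: partitions_ofD simp: card_cartesian_product)
  ultimately show ?thesis by simp
qed

section \<open>Skew skeps are zigzag chains\<close>

text \<open>
  The differences of a skep along the antidiagonal \<open>i + j = m\<close> are the parts of the shape number \<open>m\<close>. The
  value at the end \<open>(m, 0)\<close> of the antidiagonal is a partial sum of the lower boundary \<open>mt\<close>, and partial
  sums of the shape give the other values.
\<close>

definition skep_of :: "nat \<Rightarrow> (nat \<Rightarrow> nat) \<Rightarrow> (nat \<Rightarrow> nat \<Rightarrow> nat) \<Rightarrow> int \<times> int \<Rightarrow> int" where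
  "skep_of n mt Z = restrict (\<lambda>(i, j). int (psum mt (nat (i + j)) + psum (Z (nat (i + j))) (nat j))) (Delta (2 * n))"

definition zigzag_of :: "nat \<Rightarrow> (int \<times> int \<Rightarrow> int) \<Rightarrow> nat \<Rightarrow> nat \<Rightarrow> nat" where
  "zigzag_of n h = restrict (\<lambda>m k. if k < m
     then nat (h (int (m - Suc k), int (Suc k)) - h (int (m - k), int k)) else 0) {..2 * n}"

lemma Delta_int [simp]: "(int i, int j) \<in> Delta m \<longleftrightarrow> i + j \<le> m"
  by (auto simp: Delta_def)

lemma Delta_cases:
  assumes "(i, j) \<in> Delta m" obtains a b where "i = int a" "j = int b" "a + b \<le> m"
proof -
  have "i = int (nat i)" "j = int (nat j)" "nat i + nat j \<le> m" using assms by (auto simp: Delta_def)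
  then show ?thesis using that by blast
qed

lemma skep_of_int: "i + j \<le> 2 * n \<Longrightarrow> skep_of n mt Z (int i, int j) = int (psum mt (i + j) + psum (Z (i + j)) j)"
proof -
  assume *: "i + j \<le> 2 * n"
  have "nat (int i + int j) = i + j" by simp
  with * show ?thesis unfolding skep_of_def by simp
qed

lemma h_nw_int:
  assumes "k < 2 * n"
  shows "h_nw n h k = h (int (2 * n - Suc k), int (Suc k)) - h (int (2 * n - k), int k)"
proof -
  have "2 * int n - int k - 1 = int (2 * n - Suc k)" "int k + 1 = int (Suc k)" "2 * int n - int k = int (2 * n - k)"
    using assms by auto
  then show ?thesis unfolding h_nw_def by metis
qed

text \<open>
  Natural coordinates, in which each inequality is indexed by the lower left corner of the
  smallest rectangle around its four points.
\<close>

lemma skew_skeps_iff: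
  "h \<in> skew_skeps n \<longleftrightarrow> h \<in> extensional (Delta (2 * n)) \<and>
    (\<forall>a b. a + b + 2 \<le> 2 * n \<longrightarrow>
       h (int a, int (b + 1)) + h (int (a + 1), int (b + 1)) \<ge> h (int a, int (b + 2)) + h (int (a + 1), int b)) \<and>
    (\<forall>a b. a + b + 2 \<le> 2 * n \<longrightarrow>
       h (int (a + 1), int b) + h (int (a + 1), int (b + 1)) \<ge> h (int (a + 2), int b) + h (int a, int (b + 1))) \<and>
    (\<forall>a b. a + b + 3 \<le> 2 * n \<longrightarrow>
       h (int a, int (b + 1)) + h (int (a + 1), int (b + 1)) \<ge> h (int a, int b) + h (int (a + 1), int (b + 2))) \<and>
    (\<forall>a b. a + b + 3 \<le> 2 * n \<longrightarrow>
       h (int (a + 1), int b) + h (int (a + 1), int (b + 1)) \<ge> h (int a, int b) + h (int (a + 2), int (b + 1)))"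
  (is "_ \<longleftrightarrow> ?E \<and> ?N1 \<and> ?N2 \<and> ?N3 \<and> ?N4")
proof -
  let ?D = "Delta (2 * n)"
  have 1: "(\<forall>i j. {(i, j), (i + 1, j), (i, j + 1), (i + 1, j - 1)} \<subseteq> ?D \<longrightarrow>
        h (i, j) + h (i + 1, j) \<ge> h (i, j + 1) + h (i + 1, j - 1)) \<longleftrightarrow> ?N1" (is "?I \<longleftrightarrow> _")
  proof
    assume ?I show ?N1
    proof (intro allI impI)
      fix a b :: nat assume "a + b + 2 \<le> 2 * n"
      then show "h (int a, int (b + 1)) + h (int (a + 1), int (b + 1)) \<ge> h (int a, int (b + 2)) + h (int (a + 1), int b)"
        using \<open>?I\<close>[rule_format, of "int a" "int (b + 1)"] by (simp add: Delta_def add.commute)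
    qed
  next
    assume N: ?N1 show ?I
    proof (intro allI impI)
      fix i j assume *: "{(i, j), (i + 1, j), (i, j + 1), (i + 1, j - 1)} \<subseteq> ?D"
      then have "i \<ge> 0" "j \<ge> 1" "i + j + 1 \<le> 2 * int n" by (auto simp: Delta_def)
      then have "\<exists>a b. i = int a \<and> j = int (b + 1) \<and> a + b + 2 \<le> 2 * n"
        by (intro exI[of _ "nat i"] exI[of _ "nat (j - 1)"]) auto
      then obtain a b where ab: "i = int a" "j = int (b + 1)" "a + b + 2 \<le> 2 * n" by blast
      show "h (i, j) + h (i + 1, j) \<ge> h (i, j + 1) + h (i + 1, j - 1)"
        using N[rule_format, OF ab(3)] ab(1,2) by (simp add: add.commute)
    qed
  qed
  have 2: "(\<forall>i j. {(i, j), (i, j + 1), (i + 1, j), (i - 1, j + 1)} \<subseteq> ?D \<longrightarrow>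
        h (i, j) + h (i, j + 1) \<ge> h (i + 1, j) + h (i - 1, j + 1)) \<longleftrightarrow> ?N2" (is "?I \<longleftrightarrow> _")
  proof
    assume ?I show ?N2
    proof (intro allI impI)
      fix a b :: nat assume "a + b + 2 \<le> 2 * n"
      then show "h (int (a + 1), int b) + h (int (a + 1), int (b + 1)) \<ge> h (int (a + 2), int b) + h (int a, int (b + 1))"
        using \<open>?I\<close>[rule_format, of "int (a + 1)" "int b"] by (simp add: Delta_def add.commute)
    qed
  next
    assume N: ?N2 show ?I
    proof (intro allI impI)
      fix i j assume *: "{(i, j), (i, j + 1), (i + 1, j), (i - 1, j + 1)} \<subseteq> ?D"
      then have "j \<ge> 0" "i \<ge> 1" "i + j + 1 \<le> 2 * int n" by (auto simp: Delta_def)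
      then have "\<exists>a b. i = int (a + 1) \<and> j = int b \<and> a + b + 2 \<le> 2 * n"
        by (intro exI[of _ "nat (i - 1)"] exI[of _ "nat j"]) auto
      then obtain a b where ab: "i = int (a + 1)" "j = int b" "a + b + 2 \<le> 2 * n" by blast
      show "h (i, j) + h (i, j + 1) \<ge> h (i + 1, j) + h (i - 1, j + 1)"
        using N[rule_format, OF ab(3)] ab(1,2) by (simp add: add.commute)
    qed
  qed
  have 3: "(\<forall>i j. {(i, j), (i + 1, j), (i, j - 1), (i + 1, j + 1)} \<subseteq> ?D \<longrightarrow>
        h (i, j) + h (i + 1, j) \<ge> h (i, j - 1) + h (i + 1, j + 1)) \<longleftrightarrow> ?N3" (is "?I \<longleftrightarrow> _")
  proof
    assume ?I show ?N3
    proof (intro allI impI)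
      fix a b :: nat assume "a + b + 3 \<le> 2 * n"
      then show "h (int a, int (b + 1)) + h (int (a + 1), int (b + 1)) \<ge> h (int a, int b) + h (int (a + 1), int (b + 2))"
        using \<open>?I\<close>[rule_format, of "int a" "int (b + 1)"] by (simp add: Delta_def add.commute)
    qed
  next
    assume N: ?N3 show ?I
    proof (intro allI impI)
      fix i j assume *: "{(i, j), (i + 1, j), (i, j - 1), (i + 1, j + 1)} \<subseteq> ?D"
      then have "i \<ge> 0" "j \<ge> 1" "i + j + 2 \<le> 2 * int n" by (auto simp: Delta_def)
      then have "\<exists>a b. i = int a \<and> j = int (b + 1) \<and> a + b + 3 \<le> 2 * n"
        by (intro exI[of _ "nat i"] exI[of _ "nat (j - 1)"]) auto
      then obtain a b where ab: "i = int a" "j = int (b + 1)" "a + b + 3 \<le> 2 * n" by blast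
      show "h (i, j) + h (i + 1, j) \<ge> h (i, j - 1) + h (i + 1, j + 1)"
        using N[rule_format, OF ab(3)] ab(1,2) by (simp add: add.commute)
    qed
  qed
  have 4: "(\<forall>i j. {(i, j), (i, j + 1), (i - 1, j), (i + 1, j + 1)} \<subseteq> ?D \<longrightarrow>
        h (i, j) + h (i, j + 1) \<ge> h (i - 1, j) + h (i + 1, j + 1)) \<longleftrightarrow> ?N4" (is "?I \<longleftrightarrow> _")
  proof
    assume ?I show ?N4
    proof (intro allI impI)
      fix a b :: nat assume "a + b + 3 \<le> 2 * n"
      then show "h (int (a + 1), int b) + h (int (a + 1), int (b + 1)) \<ge> h (int a, int b) + h (int (a + 2), int (b + 1))"
        using \<open>?I\<close>[rule_format, of "int (a + 1)" "int b"] by (simp add: Delta_def add.commute)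
    qed
  next
    assume N: ?N4 show ?I
    proof (intro allI impI)
      fix i j assume *: "{(i, j), (i, j + 1), (i - 1, j), (i + 1, j + 1)} \<subseteq> ?D"
      then have "j \<ge> 0" "i \<ge> 1" "i + j + 2 \<le> 2 * int n" by (auto simp: Delta_def)
      then have "\<exists>a b. i = int (a + 1) \<and> j = int b \<and> a + b + 3 \<le> 2 * n"
        by (intro exI[of _ "nat (i - 1)"] exI[of _ "nat j"]) auto
      then obtain a b where ab: "i = int (a + 1)" "j = int b" "a + b + 3 \<le> 2 * n" by blast
      show "h (i, j) + h (i, j + 1) \<ge> h (i - 1, j) + h (i + 1, j + 1)"
        using N[rule_format, OF ab(3)] ab(1,2) by (simp add: add.commute)
    qed
  qed
  show ?thesis
    unfolding skew_skeps_def mem_Collect_eq 1 2 3 4 PiE_def by auto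
qed

lemma zigzagsD:
  assumes "Z \<in> zigzags n mt lt ka"
  shows "Z \<in> extensional {..2 * n}" "Z 0 = (\<lambda>_. 0)" "Z (2 * n) = ka"
    "m < 2 * n \<Longrightarrow> hstrip (Z m) (Z (Suc m))"
    "m < 2 * n \<Longrightarrow> psize (Z (Suc m)) + mt m = psize (Z m) + lt m"
    "m + 3 \<le> 2 * n \<Longrightarrow> eps3_le (int (mt m) - int (mt (m + 2))) (Z m) (Z (m + 1)) (Z (m + 2)) (Z (m + 3))"
    "m \<le> 2 * n \<Longrightarrow> partition_len m (Z m)"
proof -
  show z: "Z \<in> extensional {..2 * n}" "Z 0 = (\<lambda>_. 0)" "Z (2 * n) = ka"
    "\<And>m. m < 2 * n \<Longrightarrow> hstrip (Z m) (Z (Suc m))"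
    "m < 2 * n \<Longrightarrow> psize (Z (Suc m)) + mt m = psize (Z m) + lt m"
    "m + 3 \<le> 2 * n \<Longrightarrow> eps3_le (int (mt m) - int (mt (m + 2))) (Z m) (Z (m + 1)) (Z (m + 2)) (Z (m + 3))"
    using assms by (auto simp: zigzags_def)
  show "m \<le> 2 * n \<Longrightarrow> partition_len m (Z m)"
    using hstrip_chain_len[of "2 * n" Z 0 m] z by simp
qed

lemma psum_all: "partition_len m p \<Longrightarrow> m \<le> j \<Longrightarrow> psum p j = psize p"
  using psize_partition_len partition_len_mono by metis

lemma skep_of_in:
  assumes Z: "Z \<in> zigzags n (interleave mu rho) (interleave lam nu) ka"
  shows "skep_of n (interleave mu rho) Z \<in> SkewSkep n lam mu nu rho ka"
proof -
  let ?mt = "interleave mu rho" and ?lt = "interleave lam nu"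
  let ?h = "skep_of n ?mt Z"
  note z = zigzagsD[OF Z]
  note H = skep_of_int[of _ _ n ?mt Z]
  have hs: "Z m k \<le> Z (Suc m) k" "Z (Suc m) (Suc k) \<le> Z m k" if "m < 2 * n" for m k
    using z(4)[OF that] by (auto simp: hstrip_def)
  have E: "int (psum (Z (m + 3)) (Suc j)) + int (psum (Z m) j) + ?mt (m + 2)
        \<le> int (?mt m) + int (psum (Z (m + 2)) (Suc j)) + int (psum (Z (m + 1)) j)"
       "int (psum (Z (m + 3)) (Suc (Suc j))) + int (psum (Z m) j) + ?mt (m + 2)
        \<le> int (?mt m) + int (psum (Z (m + 2)) (Suc j)) + int (psum (Z (m + 1)) (Suc j))"
     if "m + 3 \<le> 2 * n" for m j
    using z(6)[OF that] unfolding eps3_le_def by (auto simp: algebra_simps dest: spec[of _ j])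
  have psum3: "psum ?mt (m + 3) = psum ?mt (m + 2) + ?mt (m + 2)" for m
    by (simp add: psum_def eval_nat_numeral)
  have H': "?h (int i, int j) = int (psum ?mt m + psum (Z m) j)" if "i + j = m" "m \<le> 2 * n" for i j m
    using H[of i j] that by simp
  have "?h \<in> skew_skeps n"
    unfolding skew_skeps_iff
  proof (intro conjI allI impI, goal_cases)
    case 1 show ?case by (simp add: skep_of_def)
  next
    case (2 a b)
    define m where "m = a + b"
    have e: "?h (int a, int (b + 1)) = int (psum ?mt (m + 1) + psum (Z (m + 1)) (b + 1))"
      "?h (int (a + 1), int (b + 1)) = int (psum ?mt (m + 2) + psum (Z (m + 2)) (b + 1))"
      "?h (int a, int (b + 2)) = int (psum ?mt (m + 2) + psum (Z (m + 2)) (b + 2))"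
      "?h (int (a + 1), int b) = int (psum ?mt (m + 1) + psum (Z (m + 1)) b)"
      using 2 unfolding m_def by (intro H'; simp)+
    show ?case
      unfolding e using hs(2)[of "m + 1" b] 2 by (simp add: m_def)
  next
    case (3 a b)
    define m where "m = a + b"
    have e: "?h (int (a + 1), int b) = int (psum ?mt (m + 1) + psum (Z (m + 1)) b)"
      "?h (int (a + 1), int (b + 1)) = int (psum ?mt (m + 2) + psum (Z (m + 2)) (b + 1))"
      "?h (int (a + 2), int b) = int (psum ?mt (m + 2) + psum (Z (m + 2)) b)"
      "?h (int a, int (b + 1)) = int (psum ?mt (m + 1) + psum (Z (m + 1)) (b + 1))"
      using 3 unfolding m_def by (intro H'; simp)+
    show ?case
      unfolding e using hs(1)[of "m + 1" b] 3 by (simp add: m_def)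
  next
    case (4 a b)
    define m where "m = a + b"
    have e: "?h (int a, int (b + 1)) = int (psum ?mt (m + 1) + psum (Z (m + 1)) (b + 1))"
      "?h (int (a + 1), int (b + 1)) = int (psum ?mt (m + 2) + psum (Z (m + 2)) (b + 1))"
      "?h (int a, int b) = int (psum ?mt m + psum (Z m) b)"
      "?h (int (a + 1), int (b + 2)) = int (psum ?mt (m + 3) + psum (Z (m + 3)) (b + 2))"
      using 4 unfolding m_def by (intro H'; simp)+
    have "m + 3 \<le> 2 * n" using 4 by (simp add: m_def)
    then show ?case
      unfolding e using E(2)[of m b] psum3 by simp
  next
    case (5 a b)
    define m where "m = a + b"
    have e: "?h (int (a + 1), int b) = int (psum ?mt (m + 1) + psum (Z (m + 1)) b)"
      "?h (int (a + 1), int (b + 1)) = int (psum ?mt (m + 2) + psum (Z (m + 2)) (b + 1))"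
      "?h (int a, int b) = int (psum ?mt m + psum (Z m) b)"
      "?h (int (a + 2), int (b + 1)) = int (psum ?mt (m + 3) + psum (Z (m + 3)) (b + 1))"
      using 5 unfolding m_def by (intro H'; simp)+
    have "m + 3 \<le> 2 * n" using 5 by (simp add: m_def)
    then show ?case
      unfolding e using E(1)[of m b] psum3 by simp
  qed
  moreover have "?h (0, 0) = 0" using H[of 0 0] by simp
  moreover have "h_up ?h k = int (?lt k)" if "k < 2 * n" for k
  proof -
    have "psum (Z (Suc k)) (Suc k) = psize (Z (Suc k))" "psum (Z k) k = psize (Z k)"
      using psum_all[OF z(7)[of "Suc k"], of "Suc k"] psum_all[OF z(7)[of k], of k] that by auto
    then show ?thesis
      using H[of 0 "Suc k"] H[of 0 k] z(5)[OF that] that by (simp add: h_up_def add.commute)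
  qed
  moreover have "h_right ?h k = int (?mt k)" if "k < 2 * n" for k
    using H[of "Suc k" 0] H[of k 0] that by (simp add: h_right_def add.commute)
  moreover have "h_nw n ?h k = int (ka k)" if "k < 2 * n" for k
  proof -
    note e = h_nw_int[OF that]
    have "?h (int (2 * n - Suc k), int (Suc k)) = int (psum ?mt (2 * n) + psum ka (Suc k))"
      using H[of "2 * n - Suc k" "Suc k"] that z(3) by simp
    moreover have "?h (int (2 * n - k), int k) = int (psum ?mt (2 * n) + psum ka k)"
      using H[of "2 * n - k" "k"] that z(3) by simp
    ultimately show ?thesis unfolding e by simp
  qed
  ultimately show ?thesis by (simp add: SkewSkep_def)
qed

text \<open>
  The definition of \<open>zigzag_of\<close> truncates negative differences to 0. No truncation happens: the first skep
  inequality makes the differences decrease along \<open>(m, k), (m + 1, k + 1), \<dots>\<close>, and such a sequence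
  ends in a part of \<open>ka\<close>.
\<close>

lemma skep_representation:
  assumes h: "h \<in> SkewSkep n lam mu nu rho ka"
  shows "m \<le> 2 * n \<Longrightarrow> k < m \<Longrightarrow> int (zigzag_of n h m k) = h (int (m - Suc k), int (Suc k)) - h (int (m - k), int k)"
    and "i + j \<le> 2 * n \<Longrightarrow> h (int i, int j) = int (psum (interleave mu rho) (i + j) + psum (zigzag_of n h (i + j)) j)"
    and "m \<le> 2 * n \<Longrightarrow> psum (zigzag_of n h m) m + psum (interleave mu rho) m = psum (interleave lam nu) m"
proof -
  let ?mt = "interleave mu rho" and ?lt = "interleave lam nu"
  define d where "d m k = h (int (m - Suc k), int (Suc k)) - h (int (m - k), int k)" for m k
  have s: "h \<in> skew_skeps n" and 0: "h (0, 0) = 0" and up: "\<And>k. k < 2 * n \<Longrightarrow> h_up h k = int (?lt k)"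
    and ri: "\<And>k. k < 2 * n \<Longrightarrow> h_right h k = int (?mt k)" and nw: "\<And>k. k < 2 * n \<Longrightarrow> h_nw n h k = int (ka k)"
    using h by (auto simp: SkewSkep_def)
  have s1: "h (int a, int (b + 1)) + h (int (a + 1), int (b + 1)) \<ge> h (int a, int (b + 2)) + h (int (a + 1), int b)"
    if "a + b + 2 \<le> 2 * n" for a b
    using s that unfolding skew_skeps_iff by blast
  have d1: "d (Suc m) (Suc k) \<le> d m k" if "m < 2 * n" "k < m" for m k
  proof -
    have "int (Suc (m - Suc k)) = int (m - k)" using that by simp
    then show ?thesis using s1[of "m - Suc k" k] that by (simp add: d_def)
  qed
  have d2: "d (2 * n) k = int (ka k)" if "k < 2 * n" for k
    using nw[OF that] by (simp add: d_def h_nw_int[OF that])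
  have dpos: "\<forall>k<m. d m k \<ge> 0" if "m \<le> 2 * n" for m
    using that
  proof (induction m rule: inc_induct)
    case (step m)
    show ?case
    proof (intro allI impI)
      fix k assume "k < m"
      then have "0 \<le> d (Suc m) (Suc k)" using step by auto
      also have "\<dots> \<le> d m k" using d1 step \<open>k < m\<close> by auto
      finally show "0 \<le> d m k" .
    qed
  qed (simp add: d2)
  show 1: "int (zigzag_of n h m k) = h (int (m - Suc k), int (Suc k)) - h (int (m - k), int k)"
    if "m \<le> 2 * n" "k < m" for m k
    using dpos[of m] that by (simp add: zigzag_of_def d_def)
  have H0: "h (int m, 0) = int (psum ?mt m)" if "m \<le> 2 * n" for m
    using that
  proof (induction m)
    case (Suc m)
    then show ?case using ri[of m] by (simp add: h_right_def add.commute)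
  qed (simp add: 0)
  have V0: "h (0, int m) = int (psum ?lt m)" if "m \<le> 2 * n" for m
    using that
  proof (induction m)
    case (Suc m)
    then show ?case using up[of m] by (simp add: h_up_def add.commute)
  qed (simp add: 0)
  have R: "h (int (m - j), int j) = int (psum ?mt m + psum (zigzag_of n h m) j)" if "m \<le> 2 * n" "j \<le> m" for m j
    using that(2)
  proof (induction j)
    case 0
    then show ?case using H0[OF that(1)] by simp
  next
    case (Suc j)
    then show ?case using 1[OF that(1), of j] by simp
  qed
  show "h (int i, int j) = int (psum ?mt (i + j) + psum (zigzag_of n h (i + j)) j)" if "i + j \<le> 2 * n" for i j
    using R[OF that, of j] by simp
  show "psum (zigzag_of n h m) m + psum ?mt m = psum ?lt m" if "m \<le> 2 * n" for m
    using R[OF that, of m] V0[OF that] by simp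
qed

text \<open>
  The first two skep inequalities are the interlacing of consecutive shapes, the last two are the two
  families in \<open>eps3_le\<close>. The triangle provides the latter only for \<open>j \<le> m\<close>. For larger \<open>j\<close> the partial
  sums have reached the sizes of the shapes, and the inequality says that the upper boundary
  decreases by steps of two, which holds because \<open>lam\<close> and \<open>nu\<close> are partitions.
\<close>

lemma zigzag_of_in:
  assumes h: "h \<in> SkewSkep n lam mu nu rho ka"
    and lam: "partition_len n lam" and nu: "partition_len n nu" and ka: "partition_len (2 * n) ka"
  shows "zigzag_of n h \<in> zigzags n (interleave mu rho) (interleave lam nu) ka"
proof -
  let ?mt = "interleave mu rho" and ?lt = "interleave lam nu"
  define Z where "Z = zigzag_of n h"
  note r = skep_representation[OF h, folded Z_def]
  have s: "h \<in> skew_skeps n" and nw: "\<And>k. k < 2 * n \<Longrightarrow> h_nw n h k = int (ka k)"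
    using h by (auto simp: SkewSkep_def)
  have s1: "h (int a, int (b + 1)) + h (int (a + 1), int (b + 1)) \<ge> h (int a, int (b + 2)) + h (int (a + 1), int b)"
    and s2: "h (int (a + 1), int b) + h (int (a + 1), int (b + 1)) \<ge> h (int (a + 2), int b) + h (int a, int (b + 1))"
    if "a + b + 2 \<le> 2 * n" for a b
    using s that unfolding skew_skeps_iff by blast+
  have s3: "h (int a, int (b + 1)) + h (int (a + 1), int (b + 1)) \<ge> h (int a, int b) + h (int (a + 1), int (b + 2))"
    and s4: "h (int (a + 1), int b) + h (int (a + 1), int (b + 1)) \<ge> h (int a, int b) + h (int (a + 2), int (b + 1))"
    if "a + b + 3 \<le> 2 * n" for a b
    using s that unfolding skew_skeps_iff by blast+
  have Z0: "Z m k = 0" if "m \<le> k" "m \<le> 2 * n" for m k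
    using that by (simp add: Z_def zigzag_of_def)
  have hs: "hstrip (Z m) (Z (Suc m))" if m: "m < 2 * n" for m
    unfolding hstrip_def
  proof (intro allI conjI)
    fix k
    show "Z m k \<le> Z (Suc m) k"
    proof (cases "k < m")
      case True
      define a where "a = m - Suc k"
      have a: "m - k = a + 1" "Suc m - Suc k = a + 1" "Suc m - k = a + 2" "m - Suc k = a" "a + k + 2 \<le> 2 * n"
        using True m by (auto simp: a_def)
      have "int (Z m k) \<le> int (Z (Suc m) k)"
        using r(1)[of m k] r(1)[of "Suc m" k] s2[OF a(5)] True m unfolding a by simp
      then show ?thesis by simp
    next
      case False
      then show ?thesis using Z0 m by simp
    qed
    show "Z (Suc m) (Suc k) \<le> Z m k"
    proof (cases "k < m")
      case True
      define a where "a = m - Suc k"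
      have a: "m - k = a + 1" "Suc m - Suc k = a + 1" "Suc m - Suc (Suc k) = a" "m - Suc k = a" "a + k + 2 \<le> 2 * n"
        using True m by (auto simp: a_def)
      have "int (Z (Suc m) (Suc k)) \<le> int (Z m k)"
        using r(1)[of m k] r(1)[of "Suc m" "Suc k"] s1[OF a(5)] True m unfolding a by simp
      then show ?thesis by simp
    next
      case False
      then show ?thesis using Z0[of "Suc m" "Suc k"] m by simp
    qed
  qed
  have Z00: "Z 0 = (\<lambda>_. 0)" using Z0 by auto
  have len: "partition_len m (Z m)" if "m \<le> 2 * n" for m
    using hstrip_chain_len[of "2 * n" Z 0 m] hs that Z00 by simp
  have size: "psize (Z m) + psum ?mt m = psum ?lt m" if "m \<le> 2 * n" for m
    using r(3)[OF that] psize_partition_len[OF len[OF that]] by simp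
  have wt: "psize (Z (Suc m)) + ?mt m = psize (Z m) + ?lt m" if "m < 2 * n" for m
    using size[of m] size[of "Suc m"] that by simp
  have dec: "?lt (m + 2) \<le> ?lt m" for m
    using lam nu by (auto simp: interleave_def partition_len_def antimono_def)
  have top: "Z (2 * n) = ka"
  proof
    fix k
    show "Z (2 * n) k = ka k"
    proof (cases "k < 2 * n")
      case True
      then show ?thesis using r(1)[of "2 * n" k] nw[OF True] by (simp add: h_nw_int[OF True])
    next
      case False
      then show ?thesis using ka Z0 by (simp add: partition_len_def)
    qed
  qed
  have eps: "eps3_le (int (?mt m) - int (?mt (m + 2))) (Z m) (Z (m + 1)) (Z (m + 2)) (Z (m + 3))"
    if m: "m + 3 \<le> 2 * n" for m
    unfolding eps3_le_def
  proof (intro allI)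
    fix j
    show "int (psum (Z (m + 3)) (Suc j)) + int (psum (Z m) j)
        \<le> int (?mt m) - int (?mt (m + 2)) + int (psum (Z (m + 2)) (Suc j)) + int (psum (Z (m + 1)) j) \<and>
       int (psum (Z (m + 3)) (Suc (Suc j))) + int (psum (Z m) j)
        \<le> int (?mt m) - int (?mt (m + 2)) + int (psum (Z (m + 2)) (Suc j)) + int (psum (Z (m + 1)) (Suc j))"
    proof (cases "j \<le> m")
      case True
      define a where "a = m - j"
      have a: "a + j = m" "a + (j + 1) = m + 1" "a + 1 + j = m + 1" "a + 1 + (j + 1) = m + 2" "a + 1 + (j + 2) = m + 3"
         "a + 2 + (j + 1) = m + 3"
        and l: "a + j \<le> 2 * n" "a + (j + 1) \<le> 2 * n" "a + 1 + j \<le> 2 * n" "a + 1 + (j + 1) \<le> 2 * n" "a + 1 + (j + 2) \<le> 2 * n"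
           "a + 2 + (j + 1) \<le> 2 * n"
        using True m by (auto simp: a_def)
      have p: "psum ?mt (m + 1) = psum ?mt m + ?mt m" "psum ?mt (m + 3) = psum ?mt (m + 2) + ?mt (m + 2)"
        by (simp_all add: eval_nat_numeral)
      have 3: "a + j + 3 \<le> 2 * n" using a m by simp
      show ?thesis
        using s3[OF 3] s4[OF 3] unfolding r(2)[OF l(1)] r(2)[OF l(2)] r(2)[OF l(3)] r(2)[OF l(4)] r(2)[OF l(5)] r(2)[OF l(6)] a p
        by simp
    next
      case False
      have "psum (Z m) j = psize (Z m)" "psum (Z (m + 1)) j = psize (Z (m + 1))"
        "psum (Z (m + 1)) (Suc j) = psize (Z (m + 1))" "psum (Z (m + 2)) (Suc j) = psize (Z (m + 2))"
        using psum_all[OF len[of m], of j] psum_all[OF len[of "m + 1"], of j] psum_all[OF len[of "m + 1"], of "Suc j"]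
          psum_all[OF len[of "m + 2"], of "Suc j"] False m by auto
      moreover have "psum (Z (m + 3)) (Suc j) \<le> psize (Z (m + 3))" "psum (Z (m + 3)) (Suc (Suc j)) \<le> psize (Z (m + 3))"
        using psum_le_psize partition_len_is_partition[OF len] m by blast+
      moreover have "psize (Z (m + 1)) + ?mt m = psize (Z m) + ?lt m"
        "psize (Z (m + 3)) + ?mt (m + 2) = psize (Z (m + 2)) + ?lt (m + 2)"
        using wt[of m] wt[of "m + 2"] m by (simp_all add: eval_nat_numeral)
      ultimately show ?thesis using dec[of m] by linarith
    qed
  qed
  have "Z \<in> extensional {..2 * n}" by (simp add: Z_def zigzag_of_def)
  then show ?thesis
    unfolding Z_def[symmetric] zigzags_def using top hs wt eps Z00 by simp
qed

lemma skep_bij: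
  assumes lam: "partition_len n lam" and nu: "partition_len n nu" and ka: "partition_len (2 * n) ka"
  shows "bij_betw (zigzag_of n) (SkewSkep n lam mu nu rho ka) (zigzags n (interleave mu rho) (interleave lam nu) ka)"
proof (rule bij_betw_byWitness[where f' = "skep_of n (interleave mu rho)"])
  let ?mt = "interleave mu rho" and ?lt = "interleave lam nu"
  show "zigzag_of n ` SkewSkep n lam mu nu rho ka \<subseteq> zigzags n ?mt ?lt ka"
    using zigzag_of_in assms by blast
  show "skep_of n ?mt ` zigzags n ?mt ?lt ka \<subseteq> SkewSkep n lam mu nu rho ka"
    using skep_of_in by blast
  show "\<forall>h\<in>SkewSkep n lam mu nu rho ka. skep_of n ?mt (zigzag_of n h) = h"
  proof
    fix h assume h: "h \<in> SkewSkep n lam mu nu rho ka"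
    then have "h \<in> extensional (Delta (2 * n))" by (auto simp: SkewSkep_def skew_skeps_iff)
    moreover have "skep_of n ?mt (zigzag_of n h) \<in> extensional (Delta (2 * n))" by (simp add: skep_of_def)
    moreover have "skep_of n ?mt (zigzag_of n h) x = h x" if "x \<in> Delta (2 * n)" for x
    proof -
      obtain a b where x: "x = (a, b)" by (cases x)
      with that have ab: "(a, b) \<in> Delta (2 * n)" by simp
      obtain i j where "a = int i" "b = int j" "i + j \<le> 2 * n"
        using Delta_cases[OF ab] .
      then show ?thesis using skep_representation(2)[OF h] skep_of_int x by simp
    qed
    ultimately show "skep_of n ?mt (zigzag_of n h) = h" by (metis extensionalityI)
  qed
  show "\<forall>Z\<in>zigzags n ?mt ?lt ka. zigzag_of n (skep_of n ?mt Z) = Z"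
  proof
    fix Z assume Z: "Z \<in> zigzags n ?mt ?lt ka"
    note z = zigzagsD[OF Z]
    have h: "skep_of n ?mt Z \<in> SkewSkep n lam mu nu rho ka" using skep_of_in[OF Z] .
    show "zigzag_of n (skep_of n ?mt Z) = Z"
    proof (rule ext_upto_eqI[OF _ z(1)])
      show "zigzag_of n (skep_of n ?mt Z) \<in> extensional {..2 * n}" by (simp add: zigzag_of_def)
      fix m assume m: "m \<le> 2 * n"
      show "zigzag_of n (skep_of n ?mt Z) m = Z m"
      proof
        fix k
        show "zigzag_of n (skep_of n ?mt Z) m k = Z m k"
        proof (cases "k < m")
          case True
          have "int (zigzag_of n (skep_of n ?mt Z) m k) = int (Z m k)"
            unfolding skep_representation(1)[OF h m True]
            using skep_of_int[of "m - Suc k" "Suc k" n ?mt Z] skep_of_int[of "m - k" "k" n ?mt Z] True m by simp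
          then show ?thesis by simp
        next
          case False
          then show ?thesis using z(7)[OF m] m by (simp add: zigzag_of_def partition_len_def)
        qed
      qed
    qed
  qed
qed

lemma finite_zigzags:
  assumes "is_partition ka" shows "finite (zigzags n mt lt ka)"
proof -
  have "zigzags n mt lt ka \<subseteq> PiE {..2 * n} (\<lambda>_. {p. \<forall>k. p k \<le> ka k})"
  proof
    fix Z assume Z: "Z \<in> zigzags n mt lt ka"
    have "Z i k \<le> ka k" if "i \<le> 2 * n" for i k
      using hstrip_chain_mono[of "2 * n" Z i "2 * n" k] zigzagsD[OF Z] that by auto
    then show "Z \<in> PiE {..2 * n} (\<lambda>_. {p. \<forall>k. p k \<le> ka k})"
      using zigzagsD(1)[OF Z] by (auto simp: PiE_def)
  qed
  then show ?thesis
    by (rule finite_subset) (auto intro!: finite_PiE finite_below assms)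
qed

section \<open>Semistandard tableaux as chains\<close>

lemma diagram_eq_Sigma: "skew_diagram lam mu = (SIGMA i:{i. lam i \<noteq> 0}. {mu i..<lam i})"
  by (auto simp: skew_diagram_def)

lemma finite_diagram: "is_partition lam \<Longrightarrow> finite (skew_diagram lam mu)"
proof -
  assume "is_partition lam"
  then obtain L where "partition_len L lam" by (auto simp: is_partition_def)
  then have "{i. lam i \<noteq> 0} \<subseteq> {..<L}" by (auto simp: partition_len_def) (metis le_less_linear less_numeral_extra(3))
  then show ?thesis unfolding diagram_eq_Sigma by (auto intro: finite_subset)
qed

lemma card_diagram:
  assumes "is_partition lam" "is_partition mu" "\<And>i. mu i \<le> lam i"
  shows "card (skew_diagram lam mu) + psize mu = psize lam"
proof -
  obtain L where L: "partition_len L lam" "partition_len L mu"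
    using is_partition_common_len[OF assms(1,2)] .
  have "skew_diagram lam mu = (SIGMA i:{..<L}. {mu i..<lam i})"
    using L by (auto simp: skew_diagram_def partition_len_def) (metis le_less_linear less_zeroE)
  then have "card (skew_diagram lam mu) = (\<Sum>i<L. lam i - mu i)" by simp
  also have "\<dots> + (\<Sum>i<L. mu i) = (\<Sum>i<L. lam i)"
    unfolding sum.distrib[symmetric] by (rule sum.cong) (auto simp: assms(3))
  finally show ?thesis using L by (simp add: psize_partition_len psum_def)
qed

lemma ssytD:
  assumes "T \<in> skew_ssyt lam mu"
  shows "T \<in> extensional (skew_diagram lam mu)"
    "mu i \<le> j \<Longrightarrow> j \<le> j' \<Longrightarrow> j' < lam i \<Longrightarrow> T (i, j) \<le> T (i, j')"
    "mu i \<le> j \<Longrightarrow> j < lam i \<Longrightarrow> mu i' \<le> j \<Longrightarrow> j < lam i' \<Longrightarrow> i < i' \<Longrightarrow> T (i, j) < T (i', j)"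
proof -
  show "T \<in> extensional (skew_diagram lam mu)"
    "mu i \<le> j \<Longrightarrow> j < lam i \<Longrightarrow> mu i' \<le> j \<Longrightarrow> j < lam i' \<Longrightarrow> i < i' \<Longrightarrow> T (i, j) < T (i', j)"
    using assms by (auto simp: skew_ssyt_def PiE_def skew_diagram_def)
  show "mu i \<le> j \<Longrightarrow> j \<le> j' \<Longrightarrow> j' < lam i \<Longrightarrow> T (i, j) \<le> T (i, j')"
    using assms by (cases "j = j'") (auto simp: skew_ssyt_def skew_diagram_def)
qed

lemma ssytI:
  assumes "T \<in> extensional (skew_diagram lam mu)"
    "\<And>i j j'. mu i \<le> j \<Longrightarrow> j < j' \<Longrightarrow> j' < lam i \<Longrightarrow> T (i, j) \<le> T (i, j')"
    "\<And>i i' j. mu i \<le> j \<Longrightarrow> j < lam i \<Longrightarrow> mu i' \<le> j \<Longrightarrow> j < lam i' \<Longrightarrow> i < i' \<Longrightarrow> T (i, j) < T (i', j)"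
  shows "T \<in> skew_ssyt lam mu"
  using assms by (auto simp: skew_ssyt_def PiE_def skew_diagram_def)

definition tableaux where
  "tableaux lam mu M = {T \<in> skew_ssyt lam mu. content lam mu T = M}"

lemma set_content: "is_partition lam \<Longrightarrow> set_mset (content lam mu T) = T ` skew_diagram lam mu"
  by (simp add: content_def finite_diagram)

lemma content_union:
  assumes "finite D" "E \<subseteq> D"
  shows "image_mset T (mset_set D) = image_mset T (mset_set E) + image_mset T (mset_set (D - E))"
proof -
  have "mset_set D = mset_set (E \<union> (D - E))" using assms by (simp add: Un_absorb1)
  also have "\<dots> = mset_set E + mset_set (D - E)"
    using assms finite_subset by (intro mset_set_Union) auto
  finally show ?thesis by simp
qed

text \<open>
  The cells with the largest entry \<open>C\<close> form a horizontal strip at the outer border. A tableau is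
  the same as this strip together with the tableau of smaller entries inside of it.
\<close>

lemma tableaux_peel:
  assumes lam: "is_partition lam" and mu: "is_partition mu" and le: "\<And>i. mu i \<le> lam i" and M: "set_mset M \<subseteq> {..<C}"
  shows "bij_betw (\<lambda>(p, T). restrict (\<lambda>x. if x \<in> skew_diagram p mu then T x else C) (skew_diagram lam mu))
    (SIGMA p:{p \<in> strips_below s lam. \<forall>i. mu i \<le> p i}. tableaux p mu M)
    (tableaux lam mu (M + replicate_mset s C))"
proof -
  let ?D = "skew_diagram lam mu"
  let ?A = "SIGMA p:{p \<in> strips_below s lam. \<forall>i. mu i \<le> p i}. tableaux p mu M"
  let ?B = "tableaux lam mu (M + replicate_mset s C)"
  let ?F = "\<lambda>(p, T). restrict (\<lambda>x. if x \<in> skew_diagram p mu then T x else C) ?D"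
  define inner where "inner T i = mu i + card {j \<in> {mu i..<lam i}. T (i, j) < C}" for T :: "nat \<times> nat \<Rightarrow> nat" and i
  let ?G = "\<lambda>T. (inner T, restrict T (skew_diagram (inner T) mu))"
  have mum: "i \<le> i' \<Longrightarrow> mu i' \<le> mu i" for i i' using mu by (auto simp: is_partition_def partition_len_def antimono_def)
  have lamm: "i \<le> i' \<Longrightarrow> lam i' \<le> lam i" for i i' using lam by (auto simp: is_partition_def partition_len_def antimono_def)
  have F: "?F (p, T) \<in> ?B \<and> inner (?F (p, T)) = p"
    if p: "p \<in> strips_below s lam" "\<forall>i. mu i \<le> p i" and T: "T \<in> tableaux p mu M" for p T
  proof -
    have hs: "hstrip p lam" and sz: "psize lam = psize p + s" using p by (auto simp: strips_below_def)
    have pp: "is_partition p" using strips_below_is_partition[OF p(1) lam] .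
    have pm: "i \<le> i' \<Longrightarrow> p i' \<le> p i" for i i' using pp by (auto simp: is_partition_def partition_len_def antimono_def)
    have pl: "p i \<le> lam i" "lam (Suc i) \<le> p i" for i using hs by (auto simp: hstrip_def)
    have sub: "skew_diagram p mu \<subseteq> ?D" using pl(1) by (auto simp: skew_diagram_def intro: less_le_trans)
    have Ts: "T \<in> skew_ssyt p mu" and Tc: "content p mu T = M" using T by (auto simp: tableaux_def)
    have small: "T (i, j) < C" if "mu i \<le> j" "j < p i" for i j
    proof -
      have "T (i, j) \<in> set_mset M" using that set_content[OF pp, of mu T] Tc by (auto simp: skew_diagram_def)
      then show ?thesis using M by auto
    qed
    define T' where "T' = ?F (p, T)"
    have T'1: "T' (i, j) = T (i, j)" if "mu i \<le> j" "j < p i" for i j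
      using that pl(1)[of i] by (simp add: T'_def skew_diagram_def)
    have T'2: "T' (i, j) = C" if "mu i \<le> j" "p i \<le> j" "j < lam i" for i j
      using that by (simp add: T'_def skew_diagram_def)
    have "T' \<in> skew_ssyt lam mu"
    proof (rule ssytI)
      show "T' \<in> extensional ?D" by (simp add: T'_def)
      fix i j j' assume *: "mu i \<le> j" "j < j'" "j' < lam i"
      show "T' (i, j) \<le> T' (i, j')"
      proof (cases "j' < p i")
        case True
        then show ?thesis using * T'1 ssytD(2)[OF Ts, of i j j'] by simp
      next
        case False
        then have "T' (i, j') = C" using * T'2 by simp
        moreover have "T' (i, j) \<le> C"
          using * T'1[of i j] T'2[of i j] small[of i j] by (cases "j < p i") auto
        ultimately show ?thesis by simp
      qed
    next
      fix i i' j assume *: "mu i \<le> j" "j < lam i" "mu i' \<le> j" "j < lam i'" "i < i'"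
      have "lam i' \<le> p i" using lamm[of "Suc i" i'] pl(2)[of i] * by simp
      then have j: "j < p i" using * by simp
      show "T' (i, j) < T' (i', j)"
      proof (cases "j < p i'")
        case True
        then show ?thesis using * j T'1 ssytD(3)[OF Ts, of i j i'] by simp
      next
        case False
        then show ?thesis using * j T'1[of i j] T'2[of i' j] small[of i j] by simp
      qed
    qed
    moreover have "content lam mu T' = M + replicate_mset s C"
    proof -
      have "content lam mu T' = image_mset T' (mset_set (skew_diagram p mu)) + image_mset T' (mset_set (?D - skew_diagram p mu))"
        unfolding content_def by (rule content_union[OF finite_diagram[OF lam] sub])
      moreover have "image_mset T' (mset_set (skew_diagram p mu)) = content p mu T"
        unfolding content_def using sub finite_diagram[OF pp] by (intro image_mset_cong) (auto simp: T'_def)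
      moreover have "image_mset T' (mset_set (?D - skew_diagram p mu)) = image_mset (\<lambda>_. C) (mset_set (?D - skew_diagram p mu))"
        using finite_diagram[OF lam] by (intro image_mset_cong) (auto simp: T'_def)
      moreover have "card (?D - skew_diagram p mu) = s"
        using card_Diff_subset[OF finite_diagram[OF pp] sub] card_diagram[OF lam mu le] card_diagram[OF pp mu] p(2) sz
        by simp
      ultimately show ?thesis using Tc by (simp add: image_mset_const_eq)
    qed
    moreover have "inner T' = p"
    proof
      fix i
      have "{j \<in> {mu i..<lam i}. T' (i, j) < C} = {mu i..<p i}"
      proof (intro set_eqI iffI)
        fix j assume "j \<in> {j \<in> {mu i..<lam i}. T' (i, j) < C}"
        then show "j \<in> {mu i..<p i}" using T'2[of i j] by (cases "j < p i") auto
      next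
        fix j assume "j \<in> {mu i..<p i}"
        then show "j \<in> {j \<in> {mu i..<lam i}. T' (i, j) < C}" using T'1[of i j] small[of i j] pl(1)[of i] by auto
      qed
      then show "inner T' i = p i" using p(2) by (simp add: inner_def)
    qed
    ultimately show ?thesis by (simp add: T'_def tableaux_def)
  qed
  have G: "inner T \<in> strips_below s lam \<and> (\<forall>i. mu i \<le> inner T i) \<and> restrict T (skew_diagram (inner T) mu) \<in> tableaux (inner T) mu M
      \<and> ?F (?G T) = T"
    if T: "T \<in> ?B" for T
  proof -
    have Ts: "T \<in> skew_ssyt lam mu" and Tc: "content lam mu T = M + replicate_mset s C" using T by (auto simp: tableaux_def)
    have leC: "T (i, j) \<le> C" if "mu i \<le> j" "j < lam i" for i j
    proof -
      have "T (i, j) \<in> set_mset (M + replicate_mset s C)"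
        using that set_content[OF lam, of mu T] Tc by (auto simp: skew_diagram_def)
      then show ?thesis using M by (auto split: if_splits)
    qed
    define p where "p = inner T"
      \<comment> \<open>Rows increase, so the entries below \<open>C\<close> fill an initial segment of each row.\<close>
  have row: "{j \<in> {mu i..<lam i}. T (i, j) < C} = {mu i..<p i}" for i
    proof -
      let ?S = "{j \<in> {mu i..<lam i}. T (i, j) < C}"
      have "\<exists>e\<ge>mu i. ?S = {mu i..<e}"
      proof (cases "?S = {}")
        case True then show ?thesis by (intro exI[of _ "mu i"]) auto
      next
        case False
        define e where "e = Max ?S"
        have fin: "finite ?S" by auto
        have e: "e \<in> ?S" unfolding e_def by (rule Max_in[OF fin False])
        have "?S = {mu i..<Suc e}"
        proof (intro set_eqI iffI)
          fix j assume "j \<in> ?S"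
          then have "j \<le> e" unfolding e_def using Max_ge[OF fin] by blast
          then show "j \<in> {mu i..<Suc e}" using \<open>j \<in> ?S\<close> by auto
        next
          fix j assume "j \<in> {mu i..<Suc e}"
          then show "j \<in> ?S" using e ssytD(2)[OF Ts, of i j e] by auto
        qed
        then show ?thesis using e by (intro exI[of _ "Suc e"]) auto
      qed
      then obtain e where e: "e \<ge> mu i" "?S = {mu i..<e}" by blast
      then have "p i = e" by (simp add: p_def inner_def)
      then show ?thesis using e by simp
    qed
    have mp: "mu i \<le> p i" for i by (simp add: p_def inner_def)
    have lt: "T (i, j) < C \<longleftrightarrow> j < p i" if "mu i \<le> j" "j < lam i" for i j
      using row[of i] that by (auto simp: set_eq_iff)
    have pl: "p i \<le> lam i" for i
    proof -
      have "{mu i..<p i} \<subseteq> {mu i..<lam i}" unfolding row[symmetric] by blast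
      then show ?thesis using le[of i] mp[of i] by (cases "p i = mu i") auto
    qed
    have lp: "lam (Suc i) \<le> p i" for i
    proof (rule ccontr)
      assume "\<not> lam (Suc i) \<le> p i"
      then have *: "p i < lam (Suc i)" "p i < lam i" "mu i \<le> p i" "mu (Suc i) \<le> p i"
        using lamm[of i "Suc i"] mp[of i] mum[of i "Suc i"] by auto
      then have "T (i, p i) < T (Suc i, p i)" using ssytD(3)[OF Ts] by blast
      moreover have "T (Suc i, p i) \<le> C" using leC * by blast
      ultimately have "T (i, p i) < C" by simp
      then show False using lt * by blast
    qed
    have hs: "hstrip p lam" using pl lp by (simp add: hstrip_def)
    have pp: "is_partition p" using hstrip_is_partition[OF hs] lam by blast
    have sub: "skew_diagram p mu \<subseteq> ?D" using pl by (auto simp: skew_diagram_def intro: less_le_trans)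
    have ltD: "T x < C \<longleftrightarrow> x \<in> skew_diagram p mu" if "x \<in> ?D" for x
      using that lt by (cases x) (auto simp: skew_diagram_def)
    have eqC: "T x = C" if "x \<in> ?D - skew_diagram p mu" for x
      using ltD[of x] leC that by (cases x) (auto simp: skew_diagram_def le_less)
    have "content lam mu T = image_mset T (mset_set (skew_diagram p mu)) + image_mset T (mset_set (?D - skew_diagram p mu))"
      unfolding content_def by (rule content_union[OF finite_diagram[OF lam] sub])
    moreover have "image_mset T (mset_set (?D - skew_diagram p mu)) = image_mset (\<lambda>_. C) (mset_set (?D - skew_diagram p mu))"
      using eqC finite_diagram[OF lam] by (intro image_mset_cong) auto
    moreover have "image_mset T (mset_set (skew_diagram p mu)) = content p mu (restrict T (skew_diagram p mu))"
      unfolding content_def using finite_diagram[OF pp] by (intro image_mset_cong) auto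
    ultimately have eq: "content p mu (restrict T (skew_diagram p mu)) + replicate_mset (card (?D - skew_diagram p mu)) C
        = M + replicate_mset s C"
      using Tc by (simp add: image_mset_const_eq)
    have "count (content p mu (restrict T (skew_diagram p mu))) C = 0"
      using ltD sub by (auto simp: count_eq_zero_iff set_content[OF pp])
    moreover have "count M C = 0" using M by (auto simp: count_eq_zero_iff)
    ultimately have c: "card (?D - skew_diagram p mu) = s"
      using arg_cong[OF eq, of "\<lambda>N. count N C"] by simp
    then have Mc: "content p mu (restrict T (skew_diagram p mu)) = M" using eq by simp
    have "psize lam = psize p + s"
      using card_Diff_subset[OF finite_diagram[OF pp] sub] card_diagram[OF lam mu le] card_diagram[OF pp mu mp] c
        card_mono[OF finite_diagram[OF lam] sub] by simp
    moreover have "restrict T (skew_diagram p mu) \<in> skew_ssyt p mu"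
    proof (rule ssytI)
      fix i j j' assume *: "mu i \<le> j" "j < j'" "j' < p i"
      then show "restrict T (skew_diagram p mu) (i, j) \<le> restrict T (skew_diagram p mu) (i, j')"
        using ssytD(2)[OF Ts, of i j j'] pl[of i] by (simp add: skew_diagram_def)
    next
      fix i i' j assume "mu i \<le> j" "j < p i" "mu i' \<le> j" "j < p i'" "i < i'"
      then show "restrict T (skew_diagram p mu) (i, j) < restrict T (skew_diagram p mu) (i', j)"
        using ssytD(3)[OF Ts, of i j i'] pl[of i] pl[of i'] by (simp add: skew_diagram_def)
    qed simp
    moreover have "?F (?G T) = T"
    proof (rule extensionalityI[OF _ ssytD(1)[OF Ts]])
      fix x assume "x \<in> ?D"
      then show "?F (?G T) x = T x" using eqC[of x] by (auto simp: p_def)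
    qed auto
    ultimately show ?thesis using Mc hs mp by (simp add: strips_below_def tableaux_def p_def)
  qed
  show ?thesis
  proof (rule bij_betw_byWitness[where f' = ?G])
    show "?F ` ?A \<subseteq> ?B" using F by fastforce
    show "?G ` ?B \<subseteq> ?A" using G by auto
    show "\<forall>T\<in>?B. ?F (?G T) = T" using G by blast
    show "\<forall>x\<in>?A. ?G (?F x) = x"
    proof
      fix x assume "x \<in> ?A"
      then obtain p T where x: "x = (p, T)" and p: "p \<in> strips_below s lam" "\<forall>i. mu i \<le> p i" and T: "T \<in> tableaux p mu M"
        by auto
      have i: "inner (?F (p, T)) = p" using F[OF p T] by blast
      have sub: "skew_diagram p mu \<subseteq> ?D"
        using p(1) by (auto simp: skew_diagram_def strips_below_def hstrip_def intro: less_le_trans)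
      have "T \<in> extensional (skew_diagram p mu)" using T ssytD(1) by (auto simp: tableaux_def)
      then have "restrict (?F (p, T)) (skew_diagram p mu) = T"
        using sub by (intro extensionalityI[of _ "skew_diagram p mu"]) auto
      then show "?G (?F x) = x" unfolding x i by simp
    qed
  qed
qed

lemma finite_card_tableaux:
  assumes mu: "is_partition mu"
  shows "is_partition lam \<Longrightarrow> (\<And>i. mu i \<le> lam i) \<Longrightarrow> set_mset M \<subseteq> {..<C} \<Longrightarrow>
    finite (tableaux lam mu M) \<and> card (tableaux lam mu M) = nchains (map (count M) [0..<C]) mu lam"
proof (induction C arbitrary: lam M)
  case 0
  then have M: "M = {#}" by auto
  show ?case
  proof (cases "lam = mu")
    case True
    then have "skew_diagram lam mu = {}" by (auto simp: skew_diagram_def)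
    then have "tableaux lam mu M = {\<lambda>_. undefined}" using M
      by (auto simp: tableaux_def content_def skew_ssyt_def)
    then show ?thesis using True by simp
  next
    case False
    then obtain i where "mu i < lam i" using 0(2) by (metis ext le_neq_implies_less)
    then have "(i, mu i) \<in> skew_diagram lam mu" by (simp add: skew_diagram_def)
    then have "content lam mu T \<noteq> {#}" for T
      using set_content[OF 0(1), of mu T] by auto
    then have "tableaux lam mu M = {}" using M by (auto simp: tableaux_def)
    then show ?thesis using False by (simp add: eq_commute)
  qed
next
  case (Suc C)
  define M' where "M' = filter_mset (\<lambda>x. x \<noteq> C) M"
  have MM: "M = M' + replicate_mset (count M C) C"
    unfolding M'_def by (rule multiset_eqI) auto
  have M': "set_mset M' \<subseteq> {..<C}" using Suc.prems(3) by (auto simp: M'_def less_Suc_eq)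
  let ?s = "count M C"
  let ?P = "{p \<in> strips_below ?s lam. \<forall>i. mu i \<le> p i}"
  note bij = tableaux_peel[OF Suc.prems(1) mu Suc.prems(2) M', of ?s, folded MM]
  have IH: "finite (tableaux p mu M') \<and> card (tableaux p mu M') = nchains (map (count M') [0..<C]) mu p" if p: "p \<in> ?P" for p
  proof (rule Suc.IH[OF _ _ M'])
    show "is_partition p" using strips_below_is_partition[of p ?s lam] Suc.prems(1) p by simp
    show "mu i \<le> p i" for i using p by simp
  qed
  have fP: "finite ?P" by (rule finite_subset[OF _ finite_strips_below[OF Suc.prems(1)]]) auto
  have fin: "finite (SIGMA p:?P. tableaux p mu M')" by (rule finite_SigmaI[OF fP]) (simp add: IH)
  have "card (tableaux lam mu M) = card (SIGMA p:?P. tableaux p mu M')"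
    using bij_betw_same_card[OF bij] by simp
  also have "\<dots> = (\<Sum>p \<in> ?P. card (tableaux p mu M'))" by (rule card_SigmaI[OF fP]) (use IH in simp)
  also have "\<dots> = (\<Sum>p \<in> ?P. nchains (map (count M') [0..<C]) mu p)" using IH by simp
  also have "\<dots> = (\<Sum>p \<in> strips_below ?s lam. nchains (map (count M') [0..<C]) mu p)"
    using finite_strips_below[OF Suc.prems(1)] nchains_nonzeroD(2)[OF _ mu]
    by (intro sum.mono_neutral_left) auto
  also have "\<dots> = nchains (map (count M') [0..<C] @ [?s]) mu lam"
    by (rule nchains_top_snoc[OF mu Suc.prems(1), symmetric])
  also have "map (count M') [0..<C] = map (count M) [0..<C]" by (auto simp: M'_def)
  finally show ?case using bij_betw_finite[OF bij] fin by simp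
qed

lemma skew_schur_eq_nchains:
  assumes "is_partition lam" "is_partition mu" "set_mset M \<subseteq> {..<C}"
  shows "skew_schur lam mu M = int (nchains (map (count M) [0..<C]) mu lam)"
proof (cases "\<forall>i. mu i \<le> lam i")
  case True
  then show ?thesis
    using finite_card_tableaux[OF assms(2,1) _ assms(3)] by (simp add: skew_schur_def tableaux_def)
next
  case False
  then have "nchains (map (count M) [0..<C]) mu lam = 0"
    using nchains_nonzeroD(2)[OF _ assms(2)] by blast
  then show ?thesis unfolding skew_schur_def using False by auto
qed

section \<open>Schur functions are linearly independent\<close>

definition monomial :: "nat \<Rightarrow> (nat \<Rightarrow> nat) \<Rightarrow> nat multiset" where
  "monomial C p = (\<Sum>k<C. replicate_mset (p k) k)"

lemma count_monomial: "count (monomial C p) x = (if x < C then p x else 0)"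
  by (simp add: monomial_def count_sum)

lemma set_monomial: "set_mset (monomial C p) \<subseteq> {..<C}"
proof
  fix x assume "x \<in># monomial C p"
  then have "count (monomial C p) x \<noteq> 0" by simp
  then show "x \<in> {..<C}" by (simp add: count_monomial split: if_splits)
qed

lemma map_count_monomial: "map (count (monomial C p)) [0..<C] = map p [0..<C]"
  by (simp add: count_monomial)

lemma schur_eq_nchains:
  "is_partition p \<Longrightarrow> set_mset M \<subseteq> {..<C} \<Longrightarrow> schur p M = int (nchains (map (count M) [0..<C]) (\<lambda>_. 0) p)"
  unfolding schur_def by (rule skew_schur_eq_nchains) auto

lemma psum_list: "j \<le> C \<Longrightarrow> sum_list (take j (map p [0..<C])) = psum p j"
  by (simp add: take_map interv_sum_list_conv_sum_set_nat psum_def atLeast0LessThan)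

text \<open>
  After \<open>j\<close> strips a chain starting from the empty partition occupies at most \<open>j\<close> rows of \<open>q\<close>.
\<close>

lemma nchains_dominance:
  "nchains ms (\<lambda>_. 0) q \<noteq> 0 \<Longrightarrow> sum_list (take j ms) \<le> psum q j"
proof (induction ms arbitrary: q rule: rev_induct)
  case (snoc s ms)
  have q: "is_partition q" using nchains_nonzeroD(1)[OF snoc.prems] by simp
  obtain q' where q': "q' \<in> strips_below s q" "nchains ms (\<lambda>_. 0) q' \<noteq> 0"
    using snoc.prems nchains_top_snoc[OF is_partition_zero(1) q] by (metis sum.neutral)
  show ?case
  proof (cases "j \<le> length ms")
    case True
    then have "sum_list (take j (ms @ [s])) = sum_list (take j ms)" by simp
    also have "\<dots> \<le> psum q' j" by (rule snoc.IH[OF q'(2)])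
    also have "\<dots> \<le> psum q j" by (rule psum_mono) (use q'(1) in \<open>auto simp: strips_below_def hstrip_def\<close>)
    finally show ?thesis .
  next
    case False
    then have "sum_list (take j (ms @ [s])) = psize q"
      using nchains_nonzeroD(3)[OF snoc.prems] by simp
    moreover have "psum q j = psize q"
      using nchains_len[OF snoc.prems, of 0] False by (intro psum_all[of "length (ms @ [s])"]) auto
    ultimately show ?thesis by simp
  qed
qed simp

text \<open>
  The unique tableau of shape and content \<open>p\<close> has all entries of each row equal to the row index. By
  induction the last strip must be the last row, because the remaining shape has at most \<open>C\<close> rows.
\<close>

lemma nchains_self:
  "partition_len C p \<Longrightarrow> nchains (map p [0..<C]) (\<lambda>_. 0) p = 1"
proof (induction C arbitrary: p)
  case 0
  then show ?case by (auto simp: partition_len_def)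
next
  case (Suc C)
  define p' where "p' k = (if k < C then p k else 0)" for k
  note a = partition_lenD[OF Suc.prems]
  have hs: "hstrip p' p" using a by (auto simp: hstrip_def p'_def)
  have len': "partition_len C p'" using hstrip_antimono[OF hs] by (simp add: partition_len_def p'_def)
  have p: "is_partition p" "is_partition p'" using partition_len_is_partition Suc.prems len' by auto
  have sz: "psize p = psize p' + p C"
    using psize_partition_len[OF Suc.prems] psize_partition_len[OF len'] by (simp add: psum_def p'_def)
  have mem: "p' \<in> strips_below (p C) p" using hs sz by (simp add: strips_below_def)
  have zero: "nchains (map p [0..<C]) (\<lambda>_. 0) q = 0" if q: "q \<in> strips_below (p C) p" "q \<noteq> p'" for q
  proof (rule ccontr)
    assume "nchains (map p [0..<C]) (\<lambda>_. 0) q \<noteq> 0"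
    from nchains_len[OF this, of 0] have len: "partition_len C q" by simp
    have "q k \<le> p' k" for k
      using q len by (auto simp: p'_def strips_below_def hstrip_def partition_len_def)
    moreover have "psize q = psize p'" using q sz by (simp add: strips_below_def)
    ultimately show False
      using psize_mono_eqD[of q p'] partition_len_is_partition[OF len] p q(2) by blast
  qed
  have "nchains (map p [0..<Suc C]) (\<lambda>_. 0) p = (\<Sum>q \<in> strips_below (p C) p. nchains (map p [0..<C]) (\<lambda>_. 0) q)"
    using nchains_top_snoc[OF is_partition_zero(1) p(1)] by simp
  also have "\<dots> = (\<Sum>q \<in> {p'}. nchains (map p [0..<C]) (\<lambda>_. 0) q)"
    by (rule sum.mono_neutral_right) (use finite_strips_below[OF p(1)] mem zero in auto)
  also have "map p [0..<C] = map p' [0..<C]" by (simp add: p'_def)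
  finally show ?case using Suc.IH[OF len'] by simp
qed

lemma schur_monomial_self: "partition_len C p \<Longrightarrow> schur p (monomial C p) = 1"
  using schur_eq_nchains[OF partition_len_is_partition set_monomial] nchains_self
  by (simp add: map_count_monomial)

lemma schur_monomial_dominance:
  assumes p: "partition_len C p" and q: "partition_len C q" and nz: "schur q (monomial C p) \<noteq> 0"
  shows "psum p j \<le> psum q j"
proof -
  have n: "nchains (map p [0..<C]) (\<lambda>_. 0) q \<noteq> 0"
    using nz schur_eq_nchains[OF partition_len_is_partition[OF q] set_monomial, of C p] by (simp add: map_count_monomial)
  have *: "psum p j \<le> psum q j" if "j \<le> C" for j
    using nchains_dominance[OF n, of j] psum_list[OF that] by simp
  show ?thesis
  proof (cases "j \<le> C")
    case False
    then show ?thesis using psum_all[OF p, of j] psum_all[OF q, of j] psum_all[OF p, of C] psum_all[OF q, of C] *[of C] by simp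
  qed (rule *)
qed

lemma psum_inject: "(\<And>j. psum p j = psum q j) \<Longrightarrow> p = q"
proof
  fix k assume *: "\<And>j. psum p j = psum q j"
  show "p k = q k" using *[of k] *[of "Suc k"] by simp
qed

lemma schur_inject: "is_partition p \<Longrightarrow> is_partition q \<Longrightarrow> schur p = schur q \<longleftrightarrow> p = q"
proof
  assume pq: "is_partition p" "is_partition q" and eq: "schur p = schur q"
  obtain C where C: "partition_len C p" "partition_len C q" using is_partition_common_len[OF pq] .
  have "psum p j = psum q j" for j
    using schur_monomial_dominance[OF C(1) C(2), of j] schur_monomial_dominance[OF C(2) C(1), of j]
      schur_monomial_self[OF C(1)] schur_monomial_self[OF C(2)] eq by simp
  then show "p = q" by (rule psum_inject)
qed simp

lemma sum_series_apply: "(\<Sum>i\<in>I. f i) M = (\<Sum>i\<in>I. f i M)" for f :: "'a \<Rightarrow> series"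
  by (induction I rule: infinite_finite_induct) auto

lemma schur_basis_eq: "schur_basis = schur ` {p. is_partition p}"
  by (auto simp: schur_basis_def is_partition_def)

text \<open>
  The matrix of coefficients of Schur functions at the monomials \<open>x\<^sup>p\<close> is unitriangular for the dominance
  order. In a linear relation, a shape \<open>p\<close> that is maximal for dominance among the shapes with nonzero
  coefficient is the only one that contributes to the monomial \<open>x\<^sup>p\<close>.
\<close>

lemma schur_basis_independent: "series.independent schur_basis"
proof
  assume "series.dependent schur_basis"
  then obtain t u where t: "finite t" "t \<subseteq> schur_basis" and sum0: "(\<Sum>v\<in>t. series_scale (u v) v) = 0"
    and "\<exists>v\<in>t. u v \<noteq> 0"
    unfolding series.dependent_explicit by blast
  define S where "S = {p. is_partition p \<and> schur p \<in> t \<and> u (schur p) \<noteq> 0}"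
  have finS: "finite S"
    by (rule inj_on_finite[of schur S t]) (auto simp: inj_on_def S_def schur_inject t)
  have neS: "S \<noteq> {}"
    using \<open>\<exists>v\<in>t. u v \<noteq> 0\<close> t(2) by (auto simp: S_def schur_basis_eq)
  have "\<exists>C. \<forall>p\<in>S. partition_len C p"
  proof -
    have "\<forall>p\<in>S. \<exists>m. partition_len m p" by (auto simp: S_def is_partition_def)
    then obtain m where m: "\<forall>p\<in>S. partition_len (m p) p" by metis
    have "partition_len (\<Sum>p\<in>S. m p) p" if "p \<in> S" for p
      using m that partition_len_mono member_le_sum[OF that, of m] finS by blast
    then show ?thesis by blast
  qed
  then obtain C where C: "\<And>p. p \<in> S \<Longrightarrow> partition_len C p" by blast
  \<comment> \<open>A numerical function that increases strictly along the dominance order.\<close>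
  define f where "f p = (\<Sum>j\<le>C. psum p j)" for p
  obtain p where p: "p \<in> S" and max: "\<And>q. q \<in> S \<Longrightarrow> f q \<le> f p"
  proof -
    have "Max (f ` S) \<in> f ` S" using finS neS by (intro Max_in) auto
    then obtain p where "p \<in> S" "Max (f ` S) = f p" by blast
    then show ?thesis using that[of p] Max_ge[of "f ` S"] finS by auto
  qed
  have only: "q = p" if q: "q \<in> S" "schur q (monomial C p) \<noteq> 0" for q
  proof (rule psum_inject)
    fix j
    have le: "psum p j \<le> psum q j" for j
      by (rule schur_monomial_dominance[OF C[OF p] C[OF q(1)] q(2)])
    have "f p \<le> f q" unfolding f_def by (rule sum_mono) (rule le)
    then have "f p = f q" using max[OF q(1)] by simp
    then have eq: "psum p j = psum q j" if "j \<le> C" for j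
      using sum_mono_inv[of "psum p" "{..C}" "psum q" j] le that unfolding f_def by auto
    show "psum q j = psum p j"
    proof (cases "j \<le> C")
      case False
      then show ?thesis
        using psum_all[OF C[OF p], of j] psum_all[OF C[OF q(1)], of j]
          psum_all[OF C[OF p], of C] psum_all[OF C[OF q(1)], of C] eq[of C] by simp
    qed (simp add: eq)
  qed
  have "0 = (\<Sum>v\<in>t. series_scale (u v) v) (monomial C p)" using sum0 by simp
  also have "\<dots> = (\<Sum>v\<in>t. u v * v (monomial C p))"
    by (simp add: sum_series_apply series_scale_def)
  also have "\<dots> = (\<Sum>v\<in>{schur p}. u v * v (monomial C p))"
  proof (rule sum.mono_neutral_right[OF t(1)])
    show "{schur p} \<subseteq> t" using p by (simp add: S_def)
    show "\<forall>v\<in>t - {schur p}. u v * v (monomial C p) = 0"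
    proof
      fix v assume v: "v \<in> t - {schur p}"
      then obtain q where q: "v = schur q" "is_partition q" using t(2) by (auto simp: schur_basis_eq)
      then show "u v * v (monomial C p) = 0" using only[of q] v by (auto simp: S_def)
    qed
  qed
  also have "\<dots> = u (schur p)" using schur_monomial_self[OF C[OF p]] by simp
  finally show False using p by (simp add: S_def)
qed

section \<open>The Schur expansion of a product of two skew Schur functions\<close>

lemma series_mult_skew_schur:
  assumes "is_partition lam" "is_partition mu" "is_partition nu" "is_partition rho" and M: "set_mset M \<subseteq> {..<C}"
  shows "series_mult (skew_schur lam mu) (skew_schur nu rho) M =
    int (\<Sum>(xs, ys) \<in> splits (map (count M) [0..<C]). nchains xs mu lam * nchains ys rho nu)"
proof -
  let ?c = "\<lambda>A. map (count A) [0..<C]"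
  have from_list: "monomial C ((!) (?c A)) = A" if "set_mset A \<subseteq> {..<C}" for A
    by (rule multiset_eqI) (use that in \<open>auto simp: count_monomial not_in_iff[symmetric]\<close>)
  have to_list: "?c (monomial C ((!) xs)) = xs" if "length xs = C" for xs
    using that by (auto simp: count_monomial intro!: nth_equalityI)
  have "series_mult (skew_schur lam mu) (skew_schur nu rho) M =
      (\<Sum>(xs, ys) \<in> splits (?c M). int (nchains xs mu lam * nchains ys rho nu))"
    unfolding series_mult_def
  proof (rule sum.reindex_bij_witness[where j = "\<lambda>(A, B). (?c A, ?c B)"
        and i = "\<lambda>(xs, ys). (monomial C ((!) xs), monomial C ((!) ys))"], goal_cases)
    case (1 x)
    then obtain A B where x: "x = (A, B)" "A + B = M" by auto
    then have "set_mset A \<subseteq> {..<C}" "set_mset B \<subseteq> {..<C}" using M by auto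
    then show ?case using from_list x by simp
  next
    case (2 x)
    then obtain A B where x: "x = (A, B)" "A + B = M" by auto
    then show ?case by (auto simp: splits_def intro!: nth_equalityI)
  next
    case (3 y)
    then obtain xs ys where y: "y = (xs, ys)" "length xs = length ys" "map2 (+) xs ys = ?c M"
      by (auto simp: splits_def)
    then have "length xs = C" by (metis length_map length_upt length_zip min.idem minus_nat.diff_0)
    then show ?case using to_list y by simp
  next
    case (4 y)
    then obtain xs ys where y: "y = (xs, ys)" "length xs = length ys" and m: "map2 (+) xs ys = ?c M"
      by (auto simp: splits_def)
    have l: "length xs = C" using y m by (metis length_map length_upt length_zip min.idem minus_nat.diff_0)
    have nth: "xs ! k + ys ! k = count M k" if "k < C" for k
      using arg_cong[OF m, of "\<lambda>xs. xs ! k"] that l y by simp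
    have "monomial C ((!) xs) + monomial C ((!) ys) = M"
    proof (rule multiset_eqI)
      fix k
      show "count (monomial C ((!) xs) + monomial C ((!) ys)) k = count M k"
      proof (cases "k < C")
        case False
        then have "k \<notin># M" using M by auto
        then show ?thesis using False by (simp add: count_monomial not_in_iff)
      qed (simp add: count_monomial nth)
    qed
    then show ?case using y by simp
  next
    case (5 x)
    then obtain A B where x: "x = (A, B)" "A + B = M" by auto
    then have "set_mset A \<subseteq> {..<C}" "set_mset B \<subseteq> {..<C}" using M by auto
    then show ?case using assms by (simp add: x skew_schur_eq_nchains)
  qed
  then show ?thesis by (simp add: case_prod_unfold)
qed

text \<open>
  The case \<open>al = 0\<close> of \<open>nchains_product\<close>: a tableau of empty shape has no entries, so one of the two
  factors disappears.
\<close>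

lemma nchains_skew_expansion:
  assumes mu: "partition_len n mu" and lam: "partition_len n lam"
  shows "nchains ms mu lam =
    (\<Sum>al \<in> partitions_of (psize lam - psize mu). card (lrchains n mu lam (\<lambda>_. 0) al) * nchains ms (\<lambda>_. 0) al)"
proof -
  have p: "is_partition mu" "is_partition lam" using assms partition_len_is_partition by auto
  have zero: "nchains (replicate k 0) (\<lambda>_. 0) (\<lambda>_. 0) = 1" for k
  proof (induction k)
    case (Suc k)
    have "strips_above 0 (\<lambda>_. 0) = {\<lambda>_. 0}"
      using is_partition_psize_0D strips_above_is_partition[OF _ is_partition_zero(1)]
      by (auto simp: strips_above_def hstrip_def)
    then show ?case using Suc by simp
  qed simp
  have "(\<Sum>(xs, ys) \<in> splits ms. nchains xs (\<lambda>_. 0) (\<lambda>_. 0) * nchains ys mu lam)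
      = (\<Sum>(xs, ys) \<in> {(replicate (length ms) 0, ms)}. nchains xs (\<lambda>_. 0) (\<lambda>_. 0) * nchains ys mu lam)"
  proof (rule sum.mono_neutral_right[OF finite_splits])
    show "{(replicate (length ms) 0, ms)} \<subseteq> splits ms"
      by (auto simp: splits_def intro!: nth_equalityI)
    show "\<forall>x\<in>splits ms - {(replicate (length ms) 0, ms)}.
        (case x of (xs, ys) \<Rightarrow> nchains xs (\<lambda>_. 0) (\<lambda>_. 0) * nchains ys mu lam) = 0"
    proof
      fix x assume x: "x \<in> splits ms - {(replicate (length ms) 0, ms)}"
      obtain xs ys where xe: "x = (xs, ys)" by (cases x)
      then have s: "length xs = length ys" "map2 (+) xs ys = ms" using x by (auto simp: splits_def)
      have "nchains xs (\<lambda>_. 0) (\<lambda>_. 0) = 0"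
      proof (rule ccontr)
        assume "nchains xs (\<lambda>_. 0) (\<lambda>_. 0) \<noteq> 0"
        from nchains_nonzeroD(3)[OF this is_partition_zero(1)] have "sum_list xs = 0" by simp
        then have 0: "xs ! k = 0" if "k < length xs" for k using that by (simp add: nth_mem)
        have "xs = replicate (length xs) 0" by (rule nth_equalityI) (use 0 in auto)
        moreover have "map2 (+) xs ys = ys" by (rule nth_equalityI) (use 0 s in auto)
        ultimately show False using x xe s by auto
      qed
      then show "(case x of (xs, ys) \<Rightarrow> nchains xs (\<lambda>_. 0) (\<lambda>_. 0) * nchains ys mu lam) = 0" by (simp add: xe)
    qed
  qed
  also have "\<dots> = nchains ms mu lam" by (simp add: zero)
  finally have 1: "nchains ms mu lam =
     (\<Sum>al \<in> partitions_of (sum_list ms). card (lrchains n mu lam (\<lambda>_. 0) al) * nchains ms (\<lambda>_. 0) al)"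
    using nchains_product[OF is_partition_zero(1) mu lam, of ms] by simp
  have e: "card (lrchains n mu lam (\<lambda>_. 0) al) * nchains ms (\<lambda>_. 0) al = 0"
    if "al \<notin> partitions_of (sum_list ms) \<or> al \<notin> partitions_of (psize lam - psize mu)" for al
  proof (rule ccontr)
    assume "card (lrchains n mu lam (\<lambda>_. 0) al) * nchains ms (\<lambda>_. 0) al \<noteq> 0"
    then have *: "lrchains n mu lam (\<lambda>_. 0) al \<noteq> {}" "nchains ms (\<lambda>_. 0) al \<noteq> 0" by auto
    then obtain D where "D \<in> lrchains n mu lam (\<lambda>_. 0) al" by blast
    from lrchains_psize[OF this] have "psize al = psize lam - psize mu"
      by (simp add: psize_partition_len[OF mu] psize_partition_len[OF lam])
    moreover have "is_partition al" "psize al = sum_list ms" using nchains_nonzeroD[OF *(2)] by auto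
    ultimately show False using that by (simp add: partitions_of_def)
  qed
  show ?thesis
    unfolding 1
    by (rule sum.mono_neutral_cong[OF finite_partitions_of finite_partitions_of]) (use e in auto)
qed

lemma psum_interleave: "psum (interleave p q) (2 * n) = psum p n + psum q n"
proof (induction n)
  case (Suc n)
  have "psum (interleave p q) (2 * Suc n) = psum (interleave p q) (2 * n) + p n + q n"
    by (simp add: interleave_simps[simplified])
  then show ?case using Suc by simp
qed simp

lemma zigzags_psize:
  assumes "Z \<in> zigzags n mt lt ka"
  shows "psize ka + psum mt (2 * n) = psum lt (2 * n)"
proof -
  have "psize (Z m) + psum mt m = psum lt m" if "m \<le> 2 * n" for m
    using that
  proof (induction m)
    case 0 show ?case using zigzagsD(2)[OF assms] by simp
  next
    case (Suc m) then show ?case using zigzagsD(5)[OF assms, of m] by simp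
  qed
  from this[of "2 * n"] show ?thesis using zigzagsD(3)[OF assms] by simp
qed

text \<open>
  The expansion of the first factor is multiplied by the second factor, one Schur function at a time.
  The resulting sum over the intermediate shape \<open>al\<close> is the one in \<open>card_zigzags\<close>.
\<close>

theorem skew_schur_product_expansion:
  assumes lam: "partition_len n lam" and mu: "partition_len n mu"
    and nu: "partition_len n nu" and rho: "partition_len n rho"
  shows "series_mult (skew_schur lam mu) (skew_schur nu rho) =
    (\<Sum>ka \<in> partitions_of (psize lam + psize nu - (psize mu + psize rho)).
       series_scale (int (card (zigzags n (interleave mu rho) (interleave lam nu) ka))) (schur ka))"
proof
  fix M :: "nat multiset"
  let ?N = "psize lam + psize nu - (psize mu + psize rho)"
  let ?Z = "\<lambda>ka. card (zigzags n (interleave mu rho) (interleave lam nu) ka)"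
  let ?P = "partitions_of (psize lam - psize mu)"
  obtain C where C: "set_mset M \<subseteq> {..<C}"
    using finite_nat_set_iff_bounded[of "set_mset M"] by auto
  define ms where "ms = map (count M) [0..<C]"
  note p = lam[THEN partition_len_is_partition] mu[THEN partition_len_is_partition] nu[THEN partition_len_is_partition] rho[THEN partition_len_is_partition]
  have "(\<Sum>(xs, ys) \<in> splits ms. nchains xs mu lam * nchains ys rho nu) =
      (\<Sum>(xs, ys) \<in> splits ms. \<Sum>al\<in>?P. card (lrchains n mu lam (\<lambda>_. 0) al) * (nchains xs (\<lambda>_. 0) al * nchains ys rho nu))"
    by (simp add: nchains_skew_expansion[OF mu lam] sum_distrib_right mult.assoc)
  also have "\<dots> = (\<Sum>al\<in>?P. card (lrchains n mu lam (\<lambda>_. 0) al) *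
        (\<Sum>(xs, ys) \<in> splits ms. nchains xs (\<lambda>_. 0) al * nchains ys rho nu))"
    unfolding case_prod_unfold sum_distrib_left by (rule sum.swap)
  also have "\<dots> = (\<Sum>al\<in>?P. card (lrchains n mu lam (\<lambda>_. 0) al) *
        (\<Sum>ka \<in> partitions_of (sum_list ms). card (lrchains n rho nu al ka) * nchains ms (\<lambda>_. 0) ka))"
    by (intro sum.cong refl arg_cong2[where f = "(*)"] nchains_product[OF _ rho nu])
      (auto dest: partitions_ofD)
  also have "\<dots> = (\<Sum>ka \<in> partitions_of (sum_list ms). (\<Sum>al\<in>?P. card (lrchains n mu lam (\<lambda>_. 0) al) *
        card (lrchains n rho nu al ka)) * nchains ms (\<lambda>_. 0) ka)"
    unfolding sum_distrib_left sum_distrib_right mult.assoc by (rule sum.swap)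
  also have "\<dots> = (\<Sum>ka \<in> partitions_of (sum_list ms). ?Z ka * nchains ms (\<lambda>_. 0) ka)"
    by (intro sum.cong refl arg_cong2[where f = "(*)"] card_zigzags[OF mu lam, symmetric]) (auto dest: partitions_ofD)
  also have "\<dots> = (\<Sum>ka \<in> partitions_of ?N. ?Z ka * nchains ms (\<lambda>_. 0) ka)"
  proof -
    have e: "?Z ka * nchains ms (\<lambda>_. 0) ka = 0"
      if "ka \<notin> partitions_of (sum_list ms) \<or> ka \<notin> partitions_of ?N" for ka
    proof (rule ccontr)
      assume "?Z ka * nchains ms (\<lambda>_. 0) ka \<noteq> 0"
      then have *: "zigzags n (interleave mu rho) (interleave lam nu) ka \<noteq> {}" "nchains ms (\<lambda>_. 0) ka \<noteq> 0" by auto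
      then obtain Z where "Z \<in> zigzags n (interleave mu rho) (interleave lam nu) ka" by blast
      from zigzags_psize[OF this] have "psize ka = ?N"
        by (simp add: psum_interleave psize_partition_len[OF mu] psize_partition_len[OF lam]
            psize_partition_len[OF nu] psize_partition_len[OF rho])
      moreover have "is_partition ka" "psize ka = sum_list ms" using nchains_nonzeroD[OF *(2)] by auto
      ultimately show False using that by (simp add: partitions_of_def)
    qed
    show ?thesis
      by (rule sum.mono_neutral_cong[OF finite_partitions_of finite_partitions_of]) (use e in auto)
  qed
  finally have "series_mult (skew_schur lam mu) (skew_schur nu rho) M =
      (\<Sum>ka \<in> partitions_of ?N. int (?Z ka) * int (nchains ms (\<lambda>_. 0) ka))"
    unfolding series_mult_skew_schur[OF p C] ms_def[symmetric] by simp
  also have "\<dots> = (\<Sum>ka \<in> partitions_of ?N. int (?Z ka) * schur ka M)"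
    by (intro sum.cong refl) (simp add: ms_def schur_eq_nchains[OF _ C] partitions_ofD)
  finally show "series_mult (skew_schur lam mu) (skew_schur nu rho) M =
    (\<Sum>ka \<in> partitions_of ?N. series_scale (int (?Z ka)) (schur ka)) M"
    by (simp add: sum_series_apply series_scale_def)
qed

theorem theorem2p18:
  fixes n :: nat and lam mu nu rho kappa :: "nat \<Rightarrow> nat"
  assumes "n \<ge> 1"
    and "partition_len n lam" and "partition_len n mu"
    and "partition_len n nu" and "partition_len n rho"
    and "partition_len (2 * n) kappa"
  shows "finite (SkewSkep n lam mu nu rho kappa) \<and>
         lr_coeff lam mu nu rho kappa = int (card (SkewSkep n lam mu nu rho kappa))"
proof
  let ?Z = "zigzags n (interleave mu rho) (interleave lam nu)"
  let ?N = "psize lam + psize nu - (psize mu + psize rho)"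
  have bij: "bij_betw (zigzag_of n) (SkewSkep n lam mu nu rho kappa) (?Z kappa)"
    using skep_bij assms by blast
  have ka: "is_partition kappa" using assms(6) by (rule partition_len_is_partition)
  show "finite (SkewSkep n lam mu nu rho kappa)"
    using bij_betw_finite[OF bij] finite_zigzags[OF ka] by blast
  have basis: "schur p \<in> schur_basis" if "is_partition p" for p using that by (auto simp: schur_basis_eq)
  have "lr_coeff lam mu nu rho kappa =
      (\<Sum>p \<in> partitions_of ?N. series.representation schur_basis (series_scale (int (card (?Z p))) (schur p)) (schur kappa))"
    unfolding lr_coeff_def skew_schur_product_expansion[OF assms(2-5)]
    by (subst series.representation_sum[OF schur_basis_independent])
      (rule series.span_scale, rule series.span_base, rule basis, auto dest: partitions_ofD)
  also have "\<dots> = (\<Sum>p \<in> partitions_of ?N. if kappa = p then int (card (?Z p)) else 0)"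
  proof (rule sum.cong[OF refl])
    fix p assume "p \<in> partitions_of ?N"
    then have p: "is_partition p" by (rule partitions_ofD)
    show "series.representation schur_basis (series_scale (int (card (?Z p))) (schur p)) (schur kappa)
        = (if kappa = p then int (card (?Z p)) else 0)"
      using schur_inject[OF ka p]
      by (simp add: series.representation_scale[OF schur_basis_independent series.span_base[OF basis[OF p]]]
          series.representation_basis[OF schur_basis_independent basis[OF p]])
  qed
  also have "\<dots> = int (card (?Z kappa))"
  proof (cases "kappa \<in> partitions_of ?N")
    case True
    then show ?thesis by (simp add: finite_partitions_of)
  next
    case False
    have "?Z kappa = {}"
    proof (rule ccontr)
      assume "?Z kappa \<noteq> {}"
      then obtain Z where "Z \<in> ?Z kappa" by blast
      from zigzags_psize[OF this] have "psize kappa = ?N"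
        using assms by (simp add: psum_interleave psize_partition_len)
      then show False using False ka by (simp add: partitions_of_def)
    qed
    then show ?thesis using False by (simp add: finite_partitions_of)
  qed
  also have "card (?Z kappa) = card (SkewSkep n lam mu nu rho kappa)"
    using bij_betw_same_card[OF bij] by simp
  finally show "lr_coeff lam mu nu rho kappa = int (card (SkewSkep n lam mu nu rho kappa))" .
qed

end
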